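(* Let $S,T$ be commuting bounded operators on a complex Hilbert space with $S^2=T^2$. Then $S,T$ dilate to a commuting pair of unitaries $U,V$ satisfying $U^2=V^2$ if and only if $$\|\lambda S+(1-\lambda)T\|\le 1$$ for every complex number $\lambda$ on the circle $|\lambda-\tfrac12|=\tfrac12$.
   Context: A pair $(S,T)$ of commuting operators on a Hilbert space $H$ dilates to a commuting pair $(U,V)$ of operators on a Hilbert space $K$ if there is an isometry $\iota:H\to K$ such that $p(S,T)=\iota^*p(U,V)\iota$ for all polynomials $p(z,w)$ in two variables. *)

theory Defs
  imports
    Complex_Main
    "HOL-Computational_Algebra.Polynomial"
    "HOL-Algebra.Module"
begin

text \<open>
  The theorem asserts the existence of a Hilbert space, so Hilbert spaces are represented by
  structures with a carrier (modules in the sense of HOL-Algebra over the field of complex numbers,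
  together with an inner product), not by a type class.
\<close>

definition complex_ring :: "complex ring" where
  "complex_ring = \<lparr>carrier = UNIV, monoid.mult = (*), one = 1, zero = 0, add = (+)\<rparr>"

text \<open>
  The record fields \<open>mult\<close> and \<open>one\<close>, which the module record of HOL-Algebra
  inherits from rings, play no role.
\<close>

record 'a hilbert = "(complex, 'a) module" +
  cinner :: "'a \<Rightarrow> 'a \<Rightarrow> complex"

definition hnorm :: "'a hilbert \<Rightarrow> 'a \<Rightarrow> real" where
  "hnorm H x = sqrt (Re (cinner H x x))"

text \<open>The inner product is linear in its first argument.\<close>

locale hilbert_space = Module.module complex_ring H for H :: "'a hilbert" (structure) +
  assumes cinner_commute:
      "\<lbrakk>x \<in> carrier H; y \<in> carrier H\<rbrakk> \<Longrightarrow> cinner H x y = cnj (cinner H y x)"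
    and cinner_add_left:
      "\<lbrakk>x \<in> carrier H; y \<in> carrier H; z \<in> carrier H\<rbrakk> \<Longrightarrow>
        cinner H (x \<oplus> y) z = cinner H x z + cinner H y z"
    and cinner_smult_left:
      "\<lbrakk>x \<in> carrier H; y \<in> carrier H\<rbrakk> \<Longrightarrow> cinner H (c \<odot> x) y = c * cinner H x y"
    and cinner_nonneg: "x \<in> carrier H \<Longrightarrow> 0 \<le> Re (cinner H x x)"
    and cinner_definite: "\<lbrakk>x \<in> carrier H; cinner H x x = 0\<rbrakk> \<Longrightarrow> x = \<zero>"
    and complete:
      "\<lbrakk>\<And>n. X n \<in> carrier H;
        \<And>e. e > 0 \<Longrightarrow> \<exists>N. \<forall>m\<ge>N. \<forall>n\<ge>N. hnorm H (X m \<ominus> X n) < e\<rbrakk> \<Longrightarrow>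
        \<exists>L\<in>carrier H. (\<lambda>n. hnorm H (X n \<ominus> L)) \<longlonglongrightarrow> 0"

definition bounded_operator :: "'a hilbert \<Rightarrow> 'b hilbert \<Rightarrow> ('a \<Rightarrow> 'b) \<Rightarrow> bool" where
  "bounded_operator H K A \<longleftrightarrow>
    (\<forall>x\<in>carrier H. A x \<in> carrier K) \<and>
    (\<forall>x\<in>carrier H. \<forall>y\<in>carrier H. A (x \<oplus>\<^bsub>H\<^esub> y) = A x \<oplus>\<^bsub>K\<^esub> A y) \<and>
    (\<forall>c. \<forall>x\<in>carrier H. A (c \<odot>\<^bsub>H\<^esub> x) = c \<odot>\<^bsub>K\<^esub> A x) \<and>
    (\<exists>C. \<forall>x\<in>carrier H. hnorm K (A x) \<le> C * hnorm H x)"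

definition operator_norm :: "'a hilbert \<Rightarrow> 'b hilbert \<Rightarrow> ('a \<Rightarrow> 'b) \<Rightarrow> real" where
  "operator_norm H K A = (SUP x\<in>{x \<in> carrier H. hnorm H x \<le> 1}. hnorm K (A x))"

text \<open>
  \<open>B\<close> is the adjoint of \<open>A\<close>; on \<open>carrier K\<close> it is determined by this property.
\<close>

definition is_adjoint :: "'a hilbert \<Rightarrow> 'b hilbert \<Rightarrow> ('a \<Rightarrow> 'b) \<Rightarrow> ('b \<Rightarrow> 'a) \<Rightarrow> bool" where
  "is_adjoint H K A B \<longleftrightarrow> bounded_operator K H B \<and>
    (\<forall>x\<in>carrier H. \<forall>y\<in>carrier K. cinner K (A x) y = cinner H x (B y))"

definition isometry :: "'a hilbert \<Rightarrow> 'b hilbert \<Rightarrow> ('a \<Rightarrow> 'b) \<Rightarrow> bool" where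
  "isometry H K A \<longleftrightarrow> bounded_operator H K A \<and> (\<forall>x\<in>carrier H. hnorm K (A x) = hnorm H x)"

definition unitary :: "'a hilbert \<Rightarrow> ('a \<Rightarrow> 'a) \<Rightarrow> bool" where
  "unitary H U \<longleftrightarrow> bounded_operator H H U \<and>
    (\<exists>U'. is_adjoint H H U U' \<and> (\<forall>x\<in>carrier H. U' (U x) = x \<and> U (U' x) = x))"

definition operators_commute :: "'a hilbert \<Rightarrow> ('a \<Rightarrow> 'a) \<Rightarrow> ('a \<Rightarrow> 'a) \<Rightarrow> bool" where
  "operators_commute H A B \<longleftrightarrow> (\<forall>x\<in>carrier H. A (B x) = B (A x))"

definition equal_squares :: "'a hilbert \<Rightarrow> ('a \<Rightarrow> 'a) \<Rightarrow> ('a \<Rightarrow> 'a) \<Rightarrow> bool" where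
  "equal_squares H A B \<longleftrightarrow> (\<forall>x\<in>carrier H. A (A x) = B (B x))"

text \<open>
  A polynomial \<open>p(z, w)\<close> is an element of \<open>\<complex>[z][w]\<close>: the coefficient of
  \<open>z\<^sup>j w\<^sup>i\<close> is \<open>coeff (coeff p i) j\<close>.
\<close>

definition poly_op ::
    "'a hilbert \<Rightarrow> complex poly poly \<Rightarrow> ('a \<Rightarrow> 'a) \<Rightarrow> ('a \<Rightarrow> 'a) \<Rightarrow> 'a \<Rightarrow> 'a" where
  "poly_op H p A B x =
    (\<Oplus>\<^bsub>H\<^esub>i\<in>{..degree p}. \<Oplus>\<^bsub>H\<^esub>j\<in>{..degree (coeff p i)}.
      coeff (coeff p i) j \<odot>\<^bsub>H\<^esub> (A ^^ j) ((B ^^ i) x))"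

definition dilates_to ::
    "'a hilbert \<Rightarrow> ('a \<Rightarrow> 'a) \<Rightarrow> ('a \<Rightarrow> 'a) \<Rightarrow>
     'b hilbert \<Rightarrow> ('b \<Rightarrow> 'b) \<Rightarrow> ('b \<Rightarrow> 'b) \<Rightarrow> bool" where
  "dilates_to H S T K U V \<longleftrightarrow>
    (\<exists>\<iota> \<iota>'. isometry H K \<iota> \<and> is_adjoint H K \<iota> \<iota>' \<and>
      (\<forall>p. \<forall>x\<in>carrier H. poly_op H p S T x = \<iota>' (poly_op K p U V (\<iota> x))))"

text \<open>
  Existence of a dilating Hilbert space \<open>K\<close> whose elements have type \<open>'b\<close>. HOL cannot
  quantify over types inside a formula, so the type is a parameter. For \<open>H\<close> over \<open>'a\<close>,
  the type \<open>nat \<times> 'a \<Rightarrow> complex\<close> is large enough: it contains the square-summable families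
  indexed by \<open>nat \<times> 'a\<close>, and hence a copy of every Hilbert space that is generated by
  countably many images of \<open>H\<close>, such as a minimal dilation space.
\<close>

definition dilates_to_unitaries ::
    "'b itself \<Rightarrow> 'a hilbert \<Rightarrow> ('a \<Rightarrow> 'a) \<Rightarrow> ('a \<Rightarrow> 'a) \<Rightarrow> bool" where
  "dilates_to_unitaries TY H S T \<longleftrightarrow>
    (\<exists>(K :: 'b hilbert) U V. hilbert_space K \<and> unitary K U \<and> unitary K V \<and>
      operators_commute K U V \<and> equal_squares K U V \<and> dilates_to H S T K U V)"

end

theory Submission
  imports
    Defs
    "HOL-Library.Countable"
    "HOL-Library.Function_Algebras"
    "HOL-Library.Poly_Mapping"
begin

text \<open>
  Put $A = (S+T)/2$ and $B = (S-T)/2$. Since $S$ and $T$ commute and have equal squares,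
  $AB = BA = 0$, and $\lambda S + (1-\lambda) T = A + \mu B$ with $\mu = 2\lambda - 1$, so the circle
  condition says that $\|A + \mu B\| \le 1$ for all $|\mu| = 1$. A commuting pair of unitaries with
  $U^2 = V^2$ is a unitary $U$ together with the reflection $U^{-1} V$ that commutes with it: $V = U$
  on one reducing subspace and $V = -U$ on its complement.

  Necessity is a computation: $\lambda U + (1-\lambda) V$ is isometric on the circle
  (\<open>unitary_pencil_isometric\<close>) and compression does not increase norms.

  For sufficiency one has to split the inner product of $H$ into two positive forms, $E$ and $F$, such
  that the Toeplitz kernel with diagonal $E$ and off-diagonal entries $A^n$ and the one with diagonal
  $F$ and off-diagonal entries $B^n$ are both positive. The two kernels then generate a Hilbert space on
  which the shift of the index is the required $U$, and $V$ is this shift with its sign changed on the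
  second kernel. The diagonals add up to the inner product, and $S^j T^i = A^n + (-1)^i B^n$ for
  $n = i + j > 0$, so the compressions are the right ones.

  The splitting exists by a Hahn--Banach argument on the span of the functions $z \mapsto |\langle z, x\rangle|^2$
  (\<open>splitting_form\<close>). Its consistency condition is \<open>mixed_shift_inequality\<close>: if $h$ and $k$ are
  finite families of vectors with the same Gram function, $a_i$ collects the terms that the powers of
  $A$ contribute at $h_i$, and $b_j$ those that the powers of $B$ contribute at $k_j$, then
  $\sum \|h_i\|^2 + 2 \mathrm{Re} \sum \langle h_i, a_i\rangle + 2 \mathrm{Re} \sum \langle k_j, b_j\rangle \ge 0$.
  Equal Gram functions mean that a partial isometry $w$ carries one family to the other. Glue the two
  coefficient spaces along $w$; the two shifts $V_1$ and $V_2$ become contractions of one space, the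
  operator $C = A \otimes V_1 + B \otimes V_2$ is a contraction, and because $AB = BA = 0$ its powers are
  $A^n \otimes V_1^n + B^n \otimes V_2^n$. The inequality is the positivity of
  $1 + 2 \mathrm{Re} \sum_n C^n$. That $C$ is a contraction for arbitrary $V_1, V_2$ and not
  only for commuting ones follows from a theorem of Ando (\<open>Ando_form\<close>): there is a positive form
  $Z \le \langle\cdot,\cdot\rangle$ with $\|Ax + By\|^2 \le (\|x\|^2 - Z(x)) + Z(y)$ for all $x$, $y$.

  To avoid carrier conditions, the analysis takes place on the whole type of functions from the
  elements of $H$ to the complex numbers, with a degenerate inner product pulled back from $H$ along a
  linear retraction (\<open>linear_section\<close>).
\<close>

section \<open>Positive semidefinite forms\<close>

text \<open>
  Inner products that may be degenerate, as functions on a whole type. The inner product of $H$, the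
  Ando form, the two halves of the splitting and the inner product before completion all have this shape,
  and families of vectors are compared by testing them against all such forms.
\<close>
locale psd_form = vector_space scale
  for scale :: "complex \<Rightarrow> 'v::ab_group_add \<Rightarrow> 'v" (infixr "*s" 75) +
  fixes f :: "'v \<Rightarrow> 'v \<Rightarrow> complex"
  assumes add_left: "f (x + y) z = f x z + f y z"
    and scale_left: "f (c *s x) y = c * f x y"
    and hermitian: "f x y = cnj (f y x)"
    and nonneg: "0 \<le> Re (f x x)"
begin

definition sq :: "'v \<Rightarrow> real" where "sq x = Re (f x x)"

lemma add_right: "f x (y + z) = f x y + f x z"
  by (metis add_left complex_cnj_add hermitian)

lemma scale_right: "f x (c *s y) = cnj c * f x y"
  by (metis complex_cnj_mult hermitian scale_left)

lemma zero_left [simp]: "f 0 y = 0"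
  using scale_left[of 0 0 y] by simp

lemma zero_right [simp]: "f x 0 = 0"
  using scale_right[of x 0 0] by simp

lemma minus_left: "f (- x) y = - f x y"
  using add_left[of x "- x" y] by (simp add: eq_neg_iff_add_eq_0 add.commute)

lemma minus_right: "f x (- y) = - f x y"
  using add_right[of x y "- y"] by (simp add: eq_neg_iff_add_eq_0 add.commute)

lemma diff_left: "f (x - y) z = f x z - f y z"
  using add_left[of x "- y" z] by (simp add: minus_left)

lemma diff_right: "f x (y - z) = f x y - f x z"
  using add_right[of x y "- z"] by (simp add: minus_right)

lemma sum_left: "f (sum g I) y = (\<Sum>i\<in>I. f (g i) y)"
  by (induction I rule: infinite_finite_induct) (auto simp: add_left)

lemma sum_right: "f x (sum g I) = (\<Sum>i\<in>I. f x (g i))"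
  by (induction I rule: infinite_finite_induct) (auto simp: add_right)

lemma Re_commute: "Re (f x y) = Re (f y x)"
  by (subst hermitian) simp

lemma self_real: "f x x = complex_of_real (sq x)"
proof -
  have "Im (f x x) = - Im (f x x)" by (subst hermitian) simp
  then show ?thesis by (simp add: sq_def complex_eq_iff)
qed

lemma sq_nonneg [simp]: "0 \<le> sq x"
  using nonneg by (simp add: sq_def)

lemma sq_zero [simp]: "sq 0 = 0" by (simp add: sq_def)

lemma sq_add: "sq (x + y) = sq x + sq y + 2 * Re (f x y)"
  using Re_commute[of x y] by (simp add: sq_def add_left add_right)

lemma sq_diff: "sq (x - y) = sq x + sq y - 2 * Re (f x y)"
  using Re_commute[of x y] by (simp add: sq_def diff_left diff_right)

lemma sq_minus: "sq (- x) = sq x"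
  by (simp add: sq_def minus_left minus_right)

lemma sq_scale: "sq (c *s x) = (cmod c)\<^sup>2 * sq x"
proof -
  have "f (c *s x) (c *s x) = (c * cnj c) * f x x"
    by (simp add: scale_left scale_right)
  then show ?thesis
    by (simp add: sq_def complex_norm_square[symmetric])
qed

lemma parallelogram: "sq (x + y) + sq (x - y) = 2 * sq x + 2 * sq y"
  by (simp add: sq_add sq_diff)

lemma Cauchy_Schwarz: "(cmod (f x y))\<^sup>2 \<le> sq x * sq y"
proof -
  let ?c = "f x y"
  have key: "0 \<le> sq x - 2 * t * (cmod ?c)\<^sup>2 + t\<^sup>2 * (cmod ?c)\<^sup>2 * sq y" for t :: real
  proof -
    have "Re (f x ((complex_of_real t * ?c) *s y)) = t * (cmod ?c)\<^sup>2"
      unfolding scale_right cmod_power2 by (simp add: power2_eq_square algebra_simps)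
    then have "sq (x - (complex_of_real t * ?c) *s y)
        = sq x - 2 * t * (cmod ?c)\<^sup>2 + t\<^sup>2 * (cmod ?c)\<^sup>2 * sq y"
      by (simp add: sq_diff sq_scale norm_mult power_mult_distrib)
    then show ?thesis by (metis sq_nonneg)
  qed
  show ?thesis
  proof (cases "sq y = 0")
    case True
    have "(cmod ?c)\<^sup>2 = 0"
    proof (rule ccontr)
      assume ne: "(cmod ?c)\<^sup>2 \<noteq> 0"
      have "0 \<le> sq x - 2 * ((sq x + 1) / (2 * (cmod ?c)\<^sup>2)) * (cmod ?c)\<^sup>2"
        using key[of "(sq x + 1) / (2 * (cmod ?c)\<^sup>2)"] True by simp
      also have "\<dots> = -1" using ne by (simp add: field_simps)
      finally show False by simp
    qed
    then show ?thesis using True by simp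
  next
    case False
    then have pos: "sq y > 0" using sq_nonneg[of y] by linarith
    have "0 \<le> sq x - (cmod ?c)\<^sup>2 / sq y"
      using key[of "1 / sq y"] pos by (simp add: power2_eq_square field_simps)
    then show ?thesis using pos by (simp add: field_simps)
  qed
qed

lemma null_left: assumes "sq x = 0" shows "f x y = 0"
  using Cauchy_Schwarz[of x y] assms by simp

lemma null_right: assumes "sq y = 0" shows "f x y = 0"
  using Cauchy_Schwarz[of x y] assms by simp

lemma eq_of_null_diff: assumes "sq (x - y) = 0" shows "f x z = f y z" "f z x = f z y"
  using null_left[OF assms, of z] null_right[OF assms, of z]
  by (simp_all add: diff_left diff_right)

end

text \<open>
  The deviation $d(t) = \phi(t) - t \phi(1)$ is additive with period $1$. Being bounded on $[0,1]$ it is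
  bounded everywhere, and then $d(nt) = n\,d(t)$ forces $d = 0$. The quadratic growth bound is what the
  parallelogram law provides for nonnegative functions.
\<close>
lemma additive_bounded_imp_linear:
  fixes \<phi> :: "real \<Rightarrow> real"
  assumes add: "\<And>s t. \<phi> (s + t) = \<phi> s + \<phi> t"
    and bound: "\<And>t. \<bar>\<phi> t\<bar> \<le> C * t\<^sup>2 + D"
  shows "\<phi> t = t * \<phi> 1"
proof -
  define d where "d t = \<phi> t - t * \<phi> 1" for t
  have dadd: "d (s + t) = d s + d t" for s t by (simp add: d_def add algebra_simps)
  have d0: "d 0 = 0" using dadd[of 0 0] by simp
  have dn: "d (real n * t) = real n * d t" for n t
    by (induction n) (auto simp: d0 dadd distrib_right)
  have d1: "d 1 = 0" by (simp add: d_def)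
  have dnat: "d (real n) = 0" for n using dn[of n 1] d1 by simp
  have dneg: "d (- t) = - d t" for t using dadd[of t "- t"] d0 by simp
  have dint: "d (of_int k) = 0" for k
  proof (cases k)
    case (nonneg n) then show ?thesis using dnat by simp
  next
    case (neg n)
    then have "(of_int k :: real) = - real (Suc n)" by simp
    then show ?thesis using dneg[of "real (Suc n)"] dnat[of "Suc n"] by (metis minus_zero)
  qed
  have dfrac: "d t = d (frac t)" for t
    using dadd[of "frac t" "of_int \<lfloor>t\<rfloor>"] dint by (simp add: frac_def)
  have bd: "\<bar>d t\<bar> \<le> \<bar>C\<bar> + D + \<bar>\<phi> 1\<bar>" for t
  proof -
    have fr: "0 \<le> frac t" "frac t \<le> 1" using frac_ge_0[of t] frac_lt_1[of t] by auto
    have a: "\<bar>\<phi> (frac t)\<bar> \<le> C * (frac t)\<^sup>2 + D" by (rule bound)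
    have "C * (frac t)\<^sup>2 \<le> \<bar>C\<bar> * (frac t)\<^sup>2" by (intro mult_right_mono) auto
    also have "\<dots> \<le> \<bar>C\<bar> * 1" using fr by (intro mult_left_mono) (auto simp: power_le_one)
    finally have b: "C * (frac t)\<^sup>2 \<le> \<bar>C\<bar>" by simp
    have c: "\<bar>frac t * \<phi> 1\<bar> \<le> \<bar>\<phi> 1\<bar>"
      using mult_right_mono[of "frac t" 1 "\<bar>\<phi> 1\<bar>"] fr by (simp add: abs_mult)
    show ?thesis unfolding dfrac[of t] using a b c by (simp add: d_def)
  qed
  have "d t = 0"
  proof (rule ccontr)
    assume ne: "d t \<noteq> 0"
    obtain n where n: "\<bar>C\<bar> + D + \<bar>\<phi> 1\<bar> < real n * \<bar>d t\<bar>"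
      using ne reals_Archimedean3[of "\<bar>d t\<bar>"] by auto
    have "\<bar>d (real n * t)\<bar> = real n * \<bar>d t\<bar>" by (simp add: dn abs_mult)
    then show False using bd[of "real n * t"] n by simp
  qed
  then show ?thesis by (simp add: d_def)
qed

text \<open>
  Both forms that the proof constructs arise as functions of one vector, once as a supremum and once
  from a Hahn--Banach functional; the parallelogram law is the property that is visible there.
\<close>
theorem Jordan_von_Neumann:
  fixes scale :: "complex \<Rightarrow> 'v::ab_group_add \<Rightarrow> 'v" (infixr "*s" 75)
  assumes vs: "vector_space scale"
    and par: "\<And>x y. q (x + y) + q (x - y) = 2 * q x + 2 * q y"
    and hom: "\<And>c x. q (c *s x) = (cmod c)\<^sup>2 * q x"
    and nonneg: "\<And>x. (0::real) \<le> q x"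
  obtains F where "psd_form scale F" "\<And>x. Re (F x x) = q x"
proof -
  interpret vector_space scale by (rule vs)
  have q0: "q 0 = 0" using par[of 0 0] by simp
  have qm: "q (- x) = q x" for x using par[of 0 x] q0 by simp
  define b where "b x y = q (x + y) - q (x - y)" for x y
  have bsym: "b x y = b y x" for x y
    using qm[of "x - y"] by (simp add: b_def add.commute)
  have b0: "b 0 y = 0" for y by (simp add: b_def qm)
  have bmid: "b (x + z) y + b (x - z) y = 2 * b x y" for x y z
  proof -
    have e: "x + z + y = (x + y) + z" "x - z + y = (x + y) - z"
      "x + z - y = (x - y) + z" "x - z - y = (x - y) - z" by (simp_all add: algebra_simps)
    have "b (x + z) y = q ((x + y) + z) - q ((x - y) + z)"
      "b (x - z) y = q ((x + y) - z) - q ((x - y) - z)" by (simp_all only: b_def e)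
    moreover have "b x y = q (x + y) - q (x - y)" by (simp only: b_def)
    ultimately show ?thesis using par[of "x + y" z] par[of "x - y" z] by linarith
  qed
  have b2: "b (x + x) y = 2 * b x y" for x y
    using bmid[of x x y] b0 by simp
  have half: "(1/2) *s u + (1/2) *s u = u" for u
    by (simp flip: scale_left_distrib)
  have badd: "b (u + v) y = b u y + b v y" for u v y
  proof -
    (* The midpoint identity for u = x + z and v = x - z. *)
    define x z where "x = (1/2) *s (u + v)" and "z = (1/2) *s (u - v)"
    have s: "x + z = u" "x - z = v"
      using half[of u] half[of v] by (simp_all add: x_def z_def algebra_simps)
    have "x + x = u + v" using half[of "u + v"] by (simp add: x_def)
    then show ?thesis using bmid[of x z y] b2[of x y] s by simp
  qed
  have baddr: "b y (u + v) = b y u + b y v" for u v y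
    using badd[of u v y] by (simp add: bsym)
  have breal: "b (complex_of_real t *s x) y = t * b x y" for t x y
  proof -
    have "(\<lambda>t. b (complex_of_real t *s x) y) t = t * (\<lambda>t. b (complex_of_real t *s x) y) 1"
    proof (rule additive_bounded_imp_linear)
      show "b (complex_of_real (s + t) *s x) y
          = b (complex_of_real s *s x) y + b (complex_of_real t *s x) y" for s t
        by (simp add: scale_left_distrib badd)
      show "\<bar>b (complex_of_real t *s x) y\<bar> \<le> (2 * q x) * t\<^sup>2 + 2 * q y" for t
        using par[of "complex_of_real t *s x" y] nonneg[of "complex_of_real t *s x + y"]
          nonneg[of "complex_of_real t *s x - y"] hom[of "complex_of_real t" x]
        by (simp add: b_def abs_le_iff algebra_simps)
    qed
    then show ?thesis by simp
  qed
  have bii: "b (\<i> *s x) (\<i> *s y) = b x y" for x y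
    using hom[of \<i> "x + y"] hom[of \<i> "x - y"]
    by (simp add: b_def scale_right_distrib scale_right_diff_distrib)
  have bm: "b (- x) y = - b x y" for x y using badd[of x "- x" y] b0 by simp
  have bmr: "b y (- x) = - b y x" for x y using bm bsym by metis
  have ii: "\<i> *s \<i> *s x = - x" for x by (simp add: scale_minus_left)
  have bi: "b x (\<i> *s y) = - b (\<i> *s x) y" for x y
    using bii[of x "\<i> *s y"] by (simp add: ii bmr)
  define F where "F x y = Complex (b x y / 4) (b x (\<i> *s y) / 4)" for x y
  have Fi: "F (\<i> *s x) y = \<i> * F x y" for x y
    by (simp add: F_def complex_eq_iff bi ii bm)
  have Fadd: "F (x + y) z = F x z + F y z" for x y z
    by (simp add: F_def complex_eq_iff badd add_divide_distrib)
  have Freal: "F (complex_of_real t *s x) y = complex_of_real t * F x y" for t x y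
    by (simp add: F_def complex_eq_iff breal)
  show thesis
  proof (rule that)
    show "psd_form scale F"
    proof
      fix x y z :: 'v and c :: complex
      show "F (x + y) z = F x z + F y z" by (rule Fadd)
      have c: "c *s x = complex_of_real (Re c) *s x + \<i> *s complex_of_real (Im c) *s x"
        using complex_eq[of c] by (simp flip: scale_left_distrib)
      show "F (c *s x) y = c * F x y"
        unfolding c Fadd Fi Freal by (simp add: complex_eq_iff)
      show "F x y = cnj (F y x)"
        using bi[of x y] bsym by (simp add: F_def complex_eq_iff)
      have "b x x = 4 * q x"
        using par[of x x] q0 by (simp add: b_def)
      then show "0 \<le> Re (F x x)" using nonneg by (simp add: F_def)
    qed
    show "Re (F x x) = q x" for x
      using par[of x x] q0 by (simp add: F_def b_def)
  qed
qed

section \<open>Contractive pencils and the Ando form\<close>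

text \<open>
  For $n \ne m$ the terms are the powers of an $M$-th root of unity other than $1$.
\<close>
lemma roots_of_unity_orthogonal:
  assumes "n < M" "m < M"
  shows "(\<Sum>k<M. cis (2 * pi * real k * real n / real M) * cnj (cis (2 * pi * real k * real m / real M)))
    = (if n = m then of_nat M else 0)"
proof -
  have M: "0 < real M" using assms by simp
  define z where "z = cis (2 * pi * ((real n - real m) / real M))"
  have zk: "cis (2 * pi * real k * real n / real M) * cnj (cis (2 * pi * real k * real m / real M)) = z ^ k" for k
  proof -
    have "2 * pi * real k * real n / real M - 2 * pi * real k * real m / real M
        = real k * (2 * pi * ((real n - real m) / real M))"
      using M by (simp add: field_simps)
    then show ?thesis by (simp add: z_def cis_cnj cis_mult DeMoivre)
  qed
  show ?thesis
  proof (cases "n = m")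
    case True
    then have "z = 1" by (simp add: z_def)
    then show ?thesis unfolding zk using True by simp
  next
    case False
    have zM: "z ^ M = 1"
    proof -
      have "z ^ M = cis (2 * pi * (real n - real m))"
        using M by (simp add: z_def DeMoivre)
      then show ?thesis by (simp add: cis_multiple_2pi)
    qed
    have "z \<noteq> 1"
    proof
      assume "z = 1"
      then have "cos (2 * pi * ((real n - real m) / real M)) = 1"
        by (simp add: z_def complex_eq_iff)
      then obtain j :: int where "2 * pi * ((real n - real m) / real M) = of_int j * 2 * pi"
        using cos_one_2pi_int by auto
      then have "(2 * pi) * ((real n - real m) / real M) = (2 * pi) * of_int j"
        by (simp only: mult_ac)
      then have "(real n - real m) / real M = of_int j"
        by (subst (asm) mult_cancel_left) simp
      then have "real n - real m = of_int j * real M" using M by (simp add: field_simps)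
      then have e: "int n - int m = j * int M"
        by (metis of_int_diff of_int_eq_iff of_int_mult of_int_of_nat_eq)
      have "\<bar>int n - int m\<bar> < int M" using assms by simp
      then have "\<bar>j\<bar> * int M < 1 * int M" by (simp add: e abs_mult)
      then have "\<bar>j\<bar> < 1" unfolding mult_less_cancel_right by linarith
      then have "j = 0" by simp
      then show False using e False by simp
    qed
    then show ?thesis using False zM by (simp add: zk geometric_sum)
  qed
qed

lemma (in psd_form) discrete_Parseval:
  "(\<Sum>k<M. sq (\<Sum>n<M. cis (2 * pi * real k * real n / real M) *s g n)) = real M * (\<Sum>n<M. sq (g n))"
proof -
  let ?e = "\<lambda>k n. cis (2 * pi * real k * real n / real M)"
  have "(\<Sum>k<M. f (\<Sum>n<M. ?e k n *s g n) (\<Sum>n<M. ?e k n *s g n))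
      = (\<Sum>k<M. \<Sum>n<M. \<Sum>m<M. (?e k n * cnj (?e k m)) * f (g n) (g m))"
    unfolding sum_left unfolding sum_right by (simp add: scale_left scale_right mult_ac)
  also have "\<dots> = (\<Sum>n<M. \<Sum>m<M. \<Sum>k<M. (?e k n * cnj (?e k m)) * f (g n) (g m))"
    by (subst sum.swap, intro sum.cong refl sum.swap)
  also have "\<dots> = (\<Sum>n<M. \<Sum>m<M. (if n = m then of_nat M else 0) * f (g n) (g m))"
    by (intro sum.cong refl) (simp only: sum_distrib_right[symmetric] roots_of_unity_orthogonal lessThan_iff)
  also have "\<dots> = (\<Sum>n<M. of_nat M * f (g n) (g n))"
    by (intro sum.cong refl) (simp add: if_distrib[where f = "\<lambda>x. x * _"] cong: if_cong)
  finally have "complex_of_real (\<Sum>k<M. sq (\<Sum>n<M. ?e k n *s g n)) = complex_of_real (real M * (\<Sum>n<M. sq (g n)))"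
    by (simp add: self_real sum_distrib_left)
  then show ?thesis unfolding of_real_eq_iff .
qed

locale contractive_pencil = psd_form scale ip
  for scale :: "complex \<Rightarrow> 'v::ab_group_add \<Rightarrow> 'v" (infixr "*s" 75) and ip +
  fixes A B :: "'v \<Rightarrow> 'v"
  assumes A_add: "A (x + y) = A x + A y" and A_scale: "A (c *s x) = c *s A x"
    and B_add: "B (x + y) = B x + B y" and B_scale: "B (c *s x) = c *s B x"
    and AB: "A (B x) = 0" and BA: "B (A x) = 0"
    and pencil: "cmod \<mu> = 1 \<Longrightarrow> sq (A x + \<mu> *s B x) \<le> sq x"
begin

lemma A_zero [simp]: "A 0 = 0" using A_scale[of 0 0] by simp
lemma B_zero [simp]: "B 0 = 0" using B_scale[of 0 0] by simp
lemma A_minus: "A (- x) = - A x" using A_scale[of "-1" x] by simp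
lemma B_minus: "B (- x) = - B x" using B_scale[of "-1" x] by simp
lemma A_diff: "A (x - y) = A x - A y" using A_add[of x "- y"] by (simp add: A_minus)
lemma B_diff: "B (x - y) = B x - B y" using B_add[of x "- y"] by (simp add: B_minus)
lemma A_sum: "A (sum g I) = (\<Sum>i\<in>I. A (g i))"
  by (induction I rule: infinite_finite_induct) (auto simp: A_add)
lemma B_sum: "B (sum g I) = (\<Sum>i\<in>I. B (g i))"
  by (induction I rule: infinite_finite_induct) (auto simp: B_add)

lemma swapped: "contractive_pencil scale ip B A"
proof unfold_locales
  fix x y :: 'v and c \<mu> :: complex
  show "B (x + y) = B x + B y" "B (c *s x) = c *s B x" "A (x + y) = A x + A y" "A (c *s x) = c *s A x"
    "B (A x) = 0" "A (B x) = 0"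
    by (simp_all add: A_add A_scale B_add B_scale AB BA)
  assume m: "cmod \<mu> = 1"
  then have n: "\<mu> \<noteq> 0" by auto
  have "B x + \<mu> *s A x = \<mu> *s (A x + inverse \<mu> *s B x)"
    using n by (simp add: scale_right_distrib add.commute)
  then have "sq (B x + \<mu> *s A x) = sq (A x + inverse \<mu> *s B x)"
    using m by (simp add: sq_scale)
  then show "sq (B x + \<mu> *s A x) \<le> sq x"
    using pencil[of "inverse \<mu>" x] m by (simp add: norm_inverse)
qed

text \<open>
  The operator $h \mapsto (A h_{n+1} + B h_n)_n$ on finite sequences becomes $A + \mu B$ under the discrete
  Fourier transform. With $M = N + 1$ points and $h_N = 0$ the cyclic shift does not wrap around.
\<close>
lemma shifted_pencil:
  fixes h :: "nat \<Rightarrow> 'v"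
  assumes h: "h N = 0"
  shows "sq (A (h 0)) + (\<Sum>n<N. sq (A (h (Suc n)) + B (h n))) \<le> (\<Sum>n<N. sq (h n))"
proof -
  define M where "M = Suc N"
  define g where "g n = (case n of 0 \<Rightarrow> A (h 0) | Suc n \<Rightarrow> A (h (Suc n)) + B (h n))" for n
  let ?e = "\<lambda>k n. cis (2 * pi * real k * real n / real M)"
  have F: "sq (\<Sum>n<M. ?e k n *s g n) \<le> sq (\<Sum>n<M. ?e k n *s h n)" for k
  proof -
    have e: "?e k (Suc n) = ?e k 1 * ?e k n" for n
      by (simp add: cis_mult add_divide_distrib[symmetric] distrib_left)
    have "(\<Sum>n<M. ?e k n *s g n)
        = A (h 0) + (\<Sum>n<N. ?e k (Suc n) *s A (h (Suc n))) + (\<Sum>n<N. ?e k (Suc n) *s B (h n))"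
      unfolding M_def sum.lessThan_Suc_shift
      by (simp add: g_def scale_right_distrib sum.distrib del: of_nat_Suc)
    also have "A (h 0) + (\<Sum>n<N. ?e k (Suc n) *s A (h (Suc n))) = A (\<Sum>n<M. ?e k n *s h n)"
      unfolding M_def sum.lessThan_Suc_shift by (simp add: A_add A_sum A_scale del: of_nat_Suc)
    also have "(\<Sum>n<N. ?e k (Suc n) *s B (h n)) = ?e k 1 *s B (\<Sum>n<M. ?e k n *s h n)"
      unfolding M_def sum.lessThan_Suc h e[unfolded M_def]
      by (simp add: B_add B_sum B_scale scale_sum_right del: of_nat_Suc)
    finally show ?thesis by (simp add: pencil)
  qed
  have "real M * (\<Sum>n<M. sq (g n)) \<le> real M * (\<Sum>n<M. sq (h n))"
    unfolding discrete_Parseval[symmetric] by (intro sum_mono F)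
  then have "(\<Sum>n<M. sq (g n)) \<le> (\<Sum>n<M. sq (h n))"
    by (simp add: M_def)
  then show ?thesis
    unfolding M_def sum.lessThan_Suc_shift[of "\<lambda>n. sq (g n)"] sum.lessThan_Suc by (simp add: g_def h)
qed

text \<open>
  Summing the inequality $\|Ax + By\|^2 \le \|x\|^2 - Z(x) + Z(y)$ along $y = h_0, x = h_1$, then
  $y = h_1, x = h_2$, and so on, shows that $Z(h_0)$ has to be at least the gain of every finitely supported
  sequence $h$. The supremum of the gains satisfies the inequality by dynamic programming. A trail carries a
  bound $N$ beyond which $h$ vanishes, so that $N$ can be increased at will.
\<close>
definition gain :: "(nat \<Rightarrow> 'v) \<Rightarrow> nat \<Rightarrow> real" where
  "gain h N = (\<Sum>n<N. sq (A (h (Suc n)) + B (h n)) - sq (h (Suc n)))"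

definition trails :: "'v \<Rightarrow> ((nat \<Rightarrow> 'v) \<times> nat) set" where
  "trails y = {(h, N). h 0 = y \<and> (\<forall>n\<ge>N. h (Suc n) = 0)}"

definition best_gain :: "'v \<Rightarrow> real" where
  "best_gain y = (SUP (h, N)\<in>trails y. gain h N)"

lemma gain_le: assumes "(h, N) \<in> trails y" shows "gain h N \<le> sq y"
proof -
  have "h 0 = y" "h (Suc N) = 0" using assms by (auto simp: trails_def)
  have 1: "sq (A (h 0)) + (\<Sum>n<Suc N. sq (A (h (Suc n)) + B (h n))) \<le> (\<Sum>n<Suc N. sq (h n))"
    by (rule shifted_pencil) fact
  have 2: "(\<Sum>n<Suc N. sq (h n)) = sq y + (\<Sum>n<N. sq (h (Suc n)))"
    unfolding sum.lessThan_Suc_shift using \<open>h 0 = y\<close> by simp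
  have 3: "sq (A (h 0)) \<ge> 0" "sq (A (h (Suc N)) + B (h N)) \<ge> 0" by simp_all
  show ?thesis
    unfolding gain_def sum_subtractf using 1[unfolded 2] 3 unfolding sum.lessThan_Suc by linarith
qed

lemma bdd_gain: "bdd_above ((\<lambda>(h, N). gain h N) ` trails y)"
  using gain_le by (auto intro!: bdd_aboveI2[where M = "sq y"])

lemma trails_nonempty: "trails y \<noteq> {}"
proof -
  have "(\<lambda>n. if n = 0 then y else 0, 1) \<in> trails y" by (simp add: trails_def)
  then show ?thesis by blast
qed

lemma gain_le_best: "(h, N) \<in> trails y \<Longrightarrow> gain h N \<le> best_gain y"
  unfolding best_gain_def using cSUP_upper[OF _ bdd_gain, of "(h, N)" y] by simp

lemma best_gain_le: "best_gain y \<le> sq y"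
  unfolding best_gain_def using gain_le by (auto intro!: cSUP_least trails_nonempty)

lemma best_gain_leI:
  assumes "\<And>h N. (h, N) \<in> trails y \<Longrightarrow> gain h N \<le> c" shows "best_gain y \<le> c"
  unfolding best_gain_def using assms by (auto intro!: cSUP_least trails_nonempty)

lemma best_gain_nonneg: "0 \<le> best_gain y"
proof -
  have "(\<lambda>n. if n = 0 then y else 0, 1) \<in> trails y" by (simp add: trails_def)
  from gain_le_best[OF this] show ?thesis
    by (simp add: gain_def) (meson order_trans sq_nonneg)
qed

lemma gain_extend:
  assumes "(h, N) \<in> trails y" "N \<le> K" shows "(h, Suc K) \<in> trails y" "gain h N \<le> gain h (Suc K)"
proof -
  show "(h, Suc K) \<in> trails y" using assms by (auto simp: trails_def)
  have "sum (\<lambda>n. sq (A (h (Suc n)) + B (h n)) - sq (h (Suc n))) {..<N}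
      \<le> sum (\<lambda>n. sq (A (h (Suc n)) + B (h n)) - sq (h (Suc n))) {..<Suc K}"
    using assms by (intro sum_mono2) (auto simp: trails_def)
  then show "gain h N \<le> gain h (Suc K)" by (simp only: gain_def)
qed

text \<open>
  A trail that starts at $x$ becomes a trail that starts at $y$ when $y$ is put in front of it.
\<close>
lemma best_gain_step: "sq (A x + B y) - sq x + best_gain x \<le> best_gain y"
proof -
  have "best_gain x \<le> best_gain y - (sq (A x + B y) - sq x)"
  proof (rule best_gain_leI)
    fix h N assume h: "(h, N) \<in> trails x"
    let ?k = "case_nat y h"
    have "(?k, Suc N) \<in> trails y"
      using h by (auto simp: trails_def split: nat.split) (metis Suc_le_D Suc_le_mono)
    moreover have "gain ?k (Suc N) = sq (A x + B y) - sq x + gain h N"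
      unfolding gain_def sum.lessThan_Suc_shift using h by (simp add: trails_def)
    ultimately show "gain h N \<le> best_gain y - (sq (A x + B y) - sq x)"
      using gain_le_best by fastforce
  qed
  then show ?thesis by simp
qed

lemma best_gain_scale_le: "c \<noteq> 0 \<Longrightarrow> (cmod c)\<^sup>2 * best_gain y \<le> best_gain (c *s y)"
proof -
  assume c: "c \<noteq> 0"
  have "best_gain y \<le> best_gain (c *s y) / (cmod c)\<^sup>2"
  proof (rule best_gain_leI)
    fix h N assume h: "(h, N) \<in> trails y"
    then have "((\<lambda>n. c *s h n), N) \<in> trails (c *s y)" by (auto simp: trails_def)
    moreover have "gain (\<lambda>n. c *s h n) N = (cmod c)\<^sup>2 * gain h N"
      by (simp add: gain_def A_scale B_scale sum_distrib_left sq_scale right_diff_distrib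
          flip: scale_right_distrib)
    ultimately show "gain h N \<le> best_gain (c *s y) / (cmod c)\<^sup>2"
      using gain_le_best[of "\<lambda>n. c *s h n" N "c *s y"] c by (simp add: field_simps)
  qed
  then show ?thesis using c by (simp add: field_simps)
qed

lemma best_gain_scale: "best_gain (c *s y) = (cmod c)\<^sup>2 * best_gain y"
proof (cases "c = 0")
  case True
  then show ?thesis using best_gain_le[of 0] best_gain_nonneg[of 0] by simp
next
  case False
  have "(cmod (inverse c))\<^sup>2 * best_gain (c *s y) \<le> best_gain (inverse c *s c *s y)"
    using False by (intro best_gain_scale_le) simp
  then have "best_gain (c *s y) \<le> (cmod c)\<^sup>2 * best_gain y"
    using False by (simp add: norm_divide power_divide field_simps)
  then show ?thesis using best_gain_scale_le[OF False, of y] by simp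
qed

text \<open>
  Pointwise sums and differences of a trail for $x$ and one for $y$ are trails for $x + y$ and $x - y$,
  and the gain is a quadratic function of the sequence.
\<close>
lemma best_gain_superparallel: "2 * best_gain x + 2 * best_gain y \<le> best_gain (x + y) + best_gain (x - y)"
proof -
  have 1: "2 * gain h N + 2 * gain k K \<le> best_gain (x + y) + best_gain (x - y)"
    if h: "(h, N) \<in> trails x" and k: "(k, K) \<in> trails y" for h k N K
  proof -
    define L where "L = Suc (max N K)"
    have hL: "(h, L) \<in> trails x" "gain h N \<le> gain h L" and kL: "(k, L) \<in> trails y" "gain k K \<le> gain k L"
      unfolding L_def using gain_extend[OF h, of "max N K"] gain_extend[OF k, of "max N K"] by auto
    have "((\<lambda>n. h n + k n), L) \<in> trails (x + y)" "((\<lambda>n. h n - k n), L) \<in> trails (x - y)"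
      using hL kL by (auto simp: trails_def)
    moreover have "gain (\<lambda>n. h n + k n) L + gain (\<lambda>n. h n - k n) L = 2 * gain h L + 2 * gain k L"
    proof -
      have "sq (A (h (Suc n) + k (Suc n)) + B (h n + k n)) + sq (A (h (Suc n) - k (Suc n)) + B (h n - k n))
          = 2 * sq (A (h (Suc n)) + B (h n)) + 2 * sq (A (k (Suc n)) + B (k n))" for n
      proof -
        have e: "A (h (Suc n) + k (Suc n)) + B (h n + k n) = (A (h (Suc n)) + B (h n)) + (A (k (Suc n)) + B (k n))"
          "A (h (Suc n) - k (Suc n)) + B (h n - k n) = (A (h (Suc n)) + B (h n)) - (A (k (Suc n)) + B (k n))"
          by (simp_all add: A_add B_add A_diff B_diff)
        show ?thesis unfolding e by (rule parallelogram)
      qed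
      then have "(sq (A (h (Suc n) + k (Suc n)) + B (h n + k n)) - sq (h (Suc n) + k (Suc n)))
         + (sq (A (h (Suc n) - k (Suc n)) + B (h n - k n)) - sq (h (Suc n) - k (Suc n)))
          = 2 * (sq (A (h (Suc n)) + B (h n)) - sq (h (Suc n))) + 2 * (sq (A (k (Suc n)) + B (k n)) - sq (k (Suc n)))" for n
        using parallelogram[of "h (Suc n)" "k (Suc n)"] by (smt (verit))
      then show ?thesis
        unfolding gain_def sum.distrib[symmetric] sum_distrib_left by (intro sum.cong refl)
    qed
    ultimately show ?thesis
      using gain_le_best[of "\<lambda>n. h n + k n" L "x + y"] gain_le_best[of "\<lambda>n. h n - k n" L "x - y"] hL kL
      by linarith
  qed
  have 2: "best_gain x \<le> (best_gain (x + y) + best_gain (x - y) - 2 * gain k K) / 2"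
    if k: "(k, K) \<in> trails y" for k K
    by (rule best_gain_leI) (use 1[OF _ k] in fastforce)
  have "best_gain y \<le> (best_gain (x + y) + best_gain (x - y) - 2 * best_gain x) / 2"
    by (rule best_gain_leI) (use 2 in fastforce)
  then show ?thesis by simp
qed

text \<open>
  The converse inequality is the previous one for $x + y$ and $x - y$, whose sum and difference
  are $2x$ and $2y$.
\<close>
lemma best_gain_parallelogram: "best_gain (x + y) + best_gain (x - y) = 2 * best_gain x + 2 * best_gain y"
proof -
  have two: "(2::complex) *s v = v + v" for v
    using scale_left_distrib[of 1 1 v] by simp
  have "best_gain (v + v) = 4 * best_gain v" for v
    using best_gain_scale[of 2 v] by (simp add: two)
  then show ?thesis
    using best_gain_superparallel[of x y] best_gain_superparallel[of "x + y" "x - y"] by simp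
qed

text \<open>
  Ando's characterization of linear pencils that are contractive on the unit circle. It
  implies that $A \otimes V_1 + B \otimes V_2$ is a contraction for arbitrary contractions $V_1$ and $V_2$.
\<close>
theorem Ando_form:
  obtains Z where "psd_form scale Z" "\<And>x. Re (Z x x) \<le> sq x"
    "\<And>x y. sq (A x + B y) \<le> sq x - Re (Z x x) + Re (Z y y)"
proof -
  obtain Z where Z: "psd_form scale Z" "\<And>x. Re (Z x x) = best_gain x"
    using Jordan_von_Neumann[OF vector_space_axioms best_gain_parallelogram best_gain_scale best_gain_nonneg]
    by metis
  show thesis
  proof (rule that[OF Z(1)])
    show "Re (Z x x) \<le> sq x" for x by (simp add: Z best_gain_le)
    show "sq (A x + B y) \<le> sq x - Re (Z x x) + Re (Z y y)" for x y
      using best_gain_step[of x y] by (simp add: Z)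
  qed
qed

end

section \<open>Families with equal Gram functions\<close>

lemma psd_form_eqI:
  fixes scale :: "complex \<Rightarrow> 'v::ab_group_add \<Rightarrow> 'v"
  assumes "psd_form scale F" "psd_form scale G" and eq: "\<And>x. Re (F x x) = Re (G x x)"
  shows "F x y = G x y"
proof -
  interpret F: psd_form scale F by fact
  interpret G: psd_form scale G by fact
  have re: "Re (F x y) = Re (G x y)" for x y
    using F.sq_add[of x y] G.sq_add[of x y] eq by (simp add: F.sq_def G.sq_def)
  from re[of x y] re[of x "scale \<i> y"] show ?thesis
    by (simp add: F.scale_right G.scale_right complex_eq_iff)
qed

text \<open>
  The equation $w w^* w = w$.
\<close>
definition partial_isometry_matrix :: "nat \<Rightarrow> nat \<Rightarrow> (nat \<Rightarrow> nat \<Rightarrow> complex) \<Rightarrow> bool" where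
  "partial_isometry_matrix M N w \<longleftrightarrow>
    (\<forall>i<M. \<forall>j<N. (\<Sum>k<M. \<Sum>l<N. w i l * cnj (w k l) * w k j) = w i j)"

lemma partial_isometry_matrix_adjoint:
  assumes "partial_isometry_matrix M N w"
  shows "partial_isometry_matrix N M (\<lambda>j i. cnj (w i j))"
  unfolding partial_isometry_matrix_def
proof (intro allI impI)
  fix j i assume ji: "j < N" "i < M"
  have "(\<Sum>k<N. \<Sum>l<M. cnj (w l j) * cnj (cnj (w l k)) * cnj (w i k))
      = cnj (\<Sum>k<N. \<Sum>l<M. w i k * cnj (w l k) * w l j)"
    by (simp add: mult_ac)
  also have "(\<Sum>k<N. \<Sum>l<M. w i k * cnj (w l k) * w l j) = w i j"
    by (subst sum.swap) (use assms ji in \<open>simp add: partial_isometry_matrix_def\<close>)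
  finally show "(\<Sum>k<N. \<Sum>l<M. cnj (w l j) * cnj (cnj (w l k)) * cnj (w i k)) = cnj (w i j)" .
qed

context psd_form
begin

lemma matrix_adjoint:
  "(\<Sum>i<M. f (a i) (\<Sum>j<N. w i j *s b j)) = (\<Sum>j<N. f (\<Sum>i<M. cnj (w i j) *s a i) (b j))"
  unfolding sum_left sum_right scale_left scale_right by (rule sum.swap)

text \<open>
  With $\beta = w b$ and $\gamma = w^* \beta$ one has $w \gamma = \beta$, hence
  $\langle \gamma, b\rangle = \langle\gamma, \gamma\rangle = \langle \beta, \beta\rangle$, and the claim is
  $\|\gamma - b\|^2 \ge 0$. The form is applied to families of vectors, so the argument stays within the
  form and needs no spectral theory of $w$.
\<close>
lemma matrix_contractive:
  assumes w: "partial_isometry_matrix M N w"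
  shows "(\<Sum>i<M. sq (\<Sum>j<N. w i j *s b j)) \<le> (\<Sum>j<N. sq (b j))"
proof -
  define \<beta> where "\<beta> i = (\<Sum>j<N. w i j *s b j)" for i
  define \<gamma> where "\<gamma> j = (\<Sum>k<M. cnj (w k j) *s \<beta> k)" for j
  have recover: "(\<Sum>j<N. w i j *s \<gamma> j) = \<beta> i" if i: "i < M" for i
  proof -
    have "(\<Sum>j<N. w i j *s \<gamma> j) = (\<Sum>j<N. \<Sum>k<M. \<Sum>l<N. (w i j * cnj (w k j) * w k l) *s b l)"
      by (simp add: \<gamma>_def \<beta>_def scale_sum_right mult.assoc)
    also have "\<dots> = (\<Sum>l<N. \<Sum>k<M. \<Sum>j<N. (w i j * cnj (w k j) * w k l) *s b l)"
      by (subst sum.swap, subst (2) sum.swap, subst sum.swap) (rule refl)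
    also have "\<dots> = (\<Sum>l<N. (\<Sum>k<M. \<Sum>j<N. w i j * cnj (w k j) * w k l) *s b l)"
      by (simp add: scale_sum_left)
    also have "\<dots> = \<beta> i"
      unfolding \<beta>_def using w i by (intro sum.cong refl) (simp add: partial_isometry_matrix_def)
    finally show ?thesis .
  qed
  have 1: "(\<Sum>j<N. f (\<gamma> j) (b j)) = (\<Sum>i<M. f (\<beta> i) (\<beta> i))"
    unfolding \<gamma>_def using matrix_adjoint[of \<beta> w b N M] by (simp add: \<beta>_def)
  have 2: "(\<Sum>j<N. f (\<gamma> j) (\<gamma> j)) = (\<Sum>i<M. f (\<beta> i) (\<beta> i))"
    using matrix_adjoint[of \<beta> w \<gamma> N M] by (simp add: recover flip: \<gamma>_def)
  have "0 \<le> (\<Sum>j<N. sq (\<gamma> j - b j))" by (simp add: sum_nonneg)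
  also have "\<dots> = Re (\<Sum>j<N. f (\<gamma> j) (\<gamma> j)) + (\<Sum>j<N. sq (b j)) - 2 * Re (\<Sum>j<N. f (\<gamma> j) (b j))"
    by (simp add: sq_diff sum.distrib sum_subtractf sum_distrib_left) (simp add: sq_def)
  finally show ?thesis unfolding 1 2 by (simp add: sq_def \<beta>_def)
qed

text \<open>
  The operator $\sum_j \langle\cdot, y_j\rangle\, y_j$. Its range is the span of the $y_j$, and a preimage $v$ of $x$
  singles out the expansion of $x$ with the coefficients $\langle v, y_j\rangle$. For families with equal Gram
  functions these coefficients form a partial isometry.
\<close>
definition frame_op :: "(nat \<Rightarrow> 'v) \<Rightarrow> nat \<Rightarrow> 'v \<Rightarrow> 'v" where
  "frame_op y N u = (\<Sum>j<N. f u (y j) *s y j)"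

lemma frame_op_scale: "frame_op y N (c *s u) = c *s frame_op y N u"
  by (simp add: frame_op_def scale_left scale_sum_right)

lemma frame_op_diff: "frame_op y N (u - v) = frame_op y N u - frame_op y N v"
  by (simp add: frame_op_def diff_left scale_left_diff_distrib sum_subtractf)

lemma frame_op_Suc: "frame_op y (Suc N) u = frame_op y N u + f u (y N) *s y N"
  by (simp add: frame_op_def)

lemma orthogonal_frame_op: "(\<And>j. j < N \<Longrightarrow> f e (y j) = 0) \<Longrightarrow> f e (frame_op y N u) = 0"
  by (simp add: frame_op_def sum_right scale_right)

text \<open>
  The orthogonal projection onto the span of the $y_j$ has values in the range of the frame operator. This is
  Gram--Schmidt: a new vector $y_N = t + (\mbox{projection})$ contributes the direction $t$. If $t$ is null, then
  $y_N$ is in the old span up to a null vector, but the frame operator still changes, and the solution has to be rescaled by the factor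
  $1 + \langle u_0, y_N\rangle \ge 1$.
\<close>
lemma frame_projection: "\<exists>u. \<forall>j<N. f (z - frame_op y N u) (y j) = 0"
proof (induction N arbitrary: z)
  case 0
  then show ?case by simp
next
  case (Suc N)
  obtain u where u: "\<And>j. j < N \<Longrightarrow> f (z - frame_op y N u) (y j) = 0" using Suc[of z] by blast
  obtain u0 where u0: "\<And>j. j < N \<Longrightarrow> f (y N - frame_op y N u0) (y j) = 0" using Suc[of "y N"] by blast
  define e t where "e = z - frame_op y N u" and "t = y N - frame_op y N u0"
  have eo: "f e (y j) = 0" and to: "f t (y j) = 0" if "j < N" for j
    using u[OF that] u0[OF that] by (simp_all add: e_def t_def)
  have yN: "y N = t + frame_op y N u0" by (simp add: t_def)
  have ty: "f t (y N) = f t t"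
    by (simp add: yN add_right orthogonal_frame_op to del: t_def)
  have ey: "f e (y N) = f e t"
    by (simp add: yN add_right orthogonal_frame_op eo del: t_def)
  have Tt: "frame_op y N t = 0" by (simp add: frame_op_def to)
  have ue: "z - frame_op y (Suc N) u' = e + frame_op y N (u - u') - f u' (y N) *s y N" for u'
    by (simp add: e_def frame_op_Suc frame_op_diff algebra_simps)
  show ?case
  proof (cases "sq t = 0")
    case True
    have null: "f t v = 0" "f v t = 0" for v using True by (simp_all add: null_left null_right)
    have pos: "f u0 (frame_op y N u0) = of_real (\<Sum>j<N. (cmod (f u0 (y j)))\<^sup>2)"
      by (simp add: frame_op_def sum_right scale_right mult.commute[of "cnj _"] flip: complex_norm_square)
    define r where "r = (\<Sum>j<N. (cmod (f u0 (y j)))\<^sup>2)"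
    have u0y: "f u0 (y N) = of_real r"
      using pos null(2)[of u0] by (simp add: yN add_right r_def)
    have "0 \<le> r" by (simp add: r_def sum_nonneg)
    then have r1: "1 + complex_of_real r \<noteq> 0"
      by (metis add_nonneg_pos less_irrefl of_real_1 of_real_add of_real_eq_0_iff add.commute zero_less_one)
    (* The coefficient makes the inner product of u' and y N equal to c, so the contribution of y N cancels. *)
    define c where "c = f u (y N) / (1 + of_real r)"
    define u' where "u' = u - c *s u0"
    have fu': "f u' (y N) = c"
      using r1 by (simp add: u'_def diff_left scale_left u0y c_def field_simps)
    have "z - frame_op y (Suc N) u' = e - c *s t"
      unfolding ue fu' by (simp add: u'_def frame_op_scale yN scale_right_distrib)
    then have "f (z - frame_op y (Suc N) u') v = f e v" for v
      by (simp add: diff_left scale_left null)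
    then show ?thesis using eo ey null(2)[of e] by (metis less_SucE)
  next
    case False
    (* The new residual is e minus its component along t; alpha corrects the coefficient of y N. *)
    define \<gamma> where "\<gamma> = f e t / of_real (sq t)"
    define \<alpha> where "\<alpha> = (\<gamma> - f (u - \<gamma> *s u0) (y N)) / of_real (sq t)"
    define u' where "u' = (u - \<gamma> *s u0) + \<alpha> *s t"
    have fu': "f u' (y N) = \<gamma>"
      using False by (simp add: u'_def add_left scale_left ty self_real \<alpha>_def)
    have "z - frame_op y (Suc N) u' = e - \<gamma> *s t"
      unfolding ue fu' by (simp add: u'_def frame_op_scale frame_op_diff Tt yN scale_right_distrib)
    moreover have "f (e - \<gamma> *s t) (y N) = 0"
      using False by (simp add: diff_left scale_left ey ty self_real \<gamma>_def)
    moreover have "f (e - \<gamma> *s t) (y j) = 0" if "j < N" for j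
      using that by (simp add: diff_left scale_left eo to)
    ultimately show ?thesis by (metis less_SucE)
  qed
qed

lemma rank_one_psd: "psd_form scale (\<lambda>z z'. \<Sum>i<M. f z (x i) * cnj (f z' (x i)))"
  by unfold_locales
    (simp_all add: add_left scale_left algebra_simps sum.distrib sum_distrib_left sum_nonneg
      complex_norm_square[symmetric] del: of_real_power)

lemma frame_solution:
  fixes x y :: "nat \<Rightarrow> 'v"
  assumes gram: "\<And>z. (\<Sum>i<M. (cmod (f z (x i)))\<^sup>2) = (\<Sum>j<N. (cmod (f z (y j)))\<^sup>2)"
    and i: "i < M"
  shows "\<exists>v. sq (x i - frame_op y N v) = 0"
proof -
  obtain v where v: "\<And>j. j < N \<Longrightarrow> f (x i - frame_op y N v) (y j) = 0"
    using frame_projection[of N "x i" y] by blast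
  let ?d = "x i - frame_op y N v"
  have "(\<Sum>i<M. (cmod (f ?d (x i)))\<^sup>2) = 0" unfolding gram using v by simp
  then have "f ?d (x i) = 0" using i sum_nonneg_eq_0_iff[of "{..<M}" "\<lambda>i. (cmod (f ?d (x i)))\<^sup>2"] by auto
  then have "f ?d ?d = 0" using orthogonal_frame_op[OF v] by (simp only: diff_right) simp
  then have "sq ?d = 0" by (simp add: sq_def)
  then show ?thesis by blast
qed

text \<open>
  Both frame operators define the same form, hence $w_{ij} = \langle v_i, y_j\rangle$, where the frame operator
  maps $v_i$ to $x_i$, is the conjugate of $\langle u_j, x_i\rangle$, where it maps $u_j$ to $y_j$. All identities hold up to null vectors.
\<close>
lemma equal_gram_partial_isometry:
  assumes gram: "\<And>z. (\<Sum>i<M. (cmod (f z (x i)))\<^sup>2) = (\<Sum>j<N. (cmod (f z (y j)))\<^sup>2)"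
  obtains w where "partial_isometry_matrix M N w"
    "\<And>i. i < M \<Longrightarrow> sq (x i - (\<Sum>j<N. w i j *s y j)) = 0"
    "\<And>j. j < N \<Longrightarrow> sq (y j - (\<Sum>i<M. cnj (w i j) *s x i)) = 0"
proof -
  obtain v where v: "\<And>i. i < M \<Longrightarrow> sq (x i - frame_op y N (v i)) = 0"
    using frame_solution[OF gram] by metis
  obtain u where u: "\<And>j. j < N \<Longrightarrow> sq (y j - frame_op x M (u j)) = 0"
    using frame_solution[where x = y and y = x and M = N and N = M, OF gram[symmetric]] by metis
  have P: "(\<Sum>i<M. f z (x i) * cnj (f z' (x i))) = (\<Sum>j<N. f z (y j) * cnj (f z' (y j)))" for z z'
    by (rule psd_form_eqI[OF rank_one_psd rank_one_psd])
      (use gram in \<open>simp add: complex_norm_square[symmetric] del: of_real_power\<close>)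
  have fx: "f z (x i) = (\<Sum>l<N. f z (y l) * cnj (f (v i) (y l)))" if "i < M" for z i
    using eq_of_null_diff(2)[OF v[OF that], of z]
    by (simp add: frame_op_def sum_right scale_right mult.commute)
  have fy: "f z (y j) = (\<Sum>k<M. f z (x k) * cnj (f (u j) (x k)))" if "j < N" for z j
    using eq_of_null_diff(2)[OF u[OF that], of z]
    by (simp add: frame_op_def sum_right scale_right mult.commute)
  define w where "w i j = f (v i) (y j)" for i j
  have w': "cnj (w i j) = f (u j) (x i)" if "i < M" "j < N" for i j
  proof -
    have "cnj (w i j) = cnj (\<Sum>k<M. f (v i) (x k) * cnj (f (u j) (x k)))"
      by (simp only: w_def fy[OF that(2), of "v i"])
    also have "\<dots> = cnj (\<Sum>l<N. f (v i) (y l) * cnj (f (u j) (y l)))" by (simp only: P)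
    also have "\<dots> = f (u j) (x i)" by (simp add: fx[OF that(1), of "u j"] mult.commute)
    finally show ?thesis .
  qed
  show thesis
  proof (rule that)
    show "sq (x i - (\<Sum>j<N. w i j *s y j)) = 0" if "i < M" for i
      using v[OF that] by (simp add: w_def frame_op_def)
    show "sq (y j - (\<Sum>i<M. cnj (w i j) *s x i)) = 0" if j: "j < N" for j
    proof -
      have "(\<Sum>i<M. cnj (w i j) *s x i) = frame_op x M (u j)"
        unfolding frame_op_def by (intro sum.cong refl) (simp add: w' j)
      then show ?thesis using u[OF j] by simp
    qed
    show "partial_isometry_matrix M N w"
      unfolding partial_isometry_matrix_def
    proof (intro allI impI)
      fix i j assume i: "i < M" and j: "j < N"
      have "(\<Sum>k<M. \<Sum>l<N. w i l * cnj (w k l) * w k j)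
          = (\<Sum>k<M. (\<Sum>l<N. w i l * cnj (w k l)) * w k j)"
        by (simp add: sum_distrib_right)
      also have "\<dots> = (\<Sum>k<M. f (v i) (x k) * cnj (f (u j) (x k)))"
      proof (intro sum.cong refl)
        fix k assume k: "k \<in> {..<M}"
        have "w k j = cnj (f (u j) (x k))" using w'[of k j] k j by (metis complex_cnj_cnj lessThan_iff)
        then show "(\<Sum>l<N. w i l * cnj (w k l)) * w k j = f (v i) (x k) * cnj (f (u j) (x k))"
          using k by (simp add: fx w_def)
      qed
      also have "\<dots> = w i j" by (simp add: fy[OF j] w_def)
      finally show "(\<Sum>k<M. \<Sum>l<N. w i l * cnj (w k l) * w k j) = w i j" .
    qed
  qed
qed

end

text \<open>
  Regard $h$ as a vector of $H \otimes \mathbb{C}^M$. If $V$ is a contraction of $\mathbb{C}^M$ and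
  $a = \sum_{n \ge 1} (A^n \otimes V^n) h$, then $x = V(h + a + \beta)$ satisfies $A x = a$ for every $\beta$ in the kernel
  of $A$, and it is dominated by $h + a + \beta$ in every positive form. This consequence is all that is used
  of $V$, and it passes to juxtapositions and multiples of families. The freedom in $\beta$ leaves room for
  the vectors that the other operator of the pencil contributes.
\<close>
definition shiftable ::
  "(complex \<Rightarrow> 'v \<Rightarrow> 'v) \<Rightarrow> ('v::ab_group_add \<Rightarrow> 'v) \<Rightarrow> nat \<Rightarrow> (nat \<Rightarrow> 'v) \<Rightarrow> (nat \<Rightarrow> 'v) \<Rightarrow> bool" where
  "shiftable scale A M h a \<longleftrightarrow>
    (\<forall>\<beta>. (\<forall>i<M. A (\<beta> i) = 0) \<longrightarrow>
      (\<exists>x. (\<forall>i<M. A (x i) = a i) \<and>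
        (\<forall>Z. psd_form scale Z \<longrightarrow>
          (\<Sum>i<M. Re (Z (x i) (x i))) \<le> (\<Sum>i<M. Re (Z (h i + a i + \<beta> i) (h i + a i + \<beta> i))))))"

lemma shiftableE:
  assumes "shiftable scale A M h a" "\<And>i. i < M \<Longrightarrow> A (\<beta> i) = 0"
  obtains x where "\<And>i. i < M \<Longrightarrow> A (x i) = a i"
    "\<And>Z. psd_form scale Z \<Longrightarrow>
      (\<Sum>i<M. Re (Z (x i) (x i))) \<le> (\<Sum>i<M. Re (Z (h i + a i + \<beta> i) (h i + a i + \<beta> i)))"
proof -
  have "\<forall>i<M. A (\<beta> i) = 0" using assms(2) by blast
  from assms(1)[unfolded shiftable_def, THEN spec, THEN mp, OF this] show thesis
    using that by auto
qed

lemma shiftable_range: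
  assumes "shiftable scale A M h a" "A 0 = 0" "i < M"
  shows "\<exists>x. A x = a i"
  using assms(1)[unfolded shiftable_def, THEN spec, THEN mp, of "\<lambda>_. 0"] assms(2,3) by blast

text \<open>
  The consistency condition for the splitting. Let $w$ be the partial isometry that carries $k$ to $h$. The
  quantity \<open>am G\<close> is the square of the $G$-length of the vector $\eta = h + a + b$ in the amalgam of
  the two coefficient spaces along $w$: $\alpha = h + a$ lives over the first space, $b$ over the second, and their
  inner product is formed after moving $b$ to the first space by $w$. The projections of $\eta$
  to the two spaces are $\alpha + w b$ and $k + b + w^* a$. Shiftability bounds the shifted vectors $x$ and $y$ by these projections, and
  the Ando form bounds $Ax + By = a + b$ by $x$ and $y$. Together $\|a + b\| \le \|\eta\|$, which
  is the claim after expansion.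
\<close>
theorem (in contractive_pencil) mixed_shift_inequality:
  assumes hA: "shiftable scale A M h a" and kB: "shiftable scale B N k b"
    and gram: "\<And>z. (\<Sum>i<M. (cmod (ip z (h i)))\<^sup>2) = (\<Sum>j<N. (cmod (ip z (k j)))\<^sup>2)"
  shows "0 \<le> (\<Sum>i<M. sq (h i)) + 2 * (\<Sum>i<M. Re (ip (h i) (a i))) + 2 * (\<Sum>j<N. Re (ip (k j) (b j)))"
proof -
  obtain w where w: "partial_isometry_matrix M N w"
    and kw: "\<And>j. j < N \<Longrightarrow> sq (k j - (\<Sum>i<M. cnj (w i j) *s h i)) = 0"
    using equal_gram_partial_isometry[OF gram] by metis
  have w': "partial_isometry_matrix N M (\<lambda>j i. cnj (w i j))"
    by (rule partial_isometry_matrix_adjoint[OF w])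
  have Ba: "B (a i) = 0" if "i < M" for i
    using shiftable_range[OF hA _ that] BA by (metis A_zero)
  have Ab: "A (b j) = 0" if "j < N" for j
    using shiftable_range[OF kB _ that] AB by (metis B_zero)
  define \<alpha> where "\<alpha> i = h i + a i" for i
  define \<beta> where "\<beta> i = (\<Sum>j<N. w i j *s b j)" for i
  define p where "p j = (\<Sum>i<M. cnj (w i j) *s a i)" for j
  have "A (\<beta> i) = 0" for i by (simp add: \<beta>_def A_sum A_scale Ab)
  then obtain x where x: "\<And>i. i < M \<Longrightarrow> A (x i) = a i"
    and xZ: "\<And>Z. psd_form scale Z \<Longrightarrow>
      (\<Sum>i<M. Re (Z (x i) (x i))) \<le> (\<Sum>i<M. Re (Z (\<alpha> i + \<beta> i) (\<alpha> i + \<beta> i)))"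
    unfolding \<alpha>_def using shiftableE[OF hA, of \<beta>] by blast
  have "B (p j) = 0" for j by (simp add: p_def B_sum B_scale Ba)
  then obtain y where y: "\<And>j. j < N \<Longrightarrow> B (y j) = b j"
    and yZ: "\<And>Z. psd_form scale Z \<Longrightarrow>
      (\<Sum>j<N. Re (Z (y j) (y j))) \<le> (\<Sum>j<N. Re (Z (k j + b j + p j) (k j + b j + p j)))"
    using shiftableE[OF kB, of p] by blast
  obtain Z where Z: "psd_form scale Z" and Zip: "\<And>x. Re (Z x x) \<le> sq x"
    and ando: "\<And>x y. sq (A x + B y) \<le> sq x - Re (Z x x) + Re (Z y y)"
    using Ando_form by metis
  interpret Z: psd_form scale Z by (rule Z)
  have ZA: "psd_form scale (\<lambda>x y. ip x y - Z x y)"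
  proof
    show "ip x y - Z x y = cnj (ip y x - Z y x)" for x y
      using hermitian[of x y] Z.hermitian[of x y] by simp
  qed (use Zip in \<open>simp_all add: add_left scale_left Z.add_left Z.scale_left sq_def algebra_simps\<close>)
  have ZB: "psd_form scale (\<lambda>x y. Z x y - ip (B x) (B y))"
  proof
    show "Z x y - ip (B x) (B y) = cnj (Z y x - ip (B y) (B x))" for x y
      using hermitian[of "B x" "B y"] Z.hermitian[of x y] by simp
    show "0 \<le> Re (Z x x - ip (B x) (B x))" for x
      using ando[of 0 x] by (simp add: sq_def)
  qed (simp_all add: add_left scale_left Z.add_left Z.scale_left B_add B_scale algebra_simps)
  define am where "am G = (\<Sum>i<M. Re (G (\<alpha> i) (\<alpha> i))) + (\<Sum>j<N. Re (G (b j) (b j))) + 2 * (\<Sum>i<M. Re (G (\<alpha> i) (\<beta> i)))"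
    for G :: "'v \<Rightarrow> 'v \<Rightarrow> complex"
  have amI: "(\<Sum>i<M. Re (G (\<alpha> i + \<beta> i) (\<alpha> i + \<beta> i))) \<le> am G" if "psd_form scale G" for G
  proof -
    interpret G: psd_form scale G by (rule that)
    have "(\<Sum>i<M. G.sq (\<alpha> i + \<beta> i)) = (\<Sum>i<M. G.sq (\<alpha> i)) + (\<Sum>i<M. G.sq (\<beta> i)) + 2 * (\<Sum>i<M. Re (G (\<alpha> i) (\<beta> i)))"
      by (simp add: G.sq_add sum.distrib sum_distrib_left)
    then show ?thesis
      using G.matrix_contractive[OF w, of b] by (simp add: am_def G.sq_def \<beta>_def)
  qed
  have amJ: "(\<Sum>j<N. Re (Z (k j + b j + p j) (k j + b j + p j))) \<le> am Z"
  proof -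
    define g where "g j = (\<Sum>i<M. cnj (w i j) *s \<alpha> i)" for j
    have gp: "g j = (\<Sum>i<M. cnj (w i j) *s h i) + p j" for j
      by (simp add: g_def p_def \<alpha>_def scale_right_distrib sum.distrib)
    have "Z.sq (k j + b j + p j) = Z.sq (g j + b j)" if j: "j < N" for j
    proof -
      let ?d = "k j - (\<Sum>i<M. cnj (w i j) *s h i)"
      have "Z.sq ?d = 0"
        using Zip[of ?d] kw[OF j] Z.sq_nonneg[of ?d] by (simp add: Z.sq_def)
      moreover have "k j + b j + p j = (g j + b j) + ?d" by (simp add: gp algebra_simps)
      ultimately show ?thesis by (simp only: Z.sq_add) (simp add: Z.null_right)
    qed
    then have "(\<Sum>j<N. Z.sq (k j + b j + p j)) = (\<Sum>j<N. Z.sq (g j + b j))"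
      by (intro sum.cong refl) simp
    also have "\<dots> = (\<Sum>j<N. Z.sq (g j)) + (\<Sum>j<N. Z.sq (b j)) + 2 * Re (\<Sum>j<N. Z (g j) (b j))"
      by (simp add: Z.sq_add sum.distrib sum_distrib_left)
    also have "(\<Sum>j<N. Z (g j) (b j)) = (\<Sum>i<M. Z (\<alpha> i) (\<beta> i))"
      unfolding g_def \<beta>_def by (rule Z.matrix_adjoint[symmetric])
    finally show ?thesis
      using Z.matrix_contractive[OF w', of \<alpha>] by (simp add: am_def Z.sq_def g_def)
  qed
  have kb: "(\<Sum>i<M. ip (h i) (\<beta> i)) = (\<Sum>j<N. ip (k j) (b j))"
    unfolding \<beta>_def matrix_adjoint
    by (intro sum.cong refl) (simp add: eq_of_null_diff(1)[OF kw])
  define y' where "y' i = (\<Sum>j<N. w i j *s y j)" for i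
  have By': "B (y' i) = \<beta> i" for i
    unfolding y'_def \<beta>_def B_sum B_scale by (intro sum.cong refl) (simp add: y)
  (* The Ando inequality is applied over the first space; the part of b that w does not see is
       accounted for by the form Z - <B, B>, which is positive. *)
  have "(\<Sum>i<M. sq (a i + \<beta> i)) \<le> (\<Sum>i<M. sq (x i) - Re (Z (x i) (x i)) + Re (Z (y' i) (y' i)))"
    using ando[of "x i" "y' i" for i] x By' by (intro sum_mono) (metis lessThan_iff)
  moreover have "(\<Sum>i<M. Re (Z (y' i) (y' i))) - (\<Sum>i<M. sq (\<beta> i)) \<le> (\<Sum>j<N. Re (Z (y j) (y j))) - (\<Sum>j<N. sq (b j))"
  proof -
    interpret ZB: psd_form scale "\<lambda>x y. Z x y - ip (B x) (B y)" by (rule ZB)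
    have "(\<Sum>j<N. ZB.sq (y j)) = (\<Sum>j<N. Re (Z (y j) (y j))) - (\<Sum>j<N. sq (b j))"
      by (simp add: ZB.sq_def sq_def y sum_subtractf)
    moreover have "(\<Sum>i<M. ZB.sq (y' i)) = (\<Sum>i<M. Re (Z (y' i) (y' i))) - (\<Sum>i<M. sq (\<beta> i))"
      by (simp add: ZB.sq_def sq_def By' sum_subtractf)
    ultimately show ?thesis using ZB.matrix_contractive[OF w, of y] by (simp add: y'_def)
  qed
  moreover have "(\<Sum>i<M. sq (x i) - Re (Z (x i) (x i))) \<le> am ip - am Z"
  proof -
    have "(\<Sum>i<M. sq (x i) - Re (Z (x i) (x i))) \<le> am (\<lambda>x y. ip x y - Z x y)"
      using xZ[OF ZA] amI[OF ZA] by (simp add: sq_def)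
    also have "\<dots> = am ip - am Z"
      by (simp add: am_def sum_subtractf)
    finally show ?thesis .
  qed
  moreover have "(\<Sum>j<N. Re (Z (y j) (y j))) \<le> am Z"
    using yZ[OF Z] amJ by simp
  ultimately have "(\<Sum>i<M. sq (a i + \<beta> i)) - (\<Sum>i<M. sq (\<beta> i)) + (\<Sum>j<N. sq (b j)) \<le> am ip"
    by (simp add: sum.distrib)
  moreover have "(\<Sum>i<M. sq (a i + \<beta> i)) = (\<Sum>i<M. sq (a i)) + (\<Sum>i<M. sq (\<beta> i)) + 2 * (\<Sum>i<M. Re (ip (a i) (\<beta> i)))"
    by (simp add: sq_add sum.distrib sum_distrib_left)
  moreover have "am ip = (\<Sum>i<M. sq (h i)) + (\<Sum>i<M. sq (a i)) + 2 * (\<Sum>i<M. Re (ip (h i) (a i)))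
      + (\<Sum>j<N. sq (b j)) + 2 * Re (\<Sum>i<M. ip (h i) (\<beta> i)) + 2 * (\<Sum>i<M. Re (ip (a i) (\<beta> i)))"
    unfolding am_def sq_def[symmetric] \<alpha>_def by (simp add: sq_add add_left sum.distrib sum_distrib_left)
  ultimately show ?thesis unfolding kb by simp
qed

section \<open>Splitting the inner product\<close>

text \<open>
  Only an inequality is asked of homogeneity. The converse follows by scaling back, and the inequality is easier to verify for
  infima.
\<close>
definition sublinear_on :: "('z \<Rightarrow> real) set \<Rightarrow> (('z \<Rightarrow> real) \<Rightarrow> real) \<Rightarrow> bool" where
  "sublinear_on S q \<longleftrightarrow>
    (\<forall>f\<in>S. \<forall>g\<in>S. q (\<lambda>z. f z + g z) \<le> q f + q g) \<and> (\<forall>c>0. \<forall>f\<in>S. q (\<lambda>z. c * f z) \<le> c * q f)"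

lemma sublinear_onD:
  assumes "sublinear_on S q"
  shows "f \<in> S \<Longrightarrow> g \<in> S \<Longrightarrow> q (\<lambda>z. f z + g z) \<le> q f + q g"
    "c > 0 \<Longrightarrow> f \<in> S \<Longrightarrow> q (\<lambda>z. c * f z) \<le> c * q f"
  using assms by (auto simp: sublinear_on_def)

text \<open>
  A minimal sublinear function below $p$, which exists by Zorn's lemma, is additive: for fixed $y$ the
  function $f \mapsto \inf_{t \ge 0} (m(f + t y) - t\,m(y))$ is sublinear and below $m$, hence equal to $m$, and $t = 1$ gives
  $m(f) + m(y) \le m(f + y)$. The space consists of real functions because it is applied to the span of the functions $z \mapsto |\langle z, x\rangle|^2$, which
  represents the finite-rank Hermitian operators.
\<close>
theorem Hahn_Banach_functions:
  fixes S :: "('z \<Rightarrow> real) set"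
  assumes S_zero: "(\<lambda>_. 0) \<in> S"
    and S_add: "\<And>f g. f \<in> S \<Longrightarrow> g \<in> S \<Longrightarrow> (\<lambda>z. f z + g z) \<in> S"
    and S_scale: "\<And>c f. f \<in> S \<Longrightarrow> (\<lambda>z. c * f z) \<in> S"
    and p: "sublinear_on S p"
  obtains \<phi> where "\<And>f g. f \<in> S \<Longrightarrow> g \<in> S \<Longrightarrow> \<phi> (\<lambda>z. f z + g z) = \<phi> f + \<phi> g"
    "\<And>f. f \<in> S \<Longrightarrow> \<phi> f \<le> p f"
proof -
  define \<P> where "\<P> = {q. sublinear_on S q \<and> (\<forall>f\<in>S. q f \<le> p f) \<and> (\<forall>f. f \<notin> S \<longrightarrow> q f = 0)}"
  define less where "less q r \<longleftrightarrow> (\<forall>f. r f \<le> q f)" for q r :: "('z \<Rightarrow> real) \<Rightarrow> real"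
  have lower: "- p (\<lambda>z. - 1 * f z) \<le> q f" if q: "sublinear_on S q" "\<forall>f\<in>S. q f \<le> p f" and f: "f \<in> S" for q f
  proof -
    have "q (\<lambda>_. 0) \<le> q (\<lambda>_. 0) + q (\<lambda>_. 0)"
      using sublinear_onD(1)[OF q(1) S_zero S_zero] by simp
    moreover have "q (\<lambda>z. f z + (-1) * f z) \<le> q f + q (\<lambda>z. -1 * f z)"
      using sublinear_onD(1)[OF q(1) f S_scale[OF f]] .
    moreover have "(\<lambda>z. f z + (-1) * f z) = (\<lambda>_. 0)" by simp
    moreover have "q (\<lambda>z. -1 * f z) \<le> p (\<lambda>z. -1 * f z)" using q(2) S_scale[OF f] by blast
    ultimately show ?thesis by simp
  qed
  have po: "partial_order_on \<P> (relation_of less \<P>)"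
    by (rule partial_order_on_relation_ofI) (auto simp: less_def fun_eq_iff intro: order_trans antisym)
  have chain: "\<exists>u\<in>\<P>. \<forall>q\<in>C. less q u" if C: "C \<in> Chains (relation_of less \<P>)" for C
  proof (cases "C = {}")
    case True
    have "(\<lambda>f. if f \<in> S then p f else 0) \<in> \<P>"
      using p S_add S_scale by (auto simp: \<P>_def sublinear_on_def)
    then show ?thesis using True by blast
  next
    case False
    have CP: "C \<subseteq> \<P>" using C by (auto simp: Chains_def relation_of_def)
    have total: "less q r \<or> less r q" if "q \<in> C" "r \<in> C" for q r
      using C that by (auto simp: Chains_def relation_of_def)
    define u where "u f = (if f \<in> S then INF q\<in>C. q f else 0)" for f
    have bdd: "bdd_below ((\<lambda>q. q f) ` C)" if "f \<in> S" for f
      using CP lower that by (auto simp: \<P>_def intro!: bdd_belowI2[where m = "- p (\<lambda>z. - 1 * f z)"])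
    have u_le: "u f \<le> q f" if "f \<in> S" "q \<in> C" for f q
      using that bdd by (auto simp: u_def intro: cINF_lower)
    have u_ge: "c \<le> u f" if "f \<in> S" "\<And>q. q \<in> C \<Longrightarrow> c \<le> q f" for f c
      using that False by (auto simp: u_def intro: cINF_greatest)
    have "u \<in> \<P>"
      unfolding \<P>_def
    proof (intro CollectI conjI ballI allI impI)
      show "sublinear_on S u"
        unfolding sublinear_on_def
      proof (intro conjI ballI allI impI)
        fix f g assume f: "f \<in> S" and g: "g \<in> S"
        have 1: "u (\<lambda>z. f z + g z) \<le> q f + r g" if q: "q \<in> C" and r: "r \<in> C" for q r
        proof -
          obtain s where s: "s \<in> C" "s f \<le> q f" "s g \<le> r g"
            using total[OF q r] q r unfolding less_def by blast
          have "u (\<lambda>z. f z + g z) \<le> s (\<lambda>z. f z + g z)" using u_le[OF S_add[OF f g] s(1)] .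
          also have "\<dots> \<le> s f + s g" using s(1) CP f g by (auto simp: \<P>_def sublinear_on_def)
          finally show ?thesis using s by simp
        qed
        have "u (\<lambda>z. f z + g z) - r g \<le> u f" if "r \<in> C" for r
          by (rule u_ge[OF f]) (use 1[OF _ that] in fastforce)
        then have "u (\<lambda>z. f z + g z) - u f \<le> u g"
          by (intro u_ge[OF g]) fastforce
        then show "u (\<lambda>z. f z + g z) \<le> u f + u g" by simp
      next
        fix c :: real and f assume c: "0 < c" and f: "f \<in> S"
        have "u (\<lambda>z. c * f z) / c \<le> u f"
        proof (rule u_ge[OF f])
          fix q assume q: "q \<in> C"
          have "u (\<lambda>z. c * f z) \<le> q (\<lambda>z. c * f z)" using u_le[OF S_scale[OF f] q] .
          also have "\<dots> \<le> c * q f" using q CP f c by (auto simp: \<P>_def sublinear_on_def)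
          finally show "u (\<lambda>z. c * f z) / c \<le> q f" using c by (simp add: field_simps)
        qed
        then show "u (\<lambda>z. c * f z) \<le> c * u f" using c by (simp add: field_simps)
      qed
      fix f assume f: "f \<in> S"
      obtain q where "q \<in> C" using False by blast
      then show "u f \<le> p f" using u_le[OF f] CP f by (force simp: \<P>_def)
    qed (simp add: u_def)
    moreover have "less q u" if "q \<in> C" for q
      unfolding less_def
    proof
      fix f show "u f \<le> q f"
        using u_le[OF _ that, of f] CP that by (cases "f \<in> S") (auto simp: u_def \<P>_def)
    qed
    ultimately show ?thesis by blast
  qed
  obtain m where m: "m \<in> \<P>" and minimal: "\<And>q. q \<in> \<P> \<Longrightarrow> less m q \<Longrightarrow> q = m"
    using predicate_Zorn[OF po chain] by blast
  have msub: "sublinear_on S m" and mp: "\<forall>f\<in>S. m f \<le> p f" using m by (auto simp: \<P>_def)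
  have m0: "m (\<lambda>_. 0) = 0"
    using sublinear_onD(1)[OF msub S_zero S_zero] sublinear_onD(2)[OF msub _ S_zero, of "1/2"] by simp
  have super: "m f + m y \<le> m (\<lambda>z. f z + y z)" if f: "f \<in> S" and y: "y \<in> S" for f y
  proof -
    (* Subtracting t m(y) is harmless from below because m(t y) = t m(y) for nonnegative t. *)
    define v where "v f t = m (\<lambda>z. f z + t * y z) - t * m y" for f and t :: real
    define r where "r f = (if f \<in> S then INF t\<in>{0..}. v f t else 0)" for f
    have my: "m (\<lambda>z. t * y z) \<le> t * m y" if "0 \<le> t" for t
      using that sublinear_onD(2)[OF msub _ y, of t] m0 by (cases "t = 0") auto
    have my': "t * m y \<le> m (\<lambda>z. t * y z)" if "0 \<le> t" for t
    proof (cases "t = 0")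
      case False
      then have t: "0 < t" using that by simp
      have "m (\<lambda>z. (1/t) * (t * y z)) \<le> (1/t) * m (\<lambda>z. t * y z)"
        using sublinear_onD(2)[OF msub _ S_scale[OF y], of "1/t" t] t by simp
      then show ?thesis using t by (simp add: field_simps)
    qed (use m0 in simp)
    have vlow: "- m (\<lambda>z. - 1 * f z) \<le> v f t" if f: "f \<in> S" and t: "0 \<le> t" for f t
    proof -
      have "m (\<lambda>z. (f z + t * y z) + (-1) * f z) \<le> m (\<lambda>z. f z + t * y z) + m (\<lambda>z. -1 * f z)"
        by (rule sublinear_onD(1)[OF msub S_add[OF f S_scale[OF y]] S_scale[OF f]])
      moreover have "(\<lambda>z. (f z + t * y z) + (-1) * f z) = (\<lambda>z. t * y z)" by auto
      ultimately show ?thesis using my'[OF t] by (simp add: v_def)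
    qed
    have bdd: "bdd_below (v f ` {0..})" if "f \<in> S" for f
      using vlow[OF that] by (intro bdd_belowI2) auto
    have r_le: "r f \<le> v f t" if "f \<in> S" "0 \<le> t" for f t
      using that bdd by (auto simp: r_def intro: cINF_lower)
    have r_ge: "c \<le> r f" if "f \<in> S" "\<And>t. 0 \<le> t \<Longrightarrow> c \<le> v f t" for f c
      using that by (auto simp: r_def intro!: cINF_greatest)
    have v0: "v f 0 = m f" for f by (simp add: v_def)
    have "r \<in> \<P>"
      unfolding \<P>_def
    proof (intro CollectI conjI ballI allI impI)
      show "sublinear_on S r"
        unfolding sublinear_on_def
      proof (intro conjI ballI allI impI)
        fix f g assume f: "f \<in> S" and g: "g \<in> S"
        have 1: "r (\<lambda>z. f z + g z) \<le> v f s + v g t" if "0 \<le> s" "0 \<le> t" for s t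
        proof -
          have "r (\<lambda>z. f z + g z) \<le> v (\<lambda>z. f z + g z) (s + t)"
            using r_le[OF S_add[OF f g]] that by simp
          also have "(\<lambda>z. f z + g z + (s + t) * y z) = (\<lambda>z. (f z + s * y z) + (g z + t * y z))"
            by (auto simp: algebra_simps)
          then have "v (\<lambda>z. f z + g z) (s + t) \<le> v f s + v g t"
            using sublinear_onD(1)[OF msub S_add[OF f S_scale[OF y]] S_add[OF g S_scale[OF y]], of s t]
            by (simp add: v_def algebra_simps)
          finally show ?thesis .
        qed
        have "r (\<lambda>z. f z + g z) - v g t \<le> r f" if "0 \<le> t" for t
          by (rule r_ge[OF f]) (use 1[OF _ that] in fastforce)
        then have "r (\<lambda>z. f z + g z) - r f \<le> r g"
          by (intro r_ge[OF g]) fastforce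
        then show "r (\<lambda>z. f z + g z) \<le> r f + r g" by simp
      next
        fix c :: real and f assume c: "0 < c" and f: "f \<in> S"
        have "r (\<lambda>z. c * f z) / c \<le> r f"
        proof (rule r_ge[OF f])
          fix t :: real assume t: "0 \<le> t"
          have "r (\<lambda>z. c * f z) \<le> v (\<lambda>z. c * f z) (c * t)"
            using r_le[OF S_scale[OF f]] t c by simp
          also have "(\<lambda>z. c * f z + c * t * y z) = (\<lambda>z. c * (f z + t * y z))"
            by (auto simp: algebra_simps)
          then have "v (\<lambda>z. c * f z) (c * t) \<le> c * v f t"
            using sublinear_onD(2)[OF msub c S_add[OF f S_scale[OF y]], of t]
            by (simp add: v_def algebra_simps)
          finally show "r (\<lambda>z. c * f z) / c \<le> v f t" using c by (simp add: field_simps)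
        qed
        then show "r (\<lambda>z. c * f z) \<le> c * r f" using c by (simp add: field_simps)
      qed
      fix f assume f: "f \<in> S"
      show "r f \<le> p f" using r_le[OF f, of 0] mp f by (force simp: v0)
    qed (simp add: r_def)
    moreover have "less m r"
      unfolding less_def
    proof
      fix f show "r f \<le> m f"
        using r_le[of f 0] m by (cases "f \<in> S") (auto simp: r_def v0 \<P>_def)
    qed
    ultimately have "r = m" by (rule minimal)
    then have "m f \<le> v f 1" using r_le[OF f, of 1] by simp
    then show ?thesis by (simp add: v_def)
  qed
  show thesis
  proof (rule that)
    show "m (\<lambda>z. f z + g z) = m f + m g" if "f \<in> S" "g \<in> S" for f g
      using super[OF that] sublinear_onD(1)[OF msub that] by simp
    show "m f \<le> p f" if "f \<in> S" for f using mp that by blast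
  qed
qed

lemma sum_lessThan_append: "(\<Sum>i<M + N. g i) = (\<Sum>i<M. g i) + (\<Sum>i<N. g (M + i :: nat))"
  by (induction N) (auto simp: add.assoc)

lemma shiftable_append:
  assumes 1: "shiftable scale A M h a" and 2: "shiftable scale A N k b"
    and h: "\<And>i. i < M \<Longrightarrow> g i = h i \<and> c i = a i" "\<And>i. i < N \<Longrightarrow> g (M + i) = k i \<and> c (M + i) = b i"
  shows "shiftable scale A (M + N) g c"
  unfolding shiftable_def
proof (intro allI impI)
  fix \<beta> assume "\<forall>i<M + N. A (\<beta> i) = 0"
  then have bM: "\<And>i. i < M \<Longrightarrow> A (\<beta> i) = 0" and bN: "\<And>i. i < N \<Longrightarrow> A (\<beta> (M + i)) = 0" by auto
  obtain x where x: "\<And>i. i < M \<Longrightarrow> A (x i) = a i"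
    and xZ: "\<And>Z. psd_form scale Z \<Longrightarrow>
      (\<Sum>i<M. Re (Z (x i) (x i))) \<le> (\<Sum>i<M. Re (Z (h i + a i + \<beta> i) (h i + a i + \<beta> i)))"
    using shiftableE[OF 1, of \<beta>] bM by blast
  obtain y where y: "\<And>i. i < N \<Longrightarrow> A (y i) = b i"
    and yZ: "\<And>Z. psd_form scale Z \<Longrightarrow>
      (\<Sum>i<N. Re (Z (y i) (y i))) \<le> (\<Sum>i<N. Re (Z (k i + b i + \<beta> (M + i)) (k i + b i + \<beta> (M + i))))"
    using shiftableE[OF 2, of "\<lambda>i. \<beta> (M + i)"] bN by blast
  let ?u = "\<lambda>i. if i < M then x i else y (i - M)"
  have u1: "A (?u i) = c i" if "i < M + N" for i
  proof (cases "i < M")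
    case True
    then show ?thesis using x h(1) by simp
  next
    case False
    then show ?thesis using y[of "i - M"] h(2)[of "i - M"] that by simp
  qed
  have u2: "(\<Sum>i<M + N. Re (Z (?u i) (?u i))) \<le> (\<Sum>i<M + N. Re (Z (g i + c i + \<beta> i) (g i + c i + \<beta> i)))"
    if Z: "psd_form scale Z" for Z
  proof -
    have "(\<Sum>i<M + N. Re (Z (?u i) (?u i))) = (\<Sum>i<M. Re (Z (x i) (x i))) + (\<Sum>i<N. Re (Z (y i) (y i)))"
      unfolding sum_lessThan_append by simp
    moreover have "(\<Sum>i<M + N. Re (Z (g i + c i + \<beta> i) (g i + c i + \<beta> i)))
        = (\<Sum>i<M. Re (Z (h i + a i + \<beta> i) (h i + a i + \<beta> i)))
          + (\<Sum>i<N. Re (Z (k i + b i + \<beta> (M + i)) (k i + b i + \<beta> (M + i))))"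
      unfolding sum_lessThan_append using h by (intro arg_cong2[where f = "(+)"] sum.cong refl) auto
    ultimately show ?thesis using xZ[OF Z] yZ[OF Z] by linarith
  qed
  show "\<exists>x. (\<forall>i<M + N. A (x i) = c i) \<and> (\<forall>Z. psd_form scale Z \<longrightarrow>
      (\<Sum>i<M + N. Re (Z (x i) (x i))) \<le> (\<Sum>i<M + N. Re (Z (g i + c i + \<beta> i) (g i + c i + \<beta> i))))"
    by (intro exI[of _ ?u] conjI allI impI u1 u2)
qed

lemma shiftable_scale:
  assumes vs: "vector_space scale" and A: "\<And>c x. A (scale c x) = scale c (A x)" and c: "c \<noteq> 0"
    and sh: "shiftable scale A M h a"
  shows "shiftable scale A M (\<lambda>i. scale c (h i)) (\<lambda>i. scale c (a i))"
  unfolding shiftable_def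
proof (intro allI impI)
  interpret vector_space scale by (rule vs)
  fix \<beta> assume "\<forall>i<M. A (\<beta> i) = 0"
  then have b: "A (scale (inverse c) (\<beta> i)) = 0" if "i < M" for i using that A by simp
  obtain x where x: "\<And>i. i < M \<Longrightarrow> A (x i) = a i"
    and xZ: "\<And>Z. psd_form scale Z \<Longrightarrow> (\<Sum>i<M. Re (Z (x i) (x i)))
      \<le> (\<Sum>i<M. Re (Z (h i + a i + scale (inverse c) (\<beta> i)) (h i + a i + scale (inverse c) (\<beta> i))))"
    using shiftableE[OF sh, of "\<lambda>i. scale (inverse c) (\<beta> i)"] b by blast
  have e: "scale c (h i) + scale c (a i) + \<beta> i = scale c (h i + a i + scale (inverse c) (\<beta> i))" for i
    using c by (simp add: scale_right_distrib)
  have "(\<Sum>i<M. Re (Z (scale c (x i)) (scale c (x i))))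
      \<le> (\<Sum>i<M. Re (Z (scale c (h i) + scale c (a i) + \<beta> i) (scale c (h i) + scale c (a i) + \<beta> i)))"
    if Z: "psd_form scale Z" for Z
  proof -
    interpret Z: psd_form scale Z by (rule Z)
    show ?thesis
      unfolding e Z.sq_def[symmetric] Z.sq_scale sum_distrib_left[symmetric]
      by (intro mult_left_mono) (use xZ[OF Z] in \<open>simp_all add: Z.sq_def\<close>)
  qed
  then show "\<exists>x. (\<forall>i<M. A (x i) = scale c (a i)) \<and> (\<forall>Z. psd_form scale Z \<longrightarrow>
      (\<Sum>i<M. Re (Z (x i) (x i))) \<le> (\<Sum>i<M. Re (Z (scale c (h i) + scale c (a i) + \<beta> i) (scale c (h i) + scale c (a i) + \<beta> i))))"
    using x A by (intro exI[of _ "\<lambda>i. scale c (x i)"] conjI allI impI) auto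
qed

context contractive_pencil
begin

text \<open>
  A family is a list of pairs $(h_i, a_i)$, so that families can be juxtaposed.
\<close>
definition gram :: "('v \<times> 'v) list \<Rightarrow> 'v \<Rightarrow> real" where
  "gram ps z = (\<Sum>(h, a)\<leftarrow>ps. (cmod (ip z h))\<^sup>2)"

definition cost :: "('v \<times> 'v) list \<Rightarrow> real" where
  "cost ps = (\<Sum>(h, a)\<leftarrow>ps. 2 * Re (ip h a))"

definition energy :: "('v \<times> 'v) list \<Rightarrow> real" where
  "energy ps = (\<Sum>(h, a)\<leftarrow>ps. sq h)"

definition chain :: "('v \<Rightarrow> 'v) \<Rightarrow> ('v \<times> 'v) list \<Rightarrow> bool" where
  "chain C ps \<longleftrightarrow> shiftable scale C (length ps) (\<lambda>i. fst (ps ! i)) (\<lambda>i. snd (ps ! i))"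

definition scale_family :: "real \<Rightarrow> ('v \<times> 'v) list \<Rightarrow> ('v \<times> 'v) list" where
  "scale_family c = map (\<lambda>(h, a). (of_real c *s h, of_real c *s a))"

lemma sum_list_eq: "(\<Sum>p\<leftarrow>ps. g p) = (\<Sum>i<length ps. g (ps ! i))"
  by (simp add: sum_list_sum_nth atLeast0LessThan)

lemma family_append:
  "gram (ps @ qs) z = gram ps z + gram qs z" "cost (ps @ qs) = cost ps + cost qs"
  "energy (ps @ qs) = energy ps + energy qs"
  by (simp_all add: gram_def cost_def energy_def)

lemma family_scale:
  "gram (scale_family c ps) z = c\<^sup>2 * gram ps z" "cost (scale_family c ps) = c\<^sup>2 * cost ps"
  "energy (scale_family c ps) = c\<^sup>2 * energy ps"
  by (induction ps) (auto simp: scale_family_def gram_def cost_def energy_def sq_scale scale_left scale_right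
      norm_mult power_mult_distrib algebra_simps power2_eq_square)

lemma chain_append: "chain C ps \<Longrightarrow> chain C qs \<Longrightarrow> chain C (ps @ qs)"
  unfolding chain_def length_append
  by (rule shiftable_append) (auto simp: nth_append)

lemma chain_scale:
  assumes C: "\<And>c x. C (c *s x) = c *s C x" and "c \<noteq> 0" and ps: "chain C ps"
  shows "chain C (scale_family c ps)"
proof -
  have "shiftable scale C (length ps) (\<lambda>i. of_real c *s fst (ps ! i)) (\<lambda>i. of_real c *s snd (ps ! i))"
    using assms by (intro shiftable_scale vector_space_axioms) (auto simp: chain_def)
  then have "shiftable scale C (length ps + 0) (\<lambda>i. fst (scale_family c ps ! i)) (\<lambda>i. snd (scale_family c ps ! i))"
    by (rule shiftable_append[where N = 0 and k = "\<lambda>_. 0" and b = "\<lambda>_. 0"])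
      (auto simp: scale_family_def shiftable_def split: prod.split)
  then show ?thesis by (simp add: chain_def scale_family_def)
qed

lemma chain_Nil: "chain C []"
  by (simp add: chain_def shiftable_def)

text \<open>
  Here $V = 0$: a single vector shifts to nothing.
\<close>
lemma chain_single:
  assumes "C 0 = 0" shows "chain C [(x, 0)]"
  unfolding chain_def shiftable_def
proof (intro allI impI)
  fix \<beta>
  show "\<exists>xa. (\<forall>i<length [(x, 0)]. C (xa i) = snd ([(x, 0)] ! i)) \<and> (\<forall>Z. psd_form scale Z \<longrightarrow>
      (\<Sum>i<length [(x, 0)]. Re (Z (xa i) (xa i))) \<le> (\<Sum>i<length [(x, 0)].
        Re (Z (fst ([(x, 0)] ! i) + snd ([(x, 0)] ! i) + \<beta> i) (fst ([(x, 0)] ! i) + snd ([(x, 0)] ! i) + \<beta> i))))"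
    using assms by (intro exI[of _ "\<lambda>_. 0"]) (auto simp: psd_form.nonneg psd_form.zero_left)
qed

lemma mixed_chain_inequality:
  assumes "chain A ps" "chain B qs" "\<And>z. gram ps z = gram qs z"
  shows "0 \<le> energy ps + cost ps + cost qs"
  using mixed_shift_inequality[OF assms(1,2)[unfolded chain_def]] assms(3)
  by (simp add: gram_def cost_def energy_def sum_list_eq case_prod_unfold sum_distrib_left)

text \<open>
  A functional $\phi$ that is to satisfy $\phi(\mathrm{gram}\,ps) \le \mathrm{energy}\,ps + \mathrm{cost}\,ps$ for the
  families of $A$ and $\phi(\mathrm{gram}\,qs) \ge - \mathrm{cost}\,qs$ for those of $B$ is bounded on
  $g = \mathrm{gram}\,ps - \mathrm{gram}\,qs$ by $\mathrm{energy}\,ps + \mathrm{cost}\,ps + \mathrm{cost}\,qs$. The best such bound is a sublinear function of $g$, and it is finite by \<open>mixed_chain_inequality\<close>.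
\<close>
definition splittings :: "('v \<Rightarrow> real) \<Rightarrow> (('v \<times> 'v) list \<times> ('v \<times> 'v) list) set" where
  "splittings g = {(ps, qs). chain A ps \<and> chain B qs \<and> (\<forall>z. g z = gram ps z - gram qs z)}"

definition price :: "('v \<Rightarrow> real) \<Rightarrow> real" where
  "price g = (INF (ps, qs)\<in>splittings g. energy ps + cost ps + cost qs)"

definition rank_one :: "'v \<Rightarrow> 'v \<Rightarrow> real" where
  "rank_one x z = (cmod (ip z x))\<^sup>2"

lemma splittings_negative:
  assumes "splittings g \<noteq> {}" shows "splittings (\<lambda>z. - g z) \<noteq> {}"
proof -
  obtain ps qs where "(ps, qs) \<in> splittings g" using assms by auto
  then have split: "chain A ps" "chain B qs" "\<And>z. g z = gram ps z - gram qs z" by (auto simp: splittings_def)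
  have "gram (map (\<lambda>p. (fst p, 0)) ps) z = gram ps z" for z and ps :: "('v \<times> 'v) list"
    by (simp add: gram_def case_prod_unfold comp_def)
  moreover have single: "chain C (map (\<lambda>p. (fst p, 0)) ps)" if "C 0 = 0" for C and ps :: "('v \<times> 'v) list"
  proof (induction ps)
    case Nil
    show ?case by (simp add: chain_Nil)
  next
    case (Cons p ps)
    show ?case using chain_append[OF chain_single[of C "fst p", OF that] Cons] by simp
  qed
  ultimately have "(map (\<lambda>p. (fst p, 0)) qs, map (\<lambda>p. (fst p, 0)) ps) \<in> splittings (\<lambda>z. - g z)"
    unfolding splittings_def using split(3) single[of A, OF A_zero] single[of B, OF B_zero] by simp
  then show ?thesis by blast
qed

lemma bdd_price: "bdd_below ((\<lambda>(ps, qs). energy ps + cost ps + cost qs) ` splittings g)"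
proof (cases "splittings g = {}")
  case False
  obtain ps0 qs0 where neg: "(ps0, qs0) \<in> splittings (\<lambda>z. - g z)"
    using splittings_negative[OF False] by auto
  have "- (energy ps0 + cost ps0 + cost qs0) \<le> energy ps + cost ps + cost qs"
    if "(ps, qs) \<in> splittings g" for ps qs
  proof -
    have gz: "g z = gram ps z - gram qs z" and gz': "- g z = gram ps0 z - gram qs0 z" for z
      using that neg by (auto simp: splittings_def)
    have "gram (ps @ ps0) z = gram (qs @ qs0) z" for z
      using gz[of z] gz'[of z] by (simp add: family_append)
    moreover have "chain A (ps @ ps0)" "chain B (qs @ qs0)"
      using that neg by (auto simp: splittings_def intro: chain_append)
    ultimately show ?thesis
      using mixed_chain_inequality[of "ps @ ps0" "qs @ qs0"] by (simp add: family_append)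
  qed
  then show ?thesis by (intro bdd_belowI2[where m = "- (energy ps0 + cost ps0 + cost qs0)"]) auto
qed simp

lemma price_le: "(ps, qs) \<in> splittings g \<Longrightarrow> price g \<le> energy ps + cost ps + cost qs"
  unfolding price_def using cINF_lower[OF bdd_price, of "(ps, qs)" g] by simp

lemma price_ge:
  assumes "splittings g \<noteq> {}"
    and "\<And>ps qs. (ps, qs) \<in> splittings g \<Longrightarrow> c \<le> energy ps + cost ps + cost qs"
  shows "c \<le> price g"
  unfolding price_def using assms by (auto intro!: cINF_greatest)

lemma splittings_add:
  "(ps, qs) \<in> splittings f \<Longrightarrow> (ps', qs') \<in> splittings g \<Longrightarrow>
    (ps @ ps', qs @ qs') \<in> splittings (\<lambda>z. f z + g z)"
  by (auto simp: splittings_def family_append intro: chain_append)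

lemma splittings_scale:
  assumes "(ps, qs) \<in> splittings f" "c > 0"
  shows "(scale_family (sqrt c) ps, scale_family (sqrt c) qs) \<in> splittings (\<lambda>z. c * f z)"
proof -
  have fz: "f z = gram ps z - gram qs z" for z using assms(1) by (auto simp: splittings_def)
  have "chain A ps" "chain B qs" using assms(1) by (auto simp: splittings_def)
  then show ?thesis
    using assms(2) by (auto simp: splittings_def fz family_scale right_diff_distrib A_scale B_scale intro!: chain_scale)
qed

lemma price_sublinear: "sublinear_on {g. splittings g \<noteq> {}} price"
  unfolding sublinear_on_def
proof (intro conjI ballI allI impI)
  fix f g assume "f \<in> {g. splittings g \<noteq> {}}" "g \<in> {g. splittings g \<noteq> {}}"
  then have f: "splittings f \<noteq> {}" and g: "splittings g \<noteq> {}" by auto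
  have 1: "price (\<lambda>z. f z + g z) \<le> (energy ps + cost ps + cost qs) + (energy ps' + cost ps' + cost qs')"
    if "(ps, qs) \<in> splittings f" "(ps', qs') \<in> splittings g" for ps qs ps' qs'
    using price_le[OF splittings_add[OF that]] by (simp add: family_append)
  have "price (\<lambda>z. f z + g z) - (energy ps' + cost ps' + cost qs') \<le> price f"
    if "(ps', qs') \<in> splittings g" for ps' qs'
    by (rule price_ge[OF f]) (use 1[OF _ that] in fastforce)
  then have "price (\<lambda>z. f z + g z) - price f \<le> price g"
    by (intro price_ge[OF g]) fastforce
  then show "price (\<lambda>z. f z + g z) \<le> price f + price g" by simp
next
  fix c :: real and f assume c: "0 < c" and "f \<in> {g. splittings g \<noteq> {}}"
  then have f: "splittings f \<noteq> {}" by auto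
  have "price (\<lambda>z. c * f z) / c \<le> price f"
  proof (rule price_ge[OF f])
    fix ps qs assume "(ps, qs) \<in> splittings f"
    from price_le[OF splittings_scale[OF this c]] c
    show "price (\<lambda>z. c * f z) / c \<le> energy ps + cost ps + cost qs"
      by (simp add: family_scale field_simps)
  qed
  then show "price (\<lambda>z. c * f z) \<le> c * price f" using c by (simp add: field_simps)
qed

text \<open>
  $F(x)$ is the value of the Hahn--Banach functional at $z \mapsto |\langle z, x\rangle|^2$. The parallelogram law and
  homogeneity hold already for these functions. The complementary form is the diagonal of the Toeplitz kernel of $A$, and
  $F$ is that of the kernel of $B$.
\<close>
theorem splitting_form:
  obtains F where "psd_form scale F" "\<And>x. Re (F x x) \<le> sq x"
    "\<And>M h a. shiftable scale A M h a \<Longrightarrow>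
      0 \<le> (\<Sum>i<M. sq (h i) - Re (F (h i) (h i))) + 2 * (\<Sum>i<M. Re (ip (h i) (a i)))"
    "\<And>N k b. shiftable scale B N k b \<Longrightarrow>
      0 \<le> (\<Sum>j<N. Re (F (k j) (k j))) + 2 * (\<Sum>j<N. Re (ip (k j) (b j)))"
proof -
  define S where "S = {g. splittings g \<noteq> {}}"
  have zero: "(\<lambda>_. 0) \<in> S"
    using chain_Nil by (auto simp: S_def splittings_def gram_def intro!: exI[of _ "[]"])
  have add: "(\<lambda>z. f z + g z) \<in> S" if "f \<in> S" "g \<in> S" for f g
  proof -
    obtain ps qs ps' qs' where "(ps, qs) \<in> splittings f" "(ps', qs') \<in> splittings g"
      using \<open>f \<in> S\<close> \<open>g \<in> S\<close> by (auto simp: S_def)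
    from splittings_add[OF this] show ?thesis by (auto simp: S_def)
  qed
  have neg: "(\<lambda>z. - g z) \<in> S" if "g \<in> S" for g
    using that splittings_negative[of g] by (simp add: S_def)
  have pos: "(\<lambda>z. c * g z) \<in> S" if "g \<in> S" "c > 0" for c g
  proof -
    obtain ps qs where "(ps, qs) \<in> splittings g" using \<open>g \<in> S\<close> by (auto simp: S_def)
    from splittings_scale[OF this \<open>c > 0\<close>] show ?thesis by (auto simp: S_def)
  qed
  have scl: "(\<lambda>z. c * g z) \<in> S" if "g \<in> S" for c g
  proof (cases c "0::real" rule: linorder_cases)
    case less
    then show ?thesis using neg[OF pos[OF that, of "- c"]] by simp
  next
    case equal
    then show ?thesis using zero by simp
  next
    case greater
    then show ?thesis using pos[OF that] by simp
  qed
  obtain \<phi> where \<phi>add: "\<And>f g. f \<in> S \<Longrightarrow> g \<in> S \<Longrightarrow> \<phi> (\<lambda>z. f z + g z) = \<phi> f + \<phi> g"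
    and \<phi>le: "\<And>f. f \<in> S \<Longrightarrow> \<phi> f \<le> price f"
    using Hahn_Banach_functions[OF zero add scl price_sublinear[folded S_def]] by metis
  have \<phi>0: "\<phi> (\<lambda>_. 0) = 0" using \<phi>add[OF zero zero] by simp
  have \<phi>neg: "\<phi> (\<lambda>z. - g z) = - \<phi> g" if "g \<in> S" for g
    using \<phi>add[OF that neg[OF that]] \<phi>0 by simp
  have r1: "rank_one x \<in> S" for x
  proof -
    have "([(x, 0)], []) \<in> splittings (rank_one x)"
      using chain_single[of A x] chain_Nil by (simp add: splittings_def gram_def rank_one_def)
    then show ?thesis by (auto simp: S_def)
  qed
  define Q where "Q x = \<phi> (rank_one x)" for x
  have gS: "(\<lambda>z. \<Sum>(h, a)\<leftarrow>ps. rank_one h z) \<in> S" and gQ: "\<phi> (\<lambda>z. \<Sum>(h, a)\<leftarrow>ps. rank_one h z) = (\<Sum>(h, a)\<leftarrow>ps. Q h)" for ps :: "('v \<times> 'v) list"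
  proof -
    have "(\<lambda>z. \<Sum>(h, a)\<leftarrow>ps. rank_one h z) \<in> S \<and> \<phi> (\<lambda>z. \<Sum>(h, a)\<leftarrow>ps. rank_one h z) = (\<Sum>(h, a)\<leftarrow>ps. Q h)"
    proof (induction ps)
      case Nil
      then show ?case using zero \<phi>0 by simp
    next
      case (Cons p ps)
      then show ?case using add[OF r1] \<phi>add[OF r1] by (simp add: case_prod_unfold Q_def)
    qed
    then show "(\<lambda>z. \<Sum>(h, a)\<leftarrow>ps. rank_one h z) \<in> S" "\<phi> (\<lambda>z. \<Sum>(h, a)\<leftarrow>ps. rank_one h z) = (\<Sum>(h, a)\<leftarrow>ps. Q h)" by auto
  qed
  have upper: "(\<Sum>(h, a)\<leftarrow>ps. Q h) \<le> energy ps + cost ps" if ps: "chain A ps" for ps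
  proof -
    let ?g = "\<lambda>z. \<Sum>(h, a)\<leftarrow>ps. rank_one h z"
    have "(ps, []) \<in> splittings ?g"
      using ps chain_Nil by (simp add: splittings_def gram_def rank_one_def)
    from price_le[OF this] \<phi>le[OF gS, of ps] show ?thesis by (simp add: gQ cost_def)
  qed
  have lower: "- cost qs \<le> (\<Sum>(h, a)\<leftarrow>qs. Q h)" if qs: "chain B qs" for qs
  proof -
    let ?g = "\<lambda>z. \<Sum>(h, a)\<leftarrow>qs. rank_one h z"
    have "([], qs) \<in> splittings (\<lambda>z. - ?g z)"
      using qs chain_Nil by (simp add: splittings_def gram_def rank_one_def)
    from price_le[OF this] \<phi>le[OF neg[OF gS], of qs] \<phi>neg[OF gS, of qs]
    show ?thesis by (simp add: gQ cost_def energy_def)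
  qed
  have Q_nonneg: "0 \<le> Q x" for x
    using lower[OF chain_single[of B x]] by (simp add: cost_def)
  have Q_le: "Q x \<le> sq x" for x
    using upper[OF chain_single[of A x]] by (simp add: cost_def energy_def)
  have Q_par: "Q (x + y) + Q (x - y) = 2 * Q x + 2 * Q y" for x y
  proof -
    have "(\<lambda>z. rank_one (x + y) z + rank_one (x - y) z) = (\<lambda>z. (rank_one x z + rank_one x z) + (rank_one y z + rank_one y z))"
    proof
      fix z
      show "rank_one (x + y) z + rank_one (x - y) z = (rank_one x z + rank_one x z) + (rank_one y z + rank_one y z)"
        unfolding rank_one_def add_right diff_right cmod_power2 by (simp add: power2_eq_square algebra_simps)
    qed
    then have "\<phi> (\<lambda>z. rank_one (x + y) z + rank_one (x - y) z) = \<phi> (\<lambda>z. (rank_one x z + rank_one x z) + (rank_one y z + rank_one y z))"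
      by (simp only:)
    also have "\<dots> = (\<phi> (rank_one x) + \<phi> (rank_one x)) + (\<phi> (rank_one y) + \<phi> (rank_one y))"
      by (simp only: \<phi>add[OF add[OF r1 r1] add[OF r1 r1]] \<phi>add[OF r1 r1])
    finally show ?thesis by (simp add: \<phi>add r1 Q_def)
  qed
  (* Additivity alone gives rational homogeneity; the bound 0 <= F(x) <= |x|^2 extends it to real factors. *)
  have \<phi>hom: "\<phi> (\<lambda>z. t * rank_one x z) = t * \<phi> (rank_one x)" if t: "0 \<le> t" for t x
  proof -
    have bound: "0 \<le> \<phi> (\<lambda>z. t\<^sup>2 * rank_one x z)" "\<phi> (\<lambda>z. t\<^sup>2 * rank_one x z) \<le> t\<^sup>2 * sq x" for t
    proof -
      have "(\<lambda>z. t\<^sup>2 * rank_one x z) = rank_one (of_real t *s x)"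
        by (auto simp: rank_one_def scale_right norm_mult power_mult_distrib)
      then show "0 \<le> \<phi> (\<lambda>z. t\<^sup>2 * rank_one x z)" "\<phi> (\<lambda>z. t\<^sup>2 * rank_one x z) \<le> t\<^sup>2 * sq x"
        using Q_nonneg[of "of_real t *s x"] Q_le[of "of_real t *s x"] by (simp_all add: Q_def sq_scale)
    qed
    have "(\<lambda>t. \<phi> (\<lambda>z. t * rank_one x z)) t = t * (\<lambda>t. \<phi> (\<lambda>z. t * rank_one x z)) 1"
    proof (rule additive_bounded_imp_linear)
      show "\<phi> (\<lambda>z. (s + t) * rank_one x z) = \<phi> (\<lambda>z. s * rank_one x z) + \<phi> (\<lambda>z. t * rank_one x z)" for s t
        using \<phi>add[OF scl[OF r1] scl[OF r1]] by (simp add: distrib_right)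
      show "\<bar>\<phi> (\<lambda>z. t * rank_one x z)\<bar> \<le> sq x * t\<^sup>2 + sq x" for t
      proof -
        have t: "\<bar>t\<bar> \<le> t\<^sup>2 + 1"
          using zero_le_power2[of "\<bar>t\<bar> - 1"] by (simp add: power2_diff)
        have "\<bar>\<phi> (\<lambda>z. t * rank_one x z)\<bar> = \<bar>\<phi> (\<lambda>z. \<bar>t\<bar> * rank_one x z)\<bar>"
          using \<phi>neg[OF scl[OF r1], of t x] by (cases "0 \<le> t") auto
        also have "\<dots> \<le> \<bar>t\<bar> * sq x"
          using bound[of "sqrt \<bar>t\<bar>"] by simp
        also have "\<dots> \<le> (t\<^sup>2 + 1) * sq x" by (intro mult_right_mono t) simp
        finally show ?thesis by (simp add: algebra_simps)
      qed
    qed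
    then show ?thesis by simp
  qed
  have Q_hom: "Q (c *s x) = (cmod c)\<^sup>2 * Q x" for c x
  proof -
    have "rank_one (c *s x) = (\<lambda>z. (cmod c)\<^sup>2 * rank_one x z)"
      by (auto simp: rank_one_def scale_right norm_mult power_mult_distrib)
    then show ?thesis by (simp add: Q_def \<phi>hom)
  qed
  obtain F where F: "psd_form scale F" "\<And>x. Re (F x x) = Q x"
    using Jordan_von_Neumann[OF vector_space_axioms Q_par Q_hom Q_nonneg] by metis
  have to_list: "chain C (map (\<lambda>i. (h i, a i)) [0..<M])" if "shiftable scale C M h a" for C M h a
  proof -
    have "shiftable scale C (M + 0) (\<lambda>i. fst (map (\<lambda>i. (h i, a i)) [0..<M] ! i)) (\<lambda>i. snd (map (\<lambda>i. (h i, a i)) [0..<M] ! i))"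
      using that by (rule shiftable_append[where N = 0 and k = "\<lambda>_. 0" and b = "\<lambda>_. 0"]) (auto simp: shiftable_def)
    then show ?thesis by (simp add: chain_def)
  qed
  have list_sum: "(\<Sum>(h, a)\<leftarrow>map (\<lambda>i. (h i, a i)) [0..<M]. G h a) = (\<Sum>i<M. G (h i) (a i))"
    for G :: "'v \<Rightarrow> 'v \<Rightarrow> real" and h a M
    by (simp add: sum_list_eq)
  show thesis
  proof (rule that[OF F(1)])
    show "Re (F x x) \<le> sq x" for x by (simp add: F Q_le)
    show "0 \<le> (\<Sum>i<M. sq (h i) - Re (F (h i) (h i))) + 2 * (\<Sum>i<M. Re (ip (h i) (a i)))"
      if "shiftable scale A M h a" for M h a
      using upper[OF to_list[OF that]] unfolding energy_def cost_def list_sum F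
      by (simp add: sum_subtractf sum_distrib_left)
    show "0 \<le> (\<Sum>j<N. Re (F (k j) (k j))) + 2 * (\<Sum>j<N. Re (ip (k j) (b j)))"
      if "shiftable scale B N k b" for N k b
      using lower[OF to_list[OF that]] unfolding energy_def cost_def list_sum F
      by (simp add: sum_distrib_left)
  qed
qed

end

section \<open>Completion of a semi-inner product space\<close>

context psd_form
begin

definition seminorm :: "'v \<Rightarrow> real" where "seminorm x = sqrt (sq x)"

lemma seminorm_nonneg [simp]: "0 \<le> seminorm x" by (simp add: seminorm_def)
lemma seminorm_zero [simp]: "seminorm 0 = 0" by (simp add: seminorm_def)
lemma seminorm_power2: "(seminorm x)\<^sup>2 = sq x" by (simp add: seminorm_def)
lemma seminorm_minus_commute: "seminorm (x - y) = seminorm (y - x)"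
  by (metis minus_diff_eq seminorm_def sq_minus)

lemma seminorm_Cauchy_Schwarz: "cmod (f x y) \<le> seminorm x * seminorm y"
  using Cauchy_Schwarz[of x y] unfolding seminorm_def real_sqrt_mult[symmetric] by (rule real_le_rsqrt)

lemma seminorm_triangle: "seminorm (x + y) \<le> seminorm x + seminorm y"
proof (rule power2_le_imp_le)
  have "(seminorm (x + y))\<^sup>2 \<le> (seminorm x)\<^sup>2 + (seminorm y)\<^sup>2 + 2 * (seminorm x * seminorm y)"
    using seminorm_Cauchy_Schwarz[of x y] complex_Re_le_cmod[of "f x y"] by (simp add: seminorm_power2 sq_add)
  then show "(seminorm (x + y))\<^sup>2 \<le> (seminorm x + seminorm y)\<^sup>2" by (simp add: power2_sum mult.assoc)
qed simp

lemma seminorm_triangle_diff: "seminorm (x - z) \<le> seminorm (x - y) + seminorm (y - z)"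
  using seminorm_triangle[of "x - y" "y - z"] by simp

lemma seminorm_scale: "seminorm (c *s x) = cmod c * seminorm x"
  by (simp add: seminorm_def sq_scale real_sqrt_mult)

definition Cauchy_seq :: "(nat \<Rightarrow> 'v) \<Rightarrow> bool" where
  "Cauchy_seq X \<longleftrightarrow> (\<forall>e>0. \<exists>N. \<forall>m\<ge>N. \<forall>n\<ge>N. seminorm (X m - X n) < e)"

lemma Cauchy_seqD: "Cauchy_seq X \<Longrightarrow> e > 0 \<Longrightarrow> \<exists>N. \<forall>m\<ge>N. \<forall>n\<ge>N. seminorm (X m - X n) < e"
  by (simp add: Cauchy_seq_def)

lemma Cauchy_seqE:
  assumes "Cauchy_seq X" "e > 0" obtains N where "\<And>m n. m \<ge> N \<Longrightarrow> n \<ge> N \<Longrightarrow> seminorm (X m - X n) < e"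
  using Cauchy_seqD[OF assms] by blast

lemma Cauchy_seq_const: "Cauchy_seq (\<lambda>_. x)" by (simp add: Cauchy_seq_def)

lemma Cauchy_seq_add:
  assumes "Cauchy_seq X" "Cauchy_seq Y" shows "Cauchy_seq (\<lambda>n. X n + Y n)"
  unfolding Cauchy_seq_def
proof (intro allI impI)
  fix e :: real assume "e > 0"
  then have e2: "e / 2 > 0" by simp
  obtain M where M: "\<And>m n. m \<ge> M \<Longrightarrow> n \<ge> M \<Longrightarrow> seminorm (X m - X n) < e/2"
    using Cauchy_seqE[OF assms(1) e2] by blast
  obtain N where N: "\<And>m n. m \<ge> N \<Longrightarrow> n \<ge> N \<Longrightarrow> seminorm (Y m - Y n) < e/2"
    using Cauchy_seqE[OF assms(2) e2] by blast
  have "seminorm (X m + Y m - (X n + Y n)) < e" if "m \<ge> max M N" "n \<ge> max M N" for m n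
    using seminorm_triangle[of "X m - X n" "Y m - Y n"] M[of m n] N[of m n] that
    by (simp add: algebra_simps)
  then show "\<exists>N. \<forall>m\<ge>N. \<forall>n\<ge>N. seminorm (X m + Y m - (X n + Y n)) < e" by blast
qed

lemma Cauchy_seq_scale:
  assumes "Cauchy_seq X" shows "Cauchy_seq (\<lambda>n. c *s X n)"
  unfolding Cauchy_seq_def
proof (intro allI impI)
  fix e :: real assume e: "e > 0"
  obtain N where N: "\<And>m n. m \<ge> N \<Longrightarrow> n \<ge> N \<Longrightarrow> seminorm (X m - X n) < e / (cmod c + 1)"
    using Cauchy_seqD[OF assms, of "e / (cmod c + 1)"] e by (auto simp: add_nonneg_pos)
  have "seminorm (c *s X m - c *s X n) < e" if "m \<ge> N" "n \<ge> N" for m n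
  proof -
    have "seminorm (c *s X m - c *s X n) = cmod c * seminorm (X m - X n)"
      by (simp add: seminorm_scale flip: scale_right_diff_distrib)
    also have "\<dots> \<le> (cmod c + 1) * seminorm (X m - X n)" by (simp add: distrib_right)
    also have "\<dots> < e" using N[OF that] by (simp add: pos_less_divide_eq add_nonneg_pos mult.commute)
    finally show ?thesis .
  qed
  then show "\<exists>N. \<forall>m\<ge>N. \<forall>n\<ge>N. seminorm (c *s X m - c *s X n) < e" by blast
qed

lemma Cauchy_seq_diff: "Cauchy_seq X \<Longrightarrow> Cauchy_seq Y \<Longrightarrow> Cauchy_seq (\<lambda>n. X n - Y n)"
  using Cauchy_seq_add[of X "\<lambda>n. (-1) *s Y n"] Cauchy_seq_scale[of Y "-1"] by simp

lemma Cauchy_seq_bounded: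
  assumes "Cauchy_seq X" obtains K where "K > 0" "\<And>n. seminorm (X n) \<le> K"
proof -
  obtain N where N: "\<And>m n. m \<ge> N \<Longrightarrow> n \<ge> N \<Longrightarrow> seminorm (X m - X n) < 1"
    using Cauchy_seqD[OF assms, of 1] by auto
  define K where "K = 1 + (\<Sum>n\<le>N. seminorm (X n))"
  have small: "seminorm (X n) \<le> (\<Sum>n\<le>N. seminorm (X n))" if "n \<le> N" for n
    using that by (intro member_le_sum) auto
  have "seminorm (X n) \<le> K" for n
  proof (cases "n \<le> N")
    case True then show ?thesis using small by (simp add: K_def add_increasing)
  next
    case False
    then show ?thesis
      using seminorm_triangle[of "X n - X N" "X N"] N[of n N] small[of N] by (simp add: K_def)
  qed
  moreover have "K > 0" by (simp add: K_def add_pos_nonneg sum_nonneg)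
  ultimately show thesis using that by blast
qed

lemma Cauchy_seq_form_convergent:
  assumes X: "Cauchy_seq X" and Y: "Cauchy_seq Y" shows "convergent (\<lambda>n. f (X n) (Y n))"
proof (rule Cauchy_convergent, rule CauchyI)
  fix e :: real assume e: "e > 0"
  obtain K L where K: "K > 0" "\<And>n. seminorm (X n) \<le> K" and L: "L > 0" "\<And>n. seminorm (Y n) \<le> L"
    using Cauchy_seq_bounded[OF X] Cauchy_seq_bounded[OF Y] by metis
  have pos: "e / (2 * L) > 0" "e / (2 * K) > 0" using e K L by simp_all
  obtain M where M: "\<And>m n. m \<ge> M \<Longrightarrow> n \<ge> M \<Longrightarrow> seminorm (X m - X n) < e / (2 * L)"
    using Cauchy_seqE[OF X pos(1)] by blast
  obtain N where N: "\<And>m n. m \<ge> N \<Longrightarrow> n \<ge> N \<Longrightarrow> seminorm (Y m - Y n) < e / (2 * K)"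
    using Cauchy_seqE[OF Y pos(2)] by blast
  have "cmod (f (X m) (Y m) - f (X n) (Y n)) < e" if mn: "m \<ge> max M N" "n \<ge> max M N" for m n
  proof -
    have "f (X m) (Y m) - f (X n) (Y n) = f (X m - X n) (Y m) + f (X n) (Y m - Y n)"
      by (simp add: diff_left diff_right)
    also have "cmod \<dots> \<le> seminorm (X m - X n) * seminorm (Y m) + seminorm (X n) * seminorm (Y m - Y n)"
      using seminorm_Cauchy_Schwarz[of "X m - X n" "Y m"] seminorm_Cauchy_Schwarz[of "X n" "Y m - Y n"]
      by (intro order_trans[OF norm_triangle_ineq]) simp
    also have "\<dots> \<le> seminorm (X m - X n) * L + K * seminorm (Y m - Y n)"
      using K L by (intro add_mono mult_mono) (auto intro: order_less_imp_le)
    also have "\<dots> < e / (2 * L) * L + K * (e / (2 * K))"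
      using mult_strict_right_mono[OF M[of m n] L(1)] mult_strict_left_mono[OF N[of m n] K(1)] mn by simp
    also have "\<dots> = e" using K L by (simp add: field_simps)
    finally show ?thesis .
  qed
  then show "\<exists>M. \<forall>m\<ge>M. \<forall>n\<ge>M. cmod (f (X m) (Y m) - f (X n) (Y n)) < e" by blast
qed

lemma form_tendsto_zero:
  assumes X: "(\<lambda>n. seminorm (X n)) \<longlonglongrightarrow> 0" and Y: "Cauchy_seq Y"
  shows "(\<lambda>n. f (X n) (Y n)) \<longlonglongrightarrow> 0" "(\<lambda>n. f (Y n) (X n)) \<longlonglongrightarrow> 0"
proof -
  obtain K where K: "\<And>n. seminorm (Y n) \<le> K" using Cauchy_seq_bounded[OF Y] by metis
  have le: "cmod (f (X n) (Y n)) \<le> norm (seminorm (X n)) * K" "cmod (f (Y n) (X n)) \<le> norm (seminorm (X n)) * K" for n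
    using seminorm_Cauchy_Schwarz[of "X n" "Y n"] seminorm_Cauchy_Schwarz[of "Y n" "X n"] mult_left_mono[of "seminorm (Y n)" K "seminorm (X n)"] K[of n]
    by (simp_all add: mult.commute)
  show "(\<lambda>n. f (X n) (Y n)) \<longlonglongrightarrow> 0"
    by (rule tendsto_0_le[OF X, of _ K]) (intro always_eventually allI le)
  show "(\<lambda>n. f (Y n) (X n)) \<longlonglongrightarrow> 0"
    by (rule tendsto_0_le[OF X, of _ K]) (intro always_eventually allI le)
qed

end

text \<open>
  The vectors $\phi_i$ span up to null vectors. The elements of the completion are represented by their inner products with
  the $\phi_i$, so that the completion is a space of functions of the index $i$; no quotient or type of equivalence classes is needed.
\<close>
locale spanning_family = psd_form scale s
  for scale :: "complex \<Rightarrow> 'w::ab_group_add \<Rightarrow> 'w" (infixr "*s" 75) and s +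
  fixes \<phi> :: "'i \<Rightarrow> 'w"
  assumes spanning: "\<exists>F c. finite F \<and> (\<forall>u. s u w = (\<Sum>i\<in>F. c i * s u (\<phi> i)))"
begin

definition represents :: "(nat \<Rightarrow> 'w) \<Rightarrow> ('i \<Rightarrow> complex) \<Rightarrow> bool" where
  "represents X f \<longleftrightarrow> Cauchy_seq X \<and> (\<forall>i. (\<lambda>n. s (X n) (\<phi> i)) \<longlonglongrightarrow> f i)"

definition space :: "('i \<Rightarrow> complex) set" where "space = {f. \<exists>X. represents X f}"

definition inner :: "('i \<Rightarrow> complex) \<Rightarrow> ('i \<Rightarrow> complex) \<Rightarrow> complex" where
  "inner f g = lim (\<lambda>n. s ((SOME X. represents X f) n) ((SOME X. represents X g) n))"

definition hat :: "'w \<Rightarrow> 'i \<Rightarrow> complex" where "hat w i = s w (\<phi> i)"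

lemma representsE:
  assumes "f \<in> space" obtains X where "represents X f"
  using assms by (auto simp: space_def)

lemma represents_space: "represents X f \<Longrightarrow> f \<in> space" by (auto simp: space_def)

lemma represents_hat: "represents (\<lambda>_. w) (hat w)"
  by (simp add: represents_def Cauchy_seq_const hat_def)

lemma represents_add: "represents X f \<Longrightarrow> represents Y g \<Longrightarrow> represents (\<lambda>n. X n + Y n) (\<lambda>i. f i + g i)"
  by (auto simp: represents_def add_left intro: Cauchy_seq_add tendsto_add)

lemma represents_scale: "represents X f \<Longrightarrow> represents (\<lambda>n. c *s X n) (\<lambda>i. c * f i)"
  by (auto simp: represents_def scale_left intro: Cauchy_seq_scale tendsto_mult_left)

lemma represents_diff: "represents X f \<Longrightarrow> represents Y g \<Longrightarrow> represents (\<lambda>n. X n - Y n) (\<lambda>i. f i - g i)"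
  by (auto simp: represents_def diff_left intro: Cauchy_seq_diff tendsto_diff)

lemma represents_zero: "represents (\<lambda>_. 0) (\<lambda>_. 0)"
  by (simp add: represents_def Cauchy_seq_const)

text \<open>
  Write $\|X_n\|^2 = \langle X_n, X_n - X_N\rangle + \langle X_n, X_N\rangle$. The first summand is small because the sequence is Cauchy, the
  second because $X_N$ is a combination of the $\phi_i$. Hence a function determines its representing Cauchy sequences up to null sequences, and
  inner products can be defined by limits.
\<close>
lemma weakly_null_Cauchy_is_null:
  assumes "represents X (\<lambda>_. 0)" shows "(\<lambda>n. seminorm (X n)) \<longlonglongrightarrow> 0"
proof -
  have X: "Cauchy_seq X" and w0: "\<And>i. (\<lambda>n. s (X n) (\<phi> i)) \<longlonglongrightarrow> 0"
    using assms by (auto simp: represents_def)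
  have weak: "(\<lambda>n. s (X n) w) \<longlonglongrightarrow> 0" for w
  proof -
    obtain F c where F: "finite F" "\<And>u. s u w = (\<Sum>i\<in>F. c i * s u (\<phi> i))"
      using spanning by meson
    have "(\<lambda>n. \<Sum>i\<in>F. c i * s (X n) (\<phi> i)) \<longlonglongrightarrow> (\<Sum>i\<in>F. c i * 0)"
      by (intro tendsto_sum tendsto_mult_left w0)
    then show ?thesis by (simp add: F(2))
  qed
  obtain K where K: "K > 0" "\<And>n. seminorm (X n) \<le> K" using Cauchy_seq_bounded[OF X] by metis
  have "(\<lambda>n. sq (X n)) \<longlonglongrightarrow> 0"
  proof (rule LIMSEQ_I)
    fix e :: real assume e: "e > 0"
    obtain N where N: "\<And>m n. m \<ge> N \<Longrightarrow> n \<ge> N \<Longrightarrow> seminorm (X m - X n) < e / (2 * K)"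
      using Cauchy_seqD[OF X, of "e / (2 * K)"] e K by auto
    obtain M where M: "\<And>n. n \<ge> M \<Longrightarrow> cmod (s (X n) (X N)) < e / 2"
      using LIMSEQ_D[OF weak[of "X N"], of "e / 2"] e by auto
    have "norm (sq (X n) - 0) < e" if n: "n \<ge> max M N" for n
    proof -
      have "complex_of_real (sq (X n)) = s (X n) (X n - X N) + s (X n) (X N)"
        by (simp add: diff_right self_real)
      then have "cmod (complex_of_real (sq (X n))) \<le> cmod (s (X n) (X n - X N)) + cmod (s (X n) (X N))"
        using norm_triangle_ineq by metis
      then have "sq (X n) \<le> cmod (s (X n) (X n - X N)) + cmod (s (X n) (X N))" by simp
      also have "cmod (s (X n) (X n - X N)) \<le> seminorm (X n) * seminorm (X n - X N)" by (rule seminorm_Cauchy_Schwarz)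
      also have "\<dots> \<le> K * (e / (2 * K))"
        using K N[of n N] n by (intro mult_mono) (auto intro: order_less_imp_le)
      also have "K * (e / (2 * K)) = e / 2" using K by simp
      finally show ?thesis using M[of n] n by simp
    qed
    then show "\<exists>no. \<forall>n\<ge>no. norm (sq (X n) - 0) < e" by blast
  qed
  then have "(\<lambda>n. sqrt (sq (X n))) \<longlonglongrightarrow> sqrt 0" by (rule tendsto_real_sqrt)
  then show ?thesis by (simp add: seminorm_def)
qed

lemma inner_lim:
  assumes X: "represents X f" and Y: "represents Y g"
  shows "(\<lambda>n. s (X n) (Y n)) \<longlonglongrightarrow> inner f g"
proof -
  define X' Y' where "X' = (SOME X. represents X f)" and "Y' = (SOME X. represents X g)"
  have X': "represents X' f" and Y': "represents Y' g"
    unfolding X'_def Y'_def using X Y by (metis someI)+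
  have Cauchy_seq: "Cauchy_seq X" "Cauchy_seq Y" "Cauchy_seq X'" "Cauchy_seq Y'" using X Y X' Y' by (auto simp: represents_def)
  have dX: "(\<lambda>n. seminorm (X n - X' n)) \<longlonglongrightarrow> 0" and dY: "(\<lambda>n. seminorm (Y n - Y' n)) \<longlonglongrightarrow> 0"
    using weakly_null_Cauchy_is_null represents_diff[OF X X'] represents_diff[OF Y Y'] by simp_all
  have "(\<lambda>n. s (X' n) (Y' n)) \<longlonglongrightarrow> inner f g"
    using Cauchy_seq_form_convergent[OF Cauchy_seq(3,4)] unfolding inner_def X'_def Y'_def
    by (simp add: convergent_LIMSEQ_iff)
  then have "(\<lambda>n. s (X' n) (Y' n) + s (X n - X' n) (Y n) + s (X' n) (Y n - Y' n)) \<longlonglongrightarrow> inner f g + 0 + 0"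
    by (intro tendsto_add form_tendsto_zero dX dY Cauchy_seq)
  then show ?thesis by (simp add: diff_left diff_right)
qed

lemma inner_hat: "inner (hat u) (hat w) = s u w"
  using inner_lim[OF represents_hat represents_hat] by (simp add: LIMSEQ_const_iff)

text \<open>
  The fields \<open>mult\<close> and \<open>one\<close> are filled with arbitrary values.
\<close>
definition completion :: "('i \<Rightarrow> complex) hilbert" where
  "completion = \<lparr>carrier = space, monoid.mult = (\<lambda>f g. f), one = (\<lambda>_. 0), zero = (\<lambda>_. 0),
    add = (\<lambda>f g i. f i + g i), smult = (\<lambda>c f i. c * f i), cinner = inner\<rparr>"

lemma completion_simps [simp]:
  "carrier completion = space" "\<zero>\<^bsub>completion\<^esub> = (\<lambda>_. 0)" "f \<oplus>\<^bsub>completion\<^esub> g = (\<lambda>i. f i + g i)"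
  "c \<odot>\<^bsub>completion\<^esub> f = (\<lambda>i. c * f i)" "cinner completion = inner"
  by (simp_all add: completion_def)

lemma space_add: "f \<in> space \<Longrightarrow> g \<in> space \<Longrightarrow> (\<lambda>i. f i + g i) \<in> space"
  by (auto elim!: representsE intro: represents_space represents_add)

lemma space_scale: "f \<in> space \<Longrightarrow> (\<lambda>i. c * f i) \<in> space"
  by (auto elim!: representsE intro: represents_space represents_scale)

lemma space_diff: "f \<in> space \<Longrightarrow> g \<in> space \<Longrightarrow> (\<lambda>i. f i - g i) \<in> space"
  by (auto elim!: representsE intro: represents_space represents_diff)

lemma hat_space: "hat w \<in> space" using represents_hat represents_space by blast

lemma zero_space: "(\<lambda>_. 0) \<in> space" using represents_zero represents_space by blast

lemma hnorm_lim:
  assumes "represents X f" shows "(\<lambda>n. seminorm (X n)) \<longlonglongrightarrow> hnorm completion f"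
  unfolding hnorm_def seminorm_def sq_def completion_simps
  by (intro tendsto_real_sqrt tendsto_Re inner_lim assms)

lemma hnorm_hat: "hnorm completion (hat w) = seminorm w"
  using hnorm_lim[OF represents_hat[of w]] by (simp add: LIMSEQ_const_iff)

lemma hnorm_triangle:
  assumes "f \<in> space" "g \<in> space" "h \<in> space"
  shows "hnorm completion (\<lambda>i. f i - h i) \<le> hnorm completion (\<lambda>i. f i - g i) + hnorm completion (\<lambda>i. g i - h i)"
proof -
  obtain X Y W where r: "represents X f" "represents Y g" "represents W h"
    using assms by (meson representsE)
  show ?thesis
    by (rule LIMSEQ_le[OF hnorm_lim[OF represents_diff[OF r(1,3)]]
          tendsto_add[OF hnorm_lim[OF represents_diff[OF r(1,2)]] hnorm_lim[OF represents_diff[OF r(2,3)]]]])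
      (use seminorm_triangle_diff in blast)
qed

lemma hnorm_commute:
  assumes "f \<in> space" "g \<in> space"
  shows "hnorm completion (\<lambda>i. f i - g i) = hnorm completion (\<lambda>i. g i - f i)"
proof -
  obtain X Y where r: "represents X f" "represents Y g" using assms by (meson representsE)
  show ?thesis
    using hnorm_lim[OF represents_diff[OF r]] hnorm_lim[OF represents_diff[OF r(2,1)]]
    by (simp add: seminorm_minus_commute LIMSEQ_unique)
qed

lemma completion_abelian_group: "abelian_group completion"
proof (rule abelian_groupI)
  fix f assume "f \<in> carrier completion"
  then have "(\<lambda>i. -1 * f i) \<in> space" using space_scale[of f "-1"] by simp
  then show "\<exists>g\<in>carrier completion. g \<oplus>\<^bsub>completion\<^esub> f = \<zero>\<^bsub>completion\<^esub>"
    by (intro bexI[of _ "\<lambda>i. -1 * f i"]) auto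
qed (auto simp: space_add zero_space add_ac)

lemma completion_minus:
  assumes "f \<in> space" "g \<in> space"
  shows "f \<ominus>\<^bsub>completion\<^esub> g = (\<lambda>i. f i - g i)"
proof -
  interpret C: abelian_group completion by (rule completion_abelian_group)
  have "(\<lambda>i. -1 * g i) \<in> space" using space_scale[of g "-1"] assms by simp
  then have "\<ominus>\<^bsub>completion\<^esub> g = (\<lambda>i. - g i)"
    using C.minus_equality[of "\<lambda>i. - g i" g] assms by simp
  then show ?thesis by (simp add: C.minus_eq)
qed

lemma complex_ring_cring: "cring complex_ring"
proof (rule cringI)
  show "abelian_group complex_ring"
  proof (rule abelian_groupI)
    fix x assume "x \<in> carrier complex_ring"
    show "\<exists>y\<in>carrier complex_ring. y \<oplus>\<^bsub>complex_ring\<^esub> x = \<zero>\<^bsub>complex_ring\<^esub>"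
      by (intro bexI[of _ "- x"]) (auto simp: complex_ring_def)
  qed (auto simp: complex_ring_def)
  show "comm_monoid complex_ring"
    by (rule comm_monoidI) (auto simp: complex_ring_def)
qed (auto simp: complex_ring_def algebra_simps)

lemma completion_complete:
  assumes X: "\<And>n. X n \<in> space"
    and Cau: "\<And>e. e > 0 \<Longrightarrow> \<exists>N. \<forall>m\<ge>N. \<forall>n\<ge>N. hnorm completion (\<lambda>i. X m i - X n i) < e"
  shows "\<exists>L\<in>space. (\<lambda>n. hnorm completion (\<lambda>i. X n i - L i)) \<longlonglongrightarrow> 0"
proof -
  have "\<exists>w. hnorm completion (\<lambda>i. X n i - hat w i) \<le> 1 / Suc n" for n
  proof -
    obtain W where W: "represents W (X n)" using X representsE by blast
    then have "Cauchy_seq W" by (simp add: represents_def)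
    then obtain k where k: "\<And>m. m \<ge> k \<Longrightarrow> seminorm (W m - W k) < 1 / Suc n"
      using Cauchy_seqD[of W "1 / Suc n"] by auto
    have "(\<lambda>m. seminorm (W m - W k)) \<longlonglongrightarrow> hnorm completion (\<lambda>i. X n i - hat (W k) i)"
      by (rule hnorm_lim[OF represents_diff[OF W represents_hat]])
    then have "hnorm completion (\<lambda>i. X n i - hat (W k) i) \<le> 1 / Suc n"
      by (rule LIMSEQ_le_const2) (use k in \<open>auto intro!: exI[of _ k] order_less_imp_le\<close>)
    then show ?thesis by blast
  qed
  then obtain w where w: "\<And>n. hnorm completion (\<lambda>i. X n i - hat (w n) i) \<le> 1 / Suc n" by metis
  have small: "\<exists>N. \<forall>n\<ge>N. 1 / real (Suc n) < e" if "e > 0" for e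
  proof -
    have "(\<lambda>n. 1 / real (Suc n)) \<longlonglongrightarrow> 0" by (rule lim_1_over_n[THEN LIMSEQ_Suc])
    from LIMSEQ_D[OF this that] show ?thesis by auto
  qed
  (* The diagonal sequence w of approximants is Cauchy before completion, and its limit is that of X. *)
  have cw: "Cauchy_seq w"
    unfolding Cauchy_seq_def
  proof (intro allI impI)
    fix e :: real assume e: "e > 0"
    obtain N where N: "\<And>n. n \<ge> N \<Longrightarrow> 1 / real (Suc n) < e / 3" using small[of "e/3"] e by auto
    obtain M where M: "\<And>m n. m \<ge> M \<Longrightarrow> n \<ge> M \<Longrightarrow> hnorm completion (\<lambda>i. X m i - X n i) < e / 3"
      using Cau[of "e/3"] e by auto
    have "seminorm (w m - w n) < e" if "m \<ge> max M N" "n \<ge> max M N" for m n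
    proof -
      have "seminorm (w m - w n) = hnorm completion (\<lambda>i. hat (w m) i - hat (w n) i)"
      proof -
        have "hat (w m - w n) = (\<lambda>i. hat (w m) i - hat (w n) i)" by (auto simp: hat_def diff_left)
        then show ?thesis by (metis hnorm_hat)
      qed
      also have "\<dots> \<le> hnorm completion (\<lambda>i. hat (w m) i - X m i) + hnorm completion (\<lambda>i. X m i - hat (w n) i)"
        by (intro hnorm_triangle hat_space X)
      also have "\<dots> \<le> hnorm completion (\<lambda>i. hat (w m) i - X m i)
          + (hnorm completion (\<lambda>i. X m i - X n i) + hnorm completion (\<lambda>i. X n i - hat (w n) i))"
        by (intro add_left_mono hnorm_triangle hat_space X)
      also have "\<dots> < e / 3 + (e / 3 + e / 3)"
        using w[of m] w[of n] N[of m] N[of n] M[of m n] that hnorm_commute[OF hat_space X, of "w m" m] by simp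
      finally show ?thesis by simp
    qed
    then show "\<exists>N. \<forall>m\<ge>N. \<forall>n\<ge>N. seminorm (w m - w n) < e" by blast
  qed
  define L where "L i = lim (\<lambda>n. s (w n) (\<phi> i))" for i
  have rL: "represents w L"
    unfolding represents_def L_def
    using cw Cauchy_seq_form_convergent[OF cw Cauchy_seq_const] by (simp add: convergent_LIMSEQ_iff)
  then have L: "L \<in> space" by (rule represents_space)
  have "(\<lambda>n. hnorm completion (\<lambda>i. X n i - L i)) \<longlonglongrightarrow> 0"
  proof (rule LIMSEQ_I)
    fix e :: real assume e: "e > 0"
    obtain N where N: "\<And>n. n \<ge> N \<Longrightarrow> 1 / real (Suc n) < e / 2" using small[of "e/2"] e by auto
    obtain M where M: "\<And>m n. m \<ge> M \<Longrightarrow> n \<ge> M \<Longrightarrow> seminorm (w m - w n) < e / 3"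
      using Cauchy_seqD[OF cw, of "e/3"] e by auto
    have "norm (hnorm completion (\<lambda>i. X n i - L i) - 0) < e" if n: "n \<ge> max M N" for n
    proof -
      have "(\<lambda>m. seminorm (w m - w n)) \<longlonglongrightarrow> hnorm completion (\<lambda>i. L i - hat (w n) i)"
        by (rule hnorm_lim[OF represents_diff[OF rL represents_hat]])
      then have "hnorm completion (\<lambda>i. L i - hat (w n) i) \<le> e / 3"
        by (rule LIMSEQ_le_const2) (use M n in \<open>auto intro!: exI[of _ M] order_less_imp_le\<close>)
      then have "hnorm completion (\<lambda>i. hat (w n) i - L i) \<le> e / 3"
        using hnorm_commute[OF L hat_space, of "w n"] by simp
      then have "hnorm completion (\<lambda>i. X n i - L i) < e"
        using hnorm_triangle[OF X hat_space L, of n "w n"] w[of n] N[of n] n e by simp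
      moreover have "0 \<le> hnorm completion (\<lambda>i. X n i - L i)"
      proof -
        obtain W where "represents W (\<lambda>i. X n i - L i)" using representsE[OF space_diff[OF X L]] by blast
        from LIMSEQ_le_const[OF hnorm_lim[OF this], of 0] show ?thesis by simp
      qed
      ultimately show ?thesis by simp
    qed
    then show "\<exists>no. \<forall>n\<ge>no. norm (hnorm completion (\<lambda>i. X n i - L i) - 0) < e" by blast
  qed
  then show ?thesis using L by blast
qed

theorem completion_hilbert_space: "hilbert_space completion"
proof (rule hilbert_space.intro)
  show "Module.module complex_ring completion"
    by (rule moduleI[OF complex_ring_cring completion_abelian_group])
      (auto simp: complex_ring_def space_scale algebra_simps)
  show "hilbert_space_axioms completion"
  proof
    fix f g h c assume f: "f \<in> carrier completion" and g: "g \<in> carrier completion"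
    obtain X Y where X: "represents X f" and Y: "represents Y g"
      using f g by (metis completion_simps(1) representsE)
    show "cinner completion f g = cnj (cinner completion g f)"
    proof (rule LIMSEQ_unique)
      show "(\<lambda>n. s (X n) (Y n)) \<longlonglongrightarrow> cinner completion f g" using inner_lim[OF X Y] by simp
      show "(\<lambda>n. s (X n) (Y n)) \<longlonglongrightarrow> cnj (cinner completion g f)"
        using tendsto_cnj[OF inner_lim[OF Y X]] by (simp flip: hermitian)
    qed
    show "cinner completion (c \<odot>\<^bsub>completion\<^esub> f) g = c * cinner completion f g"
    proof (rule LIMSEQ_unique)
      show "(\<lambda>n. s (c *s X n) (Y n)) \<longlonglongrightarrow> cinner completion (c \<odot>\<^bsub>completion\<^esub> f) g"
        using inner_lim[OF represents_scale[OF X] Y] by simp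
      show "(\<lambda>n. s (c *s X n) (Y n)) \<longlonglongrightarrow> c * cinner completion f g"
        using tendsto_mult_left[OF inner_lim[OF X Y], of c] by (simp add: scale_left)
    qed
    show "0 \<le> Re (cinner completion f f)"
      using LIMSEQ_le_const[OF tendsto_Re[OF inner_lim[OF X X]], of 0] nonneg by simp
    show "f = \<zero>\<^bsub>completion\<^esub>" if "cinner completion f f = 0"
    proof -
      have "hnorm completion f = 0" using that by (simp add: hnorm_def)
      then have "(\<lambda>n. seminorm (X n)) \<longlonglongrightarrow> 0" using hnorm_lim[OF X] by simp
      then have "(\<lambda>n. s (X n) (\<phi> i)) \<longlonglongrightarrow> 0" for i by (rule form_tendsto_zero) (rule Cauchy_seq_const)
      moreover have "(\<lambda>n. s (X n) (\<phi> i)) \<longlonglongrightarrow> f i" for i using X by (simp add: represents_def)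
      ultimately have "f i = 0" for i using LIMSEQ_unique by blast
      then show ?thesis by (auto simp: fun_eq_iff)
    qed
    assume h: "h \<in> carrier completion"
    obtain W where W: "represents W h" using h by (metis completion_simps(1) representsE)
    show "cinner completion (f \<oplus>\<^bsub>completion\<^esub> g) h = cinner completion f h + cinner completion g h"
    proof (rule LIMSEQ_unique)
      show "(\<lambda>n. s (X n + Y n) (W n)) \<longlonglongrightarrow> cinner completion (f \<oplus>\<^bsub>completion\<^esub> g) h"
        using inner_lim[OF represents_add[OF X Y] W] by simp
      show "(\<lambda>n. s (X n + Y n) (W n)) \<longlonglongrightarrow> cinner completion f h + cinner completion g h"
        using tendsto_add[OF inner_lim[OF X W] inner_lim[OF Y W]] by (simp add: add_left)
    qed
  next
    fix X :: "nat \<Rightarrow> 'i \<Rightarrow> complex"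
    assume X: "\<And>n. X n \<in> carrier completion"
      and C: "\<And>e. e > 0 \<Longrightarrow> \<exists>N. \<forall>m\<ge>N. \<forall>n\<ge>N. hnorm completion (X m \<ominus>\<^bsub>completion\<^esub> X n) < e"
    then show "\<exists>L\<in>carrier completion. (\<lambda>n. hnorm completion (X n \<ominus>\<^bsub>completion\<^esub> L)) \<longlonglongrightarrow> 0"
      using completion_complete[of X] by (simp add: completion_minus)
  qed
qed

lemma space_respects: "f \<in> space \<Longrightarrow> \<phi> i = \<phi> j \<Longrightarrow> f i = f j"
  by (metis LIMSEQ_unique representsE represents_def)

text \<open>
  If an isometry $T$ satisfies $\langle T w, \phi_i\rangle = \epsilon_i \langle w, \phi_{\sigma i}\rangle$, then its extension to the
  completion is this operation on functions, which can be evaluated and compared without limits.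
\<close>
definition weighted_subst :: "('i \<Rightarrow> complex) \<Rightarrow> ('i \<Rightarrow> 'i) \<Rightarrow> ('i \<Rightarrow> complex) \<Rightarrow> 'i \<Rightarrow> complex" where
  "weighted_subst \<epsilon> \<sigma> f i = \<epsilon> i * f (\<sigma> i)"

lemma weighted_subst_represents:
  assumes T: "\<And>u v. s (T u - T v) (T u - T v) = s (u - v) (u - v)"
    and TW: "\<And>w i. s (T w) (\<phi> i) = \<epsilon> i * s w (\<phi> (\<sigma> i))" and X: "represents X f"
  shows "represents (\<lambda>n. T (X n)) (weighted_subst \<epsilon> \<sigma> f)"
proof -
  have "seminorm (T u - T v) = seminorm (u - v)" for u v by (simp add: seminorm_def sq_def T)
  then show ?thesis
    using X by (auto simp: represents_def Cauchy_seq_def TW weighted_subst_def intro: tendsto_mult_left)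
qed

lemma weighted_subst_unitary:
  assumes T: "\<And>u v. s (T u) (T v) = s u v" "\<And>u v. T (u - v) = T u - T v"
    and TW: "\<And>w i. s (T w) (\<phi> i) = \<epsilon> i * s w (\<phi> (\<sigma> i))"
    and T': "\<And>u v. s (T' u) (T' v) = s u v" "\<And>u v. T' (u - v) = T' u - T' v"
    and TW': "\<And>w i. s (T' w) (\<phi> i) = \<epsilon>' i * s w (\<phi> (\<sigma>' i))"
    and eps: "\<And>i. \<epsilon> i * \<epsilon>' (\<sigma> i) = 1" "\<And>i. \<epsilon>' i * \<epsilon> (\<sigma>' i) = 1"
    and sig: "\<And>i. \<phi> (\<sigma> (\<sigma>' i)) = \<phi> i" "\<And>i. \<phi> (\<sigma>' (\<sigma> i)) = \<phi> i"
  shows "unitary completion (weighted_subst \<epsilon> \<sigma>)"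
proof -
  have rT: "represents (\<lambda>n. T (X n)) (weighted_subst \<epsilon> \<sigma> f)" if "represents X f" for X f
    by (rule weighted_subst_represents[OF _ TW that]) (simp only: T flip: T(2))
  have rT': "represents (\<lambda>n. T' (X n)) (weighted_subst \<epsilon>' \<sigma>' f)" if "represents X f" for X f
    by (rule weighted_subst_represents[OF _ TW' that]) (simp only: T' flip: T'(2))
  have U: "weighted_subst \<epsilon> \<sigma> f \<in> space" and U': "weighted_subst \<epsilon>' \<sigma>' f \<in> space" if "f \<in> space" for f
    using that by (meson representsE represents_space rT rT')+
  have I: "inner (weighted_subst \<epsilon> \<sigma> f) (weighted_subst \<epsilon> \<sigma> g) = inner f g" if "f \<in> space" "g \<in> space" for f g
  proof -
    obtain X Y where X: "represents X f" and Y: "represents Y g"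
      using \<open>f \<in> space\<close> \<open>g \<in> space\<close> by (metis representsE)
    from inner_lim[OF rT[OF X] rT[OF Y]] inner_lim[OF X Y] show ?thesis by (simp add: T LIMSEQ_unique)
  qed
  have I': "inner (weighted_subst \<epsilon>' \<sigma>' f) (weighted_subst \<epsilon>' \<sigma>' g) = inner f g" if "f \<in> space" "g \<in> space" for f g
  proof -
    obtain X Y where X: "represents X f" and Y: "represents Y g"
      using \<open>f \<in> space\<close> \<open>g \<in> space\<close> by (metis representsE)
    from inner_lim[OF rT'[OF X] rT'[OF Y]] inner_lim[OF X Y] show ?thesis by (simp add: T' LIMSEQ_unique)
  qed
  have UU': "weighted_subst \<epsilon> \<sigma> (weighted_subst \<epsilon>' \<sigma>' f) = f" if "f \<in> space" for f
  proof
    fix i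
    have "f (\<sigma>' (\<sigma> i)) = f i" by (rule space_respects[OF that sig(2)])
    then show "weighted_subst \<epsilon> \<sigma> (weighted_subst \<epsilon>' \<sigma>' f) i = f i"
      by (simp add: weighted_subst_def mult.assoc[symmetric] eps)
  qed
  have U'U: "weighted_subst \<epsilon>' \<sigma>' (weighted_subst \<epsilon> \<sigma> f) = f" if "f \<in> space" for f
  proof
    fix i
    have "f (\<sigma> (\<sigma>' i)) = f i" by (rule space_respects[OF that sig(1)])
    then show "weighted_subst \<epsilon>' \<sigma>' (weighted_subst \<epsilon> \<sigma> f) i = f i"
      by (simp add: weighted_subst_def mult.assoc[symmetric] eps)
  qed
  have b: "bounded_operator completion completion (weighted_subst \<epsilon> \<sigma>)"
    unfolding bounded_operator_def hnorm_def
    by (intro conjI exI[of _ 1]) (auto simp: U I weighted_subst_def algebra_simps)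
  have b': "bounded_operator completion completion (weighted_subst \<epsilon>' \<sigma>')"
    unfolding bounded_operator_def hnorm_def
    by (intro conjI exI[of _ 1]) (auto simp: U' I' weighted_subst_def algebra_simps)
  have adj: "inner (weighted_subst \<epsilon> \<sigma> f) g = inner f (weighted_subst \<epsilon>' \<sigma>' g)" if "f \<in> space" "g \<in> space" for f g
    using I[OF that(1) U'[OF that(2)]] UU'[OF that(2)] by simp
  show ?thesis
    unfolding unitary_def is_adjoint_def
    using b b' adj UU' U'U by (intro conjI exI[of _ "weighted_subst \<epsilon>' \<sigma>'"]) auto
qed

end

section \<open>Riesz representation and operator-valued kernels\<close>

text \<open>
  The value at $t = -b/(a+1)$ is negative unless $b = 0$; the denominator $a + 1$ covers $a = 0$.
\<close>
lemma quadratic_nonneg_imp_zero: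
  fixes a b :: real
  assumes "0 \<le> a" and "\<And>t. 0 \<le> a * t\<^sup>2 + 2 * b * t" shows "b = 0"
proof (rule ccontr)
  assume b: "b \<noteq> 0"
  define r where "r = b\<^sup>2 / (a + 1)"
  have r: "r > 0" using b assms(1) by (simp add: r_def add_nonneg_pos)
  have "a * (- b / (a + 1))\<^sup>2 + 2 * b * (- b / (a + 1)) = (a / (a + 1)) * r - 2 * r"
    by (simp add: r_def power2_eq_square)
  also have "\<dots> \<le> 1 * r - 2 * r"
    using r assms(1) by (intro diff_right_mono mult_right_mono) auto
  also have "\<dots> < 0" using r by simp
  finally show False using assms(2)[of "- b / (a + 1)"] by simp
qed

text \<open>
  The representing vector minimizes $\|v\|^2 - 2 \mathrm{Re}\, l(v)$. Minimizing sequences are Cauchy by the parallelogram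
  law.
\<close>
theorem (in psd_form) Riesz_representation:
  assumes complete: "\<And>X. Cauchy_seq X \<Longrightarrow> \<exists>L. (\<lambda>n. seminorm (X n - L)) \<longlonglongrightarrow> 0"
    and add: "\<And>x y. l (x + y) = l x + l y" and scl: "\<And>c x. l (c *s x) = c * l x"
    and bound: "\<And>x. cmod (l x) \<le> C * seminorm x"
  shows "\<exists>z. \<forall>x. l x = f x z"
proof -
  define \<Phi> where "\<Phi> v = sq v - 2 * Re (l v)" for v
  have l_minus: "l (- x) = - l x" for x using scl[of "-1" x] by simp
  have l_diff: "l (x - y) = l x - l y" for x y using add[of x "- y"] by (simp add: l_minus)
  have low: "- C\<^sup>2 \<le> \<Phi> v" for v
  proof -
    have "Re (l v) \<le> C * seminorm v" using bound[of v] complex_Re_le_cmod[of "l v"] by linarith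
    moreover have "0 \<le> (seminorm v - C)\<^sup>2" by simp
    ultimately show ?thesis unfolding \<Phi>_def power2_diff seminorm_power2 by (simp add: mult.commute)
  qed
  define m where "m = (INF v. \<Phi> v)"
  have bdd: "bdd_below (range \<Phi>)" using low by (intro bdd_belowI2) auto
  have m_le: "m \<le> \<Phi> v" for v unfolding m_def by (intro cINF_lower bdd) simp
  have "\<exists>v. \<Phi> v < m + 1 / Suc n" for n
  proof -
    have "(INF v. \<Phi> v) < m + 1 / Suc n" by (simp add: m_def)
    then show ?thesis using cINF_less_iff[OF _ bdd, of "m + 1 / Suc n"] by auto
  qed
  then obtain X where X: "\<And>n. \<Phi> (X n) < m + 1 / Suc n" by metis
  have close: "sq (u - v) \<le> 2 * (\<Phi> u - m) + 2 * (\<Phi> v - m)" for u v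
  proof -
    have "2 * sq u + 2 * sq v = sq (u + v) + sq (u - v)" using parallelogram by simp
    moreover have "4 * \<Phi> ((1/2) *s (u + v)) = sq (u + v) - 4 * Re (l u) - 4 * Re (l v)"
    proof -
      have "sq ((1/2) *s (u + v)) = sq (u + v) / 4" by (simp add: sq_scale norm_divide power2_eq_square)
      moreover have "Re (l ((1/2) *s (u + v))) = (Re (l u) + Re (l v)) / 2" by (simp add: scl add)
      ultimately show ?thesis by (simp add: \<Phi>_def)
    qed
    ultimately show ?thesis using m_le[of "(1/2) *s (u + v)"] by (simp add: \<Phi>_def)
  qed
  have lim0: "(\<lambda>n. 1 / real (Suc n)) \<longlonglongrightarrow> 0" by (rule lim_1_over_n[THEN LIMSEQ_Suc])
  have cX: "Cauchy_seq X"
    unfolding Cauchy_seq_def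
  proof (intro allI impI)
    fix e :: real assume e: "e > 0"
    then have "e\<^sup>2 / 4 > 0" by simp
    from LIMSEQ_D[OF lim0 this] obtain N where N: "\<And>n. n \<ge> N \<Longrightarrow> 1 / real (Suc n) < e\<^sup>2 / 4" by auto
    have "seminorm (X p - X q) < e" if "p \<ge> N" "q \<ge> N" for p q
    proof -
      have "(seminorm (X p - X q))\<^sup>2 < e\<^sup>2"
      proof -
        have "\<Phi> (X n) < m + e\<^sup>2 / 4" if "n \<ge> N" for n
          by (rule less_trans[OF X add_strict_left_mono[OF N[OF that]]])
        from this[OF that(1)] this[OF that(2)] show ?thesis
          using close[of "X p" "X q"] unfolding seminorm_power2 by (simp add: field_simps)
      qed
      then show ?thesis using e by (simp add: power2_less_imp_less)
    qed
    then show "\<exists>N. \<forall>m\<ge>N. \<forall>n\<ge>N. seminorm (X m - X n) < e" by blast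
  qed
  obtain z where z: "(\<lambda>n. seminorm (X n - z)) \<longlonglongrightarrow> 0" using complete[OF cX] by blast
  have "(\<lambda>n. \<Phi> (X n)) \<longlonglongrightarrow> \<Phi> z"
  proof -
    have e: "\<Phi> (X n) = \<Phi> z + (Re (f (X n - z) z) + Re (f (X n) (X n - z))) - 2 * Re (l (X n - z))" for n
    proof -
      have "Re (f (X n - z) z) + Re (f (X n) (X n - z)) = sq (X n) - sq z"
        using Re_commute[of z "X n"] by (simp add: diff_left diff_right sq_def)
      then show ?thesis by (simp add: \<Phi>_def l_diff)
    qed
    have "(\<lambda>n. l (X n - z)) \<longlonglongrightarrow> 0"
      by (rule tendsto_0_le[OF z, of _ C]) (use bound in \<open>simp add: mult.commute\<close>)
    then have "(\<lambda>n. \<Phi> z + (Re (f (X n - z) z) + Re (f (X n) (X n - z))) - 2 * Re (l (X n - z)))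
        \<longlonglongrightarrow> \<Phi> z + (Re 0 + Re 0) - 2 * Re 0"
      by (intro tendsto_intros form_tendsto_zero z cX Cauchy_seq_const)
    then show ?thesis unfolding e by simp
  qed
  moreover have "(\<lambda>n. \<Phi> (X n)) \<longlonglongrightarrow> m"
  proof (rule tendsto_sandwich[where f = "\<lambda>_. m" and h = "\<lambda>n. m + 1 / real (Suc n)"])
    show "(\<lambda>n. m + 1 / real (Suc n)) \<longlonglongrightarrow> m" using tendsto_add[OF tendsto_const lim0, of m] by simp
    show "\<forall>\<^sub>F n in sequentially. m \<le> \<Phi> (X n)" using m_le by simp
    show "\<forall>\<^sub>F n in sequentially. \<Phi> (X n) \<le> m + 1 / real (Suc n)"
      using X by (intro always_eventually allI order_less_imp_le)
  qed simp
  ultimately have zm: "\<Phi> z = m" by (rule LIMSEQ_unique)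
  have re: "Re (l v) = Re (f v z)" for v
  proof -
    have "0 \<le> sq v * t\<^sup>2 + 2 * (Re (f v z) - Re (l v)) * t" for t
    proof -
      have "\<Phi> (z + of_real t *s v) = \<Phi> z + sq v * t\<^sup>2 + 2 * (Re (f v z) - Re (l v)) * t"
        using Re_commute[of z v] by (simp add: \<Phi>_def sq_add sq_scale scale_right add scl algebra_simps)
      then show ?thesis using m_le[of "z + of_real t *s v"] zm by simp
    qed
    from quadratic_nonneg_imp_zero[OF sq_nonneg this] show ?thesis by simp
  qed
  have "l v = f v z" for v
    using re[of v] re[of "\<i> *s v"] by (simp add: scl scale_left complex_eq_iff)
  then show ?thesis by blast
qed

text \<open>
  A positive operator-valued kernel, given by its sesquilinear forms. Positivity is demanded on a cofinal system of finite sets of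
  positions only; for Toeplitz kernels these can be taken to be intervals.
\<close>
locale operator_kernel = vector_space scale
  for scale :: "complex \<Rightarrow> 'v::ab_group_add \<Rightarrow> 'v" (infixr "*s" 75) +
  fixes \<kappa> :: "'p \<Rightarrow> 'p \<Rightarrow> 'v \<Rightarrow> 'v \<Rightarrow> complex"
  assumes kernel_add: "\<kappa> p q (x + y) z = \<kappa> p q x z + \<kappa> p q y z"
    and kernel_scale: "\<kappa> p q (c *s x) y = c * \<kappa> p q x y"
    and kernel_hermitian: "\<kappa> p q x y = cnj (\<kappa> q p y x)"
    and kernel_nonneg: "finite P0 \<Longrightarrow>
      \<exists>P. P0 \<subseteq> P \<and> finite P \<and> (\<forall>g. 0 \<le> Re (\<Sum>p\<in>P. \<Sum>q\<in>P. \<kappa> p q (g p) (g q)))"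
begin

lemma kernel_zero_left [simp]: "\<kappa> p q 0 y = 0" using kernel_scale[of p q 0 0 y] by simp
lemma kernel_zero_right [simp]: "\<kappa> p q y 0 = 0" by (subst kernel_hermitian) simp

definition pscale :: "complex \<Rightarrow> ('p \<Rightarrow>\<^sub>0 'v) \<Rightarrow> ('p \<Rightarrow>\<^sub>0 'v)" where
  "pscale c w = Poly_Mapping.map ((*s) c) w"

definition form :: "('p \<Rightarrow>\<^sub>0 'v) \<Rightarrow> ('p \<Rightarrow>\<^sub>0 'v) \<Rightarrow> complex" where
  "form u w = (\<Sum>p\<in>Poly_Mapping.keys u. \<Sum>q\<in>Poly_Mapping.keys w. \<kappa> p q (Poly_Mapping.lookup u p) (Poly_Mapping.lookup w q))"

lemma lookup_pscale [simp]: "Poly_Mapping.lookup (pscale c w) p = c *s Poly_Mapping.lookup w p"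
  by (auto simp: pscale_def Poly_Mapping.map.rep_eq when_def)

lemma form_superset:
  assumes "finite P" "finite R" "Poly_Mapping.keys u \<subseteq> P" "Poly_Mapping.keys w \<subseteq> R"
  shows "form u w = (\<Sum>p\<in>P. \<Sum>q\<in>R. \<kappa> p q (Poly_Mapping.lookup u p) (Poly_Mapping.lookup w q))"
proof -
  have "form u w = (\<Sum>p\<in>Poly_Mapping.keys u. \<Sum>q\<in>R. \<kappa> p q (Poly_Mapping.lookup u p) (Poly_Mapping.lookup w q))"
    unfolding form_def using assms
    by (intro sum.cong refl sum.mono_neutral_left) (auto simp: in_keys_iff)
  also have "\<dots> = (\<Sum>p\<in>P. \<Sum>q\<in>R. \<kappa> p q (Poly_Mapping.lookup u p) (Poly_Mapping.lookup w q))"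
    using assms by (intro sum.mono_neutral_left) (auto simp: in_keys_iff)
  finally show ?thesis .
qed

lemma psd_form_form: "psd_form pscale form"
proof unfold_locales
  fix a b :: complex and u v w :: "'p \<Rightarrow>\<^sub>0 'v"
  show "pscale a (v + w) = pscale a v + pscale a w" "pscale (a + b) v = pscale a v + pscale b v"
    "pscale a (pscale b v) = pscale (a * b) v" "pscale 1 v = v"
    by (auto intro!: poly_mapping_eqI simp: lookup_add scale_right_distrib scale_left_distrib)
  let ?P = "Poly_Mapping.keys u \<union> Poly_Mapping.keys v \<union> Poly_Mapping.keys w"
  have k: "Poly_Mapping.keys (u + v) \<subseteq> ?P" using keys_add[of u v] by blast
  show "form (u + v) w = form u w + form v w"
    by (simp add: form_superset[of ?P ?P] k le_supI1 kernel_add lookup_add sum.distrib)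
  have "Poly_Mapping.keys (pscale a u) \<subseteq> Poly_Mapping.keys u" by (auto simp: in_keys_iff)
  then have k': "Poly_Mapping.keys (pscale a u) \<subseteq> ?P" by blast
  show "form (pscale a u) w = a * form u w"
    by (simp add: form_superset[of ?P ?P] k' le_supI1 kernel_scale sum_distrib_left)
  show "form u w = cnj (form w u)"
    unfolding form_def by (simp flip: kernel_hermitian) (rule sum.swap)
  obtain P where P: "Poly_Mapping.keys u \<subseteq> P" "finite P" and nn: "\<And>g. 0 \<le> Re (\<Sum>p\<in>P. \<Sum>q\<in>P. \<kappa> p q (g p) (g q))"
    using kernel_nonneg[OF finite_keys[of u]] by blast
  show "0 \<le> Re (form u u)"
    using nn[of "Poly_Mapping.lookup u"] by (simp only: form_superset[OF P(2,2,1,1)])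
qed

lemma form_single_right: "form u (Poly_Mapping.single q y) = (\<Sum>p\<in>Poly_Mapping.keys u. \<kappa> p q (Poly_Mapping.lookup u p) y)"
proof -
  have "form u (Poly_Mapping.single q y) = (\<Sum>p\<in>Poly_Mapping.keys u. \<Sum>r\<in>{q}. \<kappa> p r (Poly_Mapping.lookup u p) (Poly_Mapping.lookup (Poly_Mapping.single q y) r))"
    by (rule form_superset) auto
  then show ?thesis by simp
qed

lemma form_single: "form (Poly_Mapping.single p x) (Poly_Mapping.single q y) = \<kappa> p q x y"
proof -
  have "form (Poly_Mapping.single p x) (Poly_Mapping.single q y)
      = (\<Sum>p'\<in>{p}. \<Sum>r\<in>{q}. \<kappa> p' r (Poly_Mapping.lookup (Poly_Mapping.single p x) p') (Poly_Mapping.lookup (Poly_Mapping.single q y) r))"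
    by (rule form_superset) auto
  then show ?thesis by simp
qed

lemma form_expand_right: "form u w = (\<Sum>q\<in>Poly_Mapping.keys w. form u (Poly_Mapping.single q (Poly_Mapping.lookup w q)))"
  unfolding form_single_right unfolding form_def by (rule sum.swap)

text \<open>
  The vector with the values $\epsilon_p w_{\tau p}$; for a bijection $\tau$ it is again finitely supported.
\<close>
definition reindex :: "('p \<Rightarrow> complex) \<Rightarrow> ('p \<Rightarrow> 'p) \<Rightarrow> ('p \<Rightarrow>\<^sub>0 'v) \<Rightarrow> ('p \<Rightarrow>\<^sub>0 'v)" where
  "reindex \<epsilon> \<tau> w = Abs_poly_mapping (\<lambda>p. \<epsilon> p *s Poly_Mapping.lookup w (\<tau> p))"

lemma lookup_reindex:
  assumes "bij \<tau>" shows "Poly_Mapping.lookup (reindex \<epsilon> \<tau> w) p = \<epsilon> p *s Poly_Mapping.lookup w (\<tau> p)"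
proof -
  have "finite (\<tau> -` Poly_Mapping.keys w)" using assms by (intro finite_vimageI) (auto simp: bij_def)
  then have "finite {p. \<epsilon> p *s Poly_Mapping.lookup w (\<tau> p) \<noteq> 0}"
    by (rule finite_subset[rotated]) (auto simp: in_keys_iff)
  then show ?thesis by (simp add: reindex_def)
qed

lemma reindex_diff: "bij \<tau> \<Longrightarrow> reindex \<epsilon> \<tau> (u - w) = reindex \<epsilon> \<tau> u - reindex \<epsilon> \<tau> w"
  by (auto intro!: poly_mapping_eqI simp: lookup_reindex lookup_minus scale_right_diff_distrib)

lemma keys_reindex: "bij \<tau> \<Longrightarrow> Poly_Mapping.keys (reindex \<epsilon> \<tau> w) \<subseteq> \<tau> -` Poly_Mapping.keys w"
  by (auto simp: in_keys_iff lookup_reindex)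

lemma sum_reindex:
  assumes "bij \<tau>" shows "(\<Sum>p\<in>\<tau> -` K. g (\<tau> p)) = (\<Sum>p\<in>K. g p)"
  using assms by (intro sum.reindex_bij_betw) (metis bij_betw_def bij_def inj_on_subset subset_UNIV surj_image_vimage_eq)

lemma form_reindex:
  assumes t: "bij \<tau>" and inv: "\<And>p q x y. \<epsilon> p * cnj (\<epsilon> q) * \<kappa> p q x y = \<kappa> (\<tau> p) (\<tau> q) x y"
  shows "form (reindex \<epsilon> \<tau> u) (reindex \<epsilon> \<tau> w) = form u w"
proof -
  have fin: "finite (\<tau> -` Poly_Mapping.keys u)" for u :: "'p \<Rightarrow>\<^sub>0 'v" using t by (intro finite_vimageI) (auto simp: bij_def)
  have sr: "\<kappa> p q x (c *s y) = cnj c * \<kappa> p q x y" for p q x y c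
    by (subst (1 2) kernel_hermitian) (simp add: kernel_scale)
  have "form (reindex \<epsilon> \<tau> u) (reindex \<epsilon> \<tau> w)
      = (\<Sum>p\<in>\<tau> -` Poly_Mapping.keys u. \<Sum>q\<in>\<tau> -` Poly_Mapping.keys w. \<kappa> p q (\<epsilon> p *s Poly_Mapping.lookup u (\<tau> p)) (\<epsilon> q *s Poly_Mapping.lookup w (\<tau> q)))"
    by (simp add: form_superset[OF fin fin keys_reindex[OF t] keys_reindex[OF t]] lookup_reindex[OF t])
  also have "\<dots> = (\<Sum>p\<in>\<tau> -` Poly_Mapping.keys u. \<Sum>q\<in>\<tau> -` Poly_Mapping.keys w. \<kappa> (\<tau> p) (\<tau> q) (Poly_Mapping.lookup u (\<tau> p)) (Poly_Mapping.lookup w (\<tau> q)))"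
    by (simp add: kernel_scale sr mult_ac flip: inv)
  also have "\<dots> = (\<Sum>p\<in>\<tau> -` Poly_Mapping.keys u. \<Sum>q\<in>Poly_Mapping.keys w. \<kappa> (\<tau> p) q (Poly_Mapping.lookup u (\<tau> p)) (Poly_Mapping.lookup w q))"
    by (intro sum.cong refl sum_reindex[OF t, of "\<lambda>q. \<kappa> (\<tau> p) q (Poly_Mapping.lookup u (\<tau> p)) (Poly_Mapping.lookup w q)" for p])
  also have "\<dots> = form u w"
    unfolding form_def by (rule sum_reindex[OF t, of "\<lambda>p. \<Sum>q\<in>Poly_Mapping.keys w. \<kappa> p q (Poly_Mapping.lookup u p) (Poly_Mapping.lookup w q)"])
  finally show ?thesis .
qed

lemma form_reindex_single:
  assumes t: "bij \<tau>" and inv: "\<And>p q x y. \<epsilon> p * cnj (\<epsilon> q) * \<kappa> p q x y = \<kappa> (\<tau> p) (\<tau> q) x y"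
    and unit: "\<And>q. cnj (\<epsilon> q) * \<epsilon> q = 1"
  shows "form (reindex \<epsilon> \<tau> u) (Poly_Mapping.single q y) = \<epsilon> q * form u (Poly_Mapping.single (\<tau> q) y)"
proof -
  have fin: "finite (\<tau> -` Poly_Mapping.keys u)" using t by (intro finite_vimageI) (auto simp: bij_def)
  have "form (reindex \<epsilon> \<tau> u) (Poly_Mapping.single q y)
      = (\<Sum>p\<in>\<tau> -` Poly_Mapping.keys u. \<Sum>r\<in>{q}. \<kappa> p r (Poly_Mapping.lookup (reindex \<epsilon> \<tau> u) p) (Poly_Mapping.lookup (Poly_Mapping.single q y) r))"
    by (rule form_superset[OF fin _ keys_reindex[OF t]]) auto
  also have "\<dots> = (\<Sum>p\<in>\<tau> -` Poly_Mapping.keys u. \<epsilon> p * \<kappa> p q (Poly_Mapping.lookup u (\<tau> p)) y)"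
    by (simp add: lookup_reindex[OF t] kernel_scale)
  also have "\<dots> = (\<Sum>p\<in>\<tau> -` Poly_Mapping.keys u. \<epsilon> q * \<kappa> (\<tau> p) (\<tau> q) (Poly_Mapping.lookup u (\<tau> p)) y)"
  proof (intro sum.cong refl)
    fix p
    have "\<epsilon> p * \<kappa> p q (Poly_Mapping.lookup u (\<tau> p)) y = (cnj (\<epsilon> q) * \<epsilon> q) * (\<epsilon> p * \<kappa> p q (Poly_Mapping.lookup u (\<tau> p)) y)"
      by (simp only: unit mult_1)
    also have "\<dots> = \<epsilon> q * (\<epsilon> p * cnj (\<epsilon> q) * \<kappa> p q (Poly_Mapping.lookup u (\<tau> p)) y)" by (simp only: mult_ac)
    finally show "\<epsilon> p * \<kappa> p q (Poly_Mapping.lookup u (\<tau> p)) y = \<epsilon> q * \<kappa> (\<tau> p) (\<tau> q) (Poly_Mapping.lookup u (\<tau> p)) y"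
      by (simp only: inv)
  qed
  also have "\<dots> = \<epsilon> q * (\<Sum>p\<in>Poly_Mapping.keys u. \<kappa> p (\<tau> q) (Poly_Mapping.lookup u p) y)"
    unfolding sum_distrib_left[symmetric]
    by (simp only: sum_reindex[OF t, of "\<lambda>p. \<kappa> p (\<tau> q) (Poly_Mapping.lookup u p) y"])
  finally show ?thesis by (simp add: form_single_right)
qed

end

text \<open>
  The kernel with entries $C^{m-n}$ below the diagonal, their adjoints above and $E$ on the
  diagonal. The adjoints are expressed by moving the operator to the other argument.
\<close>
definition toeplitz ::
  "('v \<Rightarrow> 'v \<Rightarrow> complex) \<Rightarrow> ('v \<Rightarrow> 'v \<Rightarrow> complex) \<Rightarrow> ('v \<Rightarrow> 'v) \<Rightarrow> int \<Rightarrow> int \<Rightarrow> 'v \<Rightarrow> 'v \<Rightarrow> complex" where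
  "toeplitz ip E C m n x y =
    (if m = n then E x y else if n < m then ip ((C ^^ nat (m - n)) x) y else ip x ((C ^^ nat (n - m)) y))"

context psd_form
begin

text \<open>
  The contraction behind this family is the truncated backward shift: $a_n = C (h_{n+1} + a_{n+1})$.
\<close>
lemma tails_shiftable:
  assumes C: "\<And>x y. C (x + y) = C x + C y" "C 0 = 0"
  shows "shiftable scale C N h (\<lambda>n. \<Sum>m\<in>{n<..<N}. (C ^^ (m - n)) (h m))"
  unfolding shiftable_def
proof (intro allI impI)
  fix \<beta> assume b: "\<forall>i<N. C (\<beta> i) = 0"
  let ?a = "\<lambda>n. \<Sum>m\<in>{n<..<N}. (C ^^ (m - n)) (h m)"
  let ?z = "\<lambda>n. h n + ?a n + \<beta> n"
  let ?x = "\<lambda>n. if Suc n < N then ?z (Suc n) else 0"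
  have Csum: "C (sum g I) = (\<Sum>i\<in>I. C (g i))" for g :: "nat \<Rightarrow> 'v" and I
    by (induction I rule: infinite_finite_induct) (auto simp: C)
  have "C (?x n) = ?a n" if n: "n < N" for n
  proof (cases "Suc n < N")
    case True
    have I: "{n<..<N} = insert (Suc n) {Suc n<..<N}" using True by auto
    have "C (?a (Suc n)) = (\<Sum>m\<in>{Suc n<..<N}. (C ^^ (m - n)) (h m))"
      unfolding Csum
    proof (intro sum.cong refl)
      fix m assume "m \<in> {Suc n<..<N}"
      then have "m - n = Suc (m - Suc n)" by auto
      then show "C ((C ^^ (m - Suc n)) (h m)) = (C ^^ (m - n)) (h m)" by simp
    qed
    then show ?thesis using True b by (simp add: C I)
  next
    case False
    then have "{n<..<N} = {}" by auto
    then show ?thesis using False by (simp add: C)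
  qed
  moreover have "(\<Sum>n<N. Re (Z (?x n) (?x n))) \<le> (\<Sum>n<N. Re (Z (?z n) (?z n)))" if "psd_form scale Z" for Z
  proof (cases N)
    case (Suc K)
    interpret Z: psd_form scale Z by (rule that)
    have "(\<Sum>n<N. Z.sq (?x n)) = (\<Sum>n<K. Z.sq (?z (Suc n)))" by (simp add: Suc)
    also have "\<dots> \<le> (\<Sum>n<N. Z.sq (?z n))" unfolding Suc sum.lessThan_Suc_shift by simp
    finally show ?thesis by (simp add: Z.sq_def)
  qed simp
  ultimately show "\<exists>x. (\<forall>i<N. C (x i) = ?a i) \<and> (\<forall>Z. psd_form scale Z \<longrightarrow>
      (\<Sum>i<N. Re (Z (x i) (x i))) \<le> (\<Sum>i<N. Re (Z (?z i) (?z i))))"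
    by (intro exI[of _ ?x] conjI allI impI)
qed

text \<open>
  The entries off the diagonal come in adjoint pairs, so the real part of their sum is twice that of
  $\sum_n \langle h_n, a_n\rangle$ with $a_n = \sum_{m > n} C^{m-n} h_m$.
\<close>
lemma toeplitz_nonneg:
  assumes C: "\<And>x y. C (x + y) = C x + C y" "C 0 = 0"
    and E: "\<And>N h a. shiftable scale C N h a \<Longrightarrow>
      0 \<le> (\<Sum>i<N. Re (E (h i) (h i))) + 2 * (\<Sum>i<N. Re (f (h i) (a i)))"
  shows "0 \<le> Re (\<Sum>m<N. \<Sum>n<N. toeplitz f E C (c + int m) (c + int n) (h m) (h n))"
proof -
  let ?a = "\<lambda>n. \<Sum>m\<in>{n<..<N}. (C ^^ (m - n)) (h m)"
  have "(\<Sum>m<N. \<Sum>n<N. toeplitz f E C (c + int m) (c + int n) (h m) (h n))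
     = (\<Sum>m<N. \<Sum>n<N. (if m = n then E (h m) (h n) else 0) + (if n < m then f ((C ^^ (m - n)) (h m)) (h n) else 0)
         + (if m < n then f (h m) ((C ^^ (n - m)) (h n)) else 0))"
    by (intro sum.cong refl) (auto simp: toeplitz_def nat_diff_distrib simp flip: of_nat_diff)
  also have "\<dots> = (\<Sum>m<N. E (h m) (h m)) + (\<Sum>m<N. \<Sum>n<N. if n < m then f ((C ^^ (m - n)) (h m)) (h n) else 0)
     + (\<Sum>m<N. \<Sum>n<N. if m < n then f (h m) ((C ^^ (n - m)) (h n)) else 0)"
    by (simp add: sum.distrib)
  also have "(\<Sum>m<N. \<Sum>n<N. if m < n then f (h m) ((C ^^ (n - m)) (h n)) else 0) = (\<Sum>m<N. f (h m) (?a m))"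
    unfolding sum_right
    by (rule sum.cong[OF refl], rule sum.mono_neutral_cong_right) auto
  also have "(\<Sum>m<N. \<Sum>n<N. if n < m then f ((C ^^ (m - n)) (h m)) (h n) else 0) = (\<Sum>n<N. f (?a n) (h n))"
    unfolding sum_left
    by (subst sum.swap, rule sum.cong[OF refl], rule sum.mono_neutral_cong_right) auto
  finally have "Re (\<Sum>m<N. \<Sum>n<N. toeplitz f E C (c + int m) (c + int n) (h m) (h n))
      = (\<Sum>m<N. Re (E (h m) (h m))) + (\<Sum>n<N. Re (f (?a n) (h n))) + (\<Sum>m<N. Re (f (h m) (?a m)))"
    by simp
  also have "(\<Sum>n<N. Re (f (?a n) (h n))) = (\<Sum>m<N. Re (f (h m) (?a m)))"
    by (intro sum.cong refl Re_commute)
  finally show ?thesis using E[OF tails_shiftable[OF C, of N h]] by simp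
qed

end

section \<open>Hilbert spaces on a carrier\<close>

lemma complex_ring_simps [simp]: "carrier complex_ring = UNIV" "\<one>\<^bsub>complex_ring\<^esub> = 1"
  "\<zero>\<^bsub>complex_ring\<^esub> = 0" "x \<oplus>\<^bsub>complex_ring\<^esub> y = x + y" "x \<otimes>\<^bsub>complex_ring\<^esub> y = x * y"
  by (simp_all add: complex_ring_def)

definition fscale :: "complex \<Rightarrow> ('a \<Rightarrow> complex) \<Rightarrow> 'a \<Rightarrow> complex" where
  "fscale c g = (\<lambda>y. c * g y)"

lemma fscale_apply [simp]: "fscale c g y = c * g y"
  by (simp add: fscale_def)

lemma vector_space_fscale: "vector_space fscale"
  by unfold_locales (auto simp: fun_eq_iff algebra_simps)

context hilbert_space
begin

lemma smult_one' [simp]: "x \<in> carrier H \<Longrightarrow> 1 \<odot> x = x"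
  using smult_one by simp

lemma cinner_add_right:
  "\<lbrakk>x \<in> carrier H; y \<in> carrier H; z \<in> carrier H\<rbrakk> \<Longrightarrow> cinner H x (y \<oplus> z) = cinner H x y + cinner H x z"
  by (subst (1 2 3) cinner_commute) (simp_all add: cinner_add_left)

lemma cinner_smult_right:
  "\<lbrakk>x \<in> carrier H; y \<in> carrier H\<rbrakk> \<Longrightarrow> cinner H x (c \<odot> y) = cnj c * cinner H x y"
  by (subst (1 2) cinner_commute) (simp_all add: cinner_smult_left)

lemma smult_minus_one: "x \<in> carrier H \<Longrightarrow> (-1) \<odot> x = \<ominus> x"
proof -
  assume x: "x \<in> carrier H"
  have "(-1) \<odot> x \<oplus> x = (-1) \<odot> x \<oplus> 1 \<odot> x" using x by simp
  also have "\<dots> = \<zero>" using smult_l_distr[of "-1" 1 x] smult_l_null[of x] x by simp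
  finally show ?thesis using minus_equality[of "(-1) \<odot> x" x] x by simp
qed

lemma minus_eq_smult: "x \<in> carrier H \<Longrightarrow> y \<in> carrier H \<Longrightarrow> x \<ominus> y = x \<oplus> (-1) \<odot> y"
  by (simp add: minus_eq smult_minus_one)

text \<open>
  Elements of $H$ are embedded linearly into a type of functions, where addition and scaling are total.
  The value $0$ outside the carrier keeps the embedding linear.
\<close>
definition functional :: "'a \<Rightarrow> 'a \<Rightarrow> complex" where
  "functional x = (\<lambda>y. if y \<in> carrier H then cinner H x y else 0)"

lemma functional_add: "x \<in> carrier H \<Longrightarrow> y \<in> carrier H \<Longrightarrow> functional (x \<oplus> y) = functional x + functional y"
  by (auto simp: functional_def fun_eq_iff cinner_add_left)

lemma functional_smult: "x \<in> carrier H \<Longrightarrow> functional (c \<odot> x) = fscale c (functional x)"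
  by (auto simp: functional_def fun_eq_iff cinner_smult_left)

lemma functional_zero: "functional \<zero> = 0"
  using functional_smult[of \<zero> 0] smult_l_null[of \<zero>] by (simp add: fun_eq_iff)

lemma functional_inject:
  assumes x: "x \<in> carrier H" and y: "y \<in> carrier H" and eq: "functional x = functional y"
  shows "x = y"
proof -
  let ?d = "x \<oplus> (-1) \<odot> y"
  have "functional ?d = 0"
    using x y eq by (simp add: functional_add functional_smult fun_eq_iff)
  then have "functional ?d ?d = 0" by simp
  then have "cinner H ?d ?d = 0" using x y by (simp add: functional_def)
  then have "?d = \<zero>" using x y by (intro cinner_definite) auto
  then show ?thesis using x y by (simp add: smult_minus_one) (metis r_neg2 minus_minus a_inv_closed minus_equality)
qed

lemma eq_by_cinner:
  assumes "x \<in> carrier H" "y \<in> carrier H" "\<And>z. z \<in> carrier H \<Longrightarrow> cinner H z x = cinner H z y"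
  shows "x = y"
proof (rule functional_inject[OF assms(1,2)])
  have "cinner H x z = cinner H y z" if "z \<in> carrier H" for z
    using assms that cinner_commute[of x z] cinner_commute[of y z] by simp
  then show "functional x = functional y" by (auto simp: functional_def fun_eq_iff)
qed

text \<open>
  A linear projection onto the image of the embedding, which exists by extending a basis, followed by the inverse of the
  embedding. It transports the inner product and the operators of $H$ to the whole function type.
\<close>
theorem linear_section:
  obtains Q where "\<And>g. Q g \<in> carrier H" "\<And>g h. Q (g + h) = Q g \<oplus> Q h"
    "\<And>c g. Q (fscale c g) = c \<odot> Q g" "\<And>x. x \<in> carrier H \<Longrightarrow> Q (functional x) = x"
proof -
  interpret F: vector_space "fscale :: complex \<Rightarrow> ('a \<Rightarrow> complex) \<Rightarrow> _" by (rule vector_space_fscale)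
  interpret FF: vector_space_pair "fscale :: complex \<Rightarrow> ('a \<Rightarrow> complex) \<Rightarrow> _" "fscale :: complex \<Rightarrow> ('a \<Rightarrow> complex) \<Rightarrow> _" ..
  let ?V = "functional ` carrier H"
  have sub: "F.subspace ?V"
  proof (rule F.subspaceI)
    show "0 \<in> ?V" using functional_zero zero_closed by (metis imageI)
    show "g + h \<in> ?V" if "g \<in> ?V" "h \<in> ?V" for g h
      using that by (auto simp: functional_add[symmetric])
    show "fscale c g \<in> ?V" if "g \<in> ?V" for c g
      using that by (auto simp: functional_smult[symmetric])
  qed
  have "Vector_Spaces.linear fscale fscale (\<lambda>g :: 'a \<Rightarrow> complex. g)" by (rule F.linear_ident)
  from FF.linear_exists_left_inverse_on[OF this sub]
  obtain P where P: "range P \<subseteq> ?V" "Vector_Spaces.linear fscale fscale P" "\<And>v. v \<in> ?V \<Longrightarrow> P v = v"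
    by (auto simp: inj_on_def)
  interpret P: Vector_Spaces.linear fscale fscale P by (rule P(2))
  define Q where "Q g = inv_into (carrier H) functional (P g)" for g
  have QP: "functional (Q g) = P g" and QH: "Q g \<in> carrier H" for g
    using P(1) unfolding Q_def by (auto intro!: f_inv_into_f inv_into_into)
  show thesis
  proof (rule that)
    show "Q g \<in> carrier H" for g by (rule QH)
    show "Q (g + h) = Q g \<oplus> Q h" for g h
      by (rule functional_inject) (simp_all add: QH functional_add QP P.add)
    show "Q (fscale c g) = c \<odot> Q g" for c g
      by (rule functional_inject) (simp_all add: QH functional_smult QP P.scale)
    show "Q (functional x) = x" if "x \<in> carrier H" for x
      by (rule functional_inject) (simp_all add: QH QP P(3) that)
  qed
qed

end

locale linearized_hilbert_space = hilbert_space H for H :: "'a hilbert" (structure) +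
  fixes Q :: "('a \<Rightarrow> complex) \<Rightarrow> 'a"
  assumes Q_closed [simp]: "Q g \<in> carrier H" and Q_add: "Q (g + h) = Q g \<oplus> Q h"
    and Q_scale: "Q (fscale c g) = c \<odot> Q g" and Q_functional: "x \<in> carrier H \<Longrightarrow> Q (functional x) = x"
begin

definition ip :: "('a \<Rightarrow> complex) \<Rightarrow> ('a \<Rightarrow> complex) \<Rightarrow> complex" where
  "ip g h = cinner H (Q g) (Q h)"

sublocale form: psd_form fscale ip
proof (rule psd_form.intro[OF vector_space_fscale], unfold_locales)
  fix g h k :: "'a \<Rightarrow> complex" and c :: complex
  show "ip (g + h) k = ip g k + ip h k" by (simp add: ip_def Q_add cinner_add_left)
  show "ip (fscale c g) h = c * ip g h" by (simp add: ip_def Q_scale cinner_smult_left)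
  show "ip g h = cnj (ip h g)" unfolding ip_def by (rule cinner_commute) simp_all
  show "0 \<le> Re (ip g g)" by (simp add: ip_def cinner_nonneg)
qed

lemma cinner_eq_ip: "x \<in> carrier H \<Longrightarrow> y \<in> carrier H \<Longrightarrow> cinner H x y = ip (functional x) (functional y)"
  by (simp add: ip_def Q_functional)

lemma seminorm_eq_hnorm: "form.seminorm g = hnorm H (Q g)"
  by (simp add: form.seminorm_def form.sq_def ip_def hnorm_def)

lemma Q_diff: "Q (g - h) = Q g \<ominus> Q h"
proof -
  have "g - h = g + fscale (-1) h" by (auto simp: fun_eq_iff)
  then show ?thesis by (simp only: Q_add Q_scale minus_eq_smult Q_closed)
qed

lemma ip_complete:
  assumes "form.Cauchy_seq X" shows "\<exists>L. (\<lambda>n. form.seminorm (X n - L)) \<longlonglongrightarrow> 0"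
proof -
  have "\<exists>L\<in>carrier H. (\<lambda>n. hnorm H (Q (X n) \<ominus> L)) \<longlonglongrightarrow> 0"
    by (rule complete) (use assms in \<open>auto simp: form.Cauchy_seq_def seminorm_eq_hnorm Q_diff\<close>)
  then obtain L where "L \<in> carrier H" "(\<lambda>n. hnorm H (Q (X n) \<ominus> L)) \<longlonglongrightarrow> 0" by blast
  then have "(\<lambda>n. form.seminorm (X n - functional L)) \<longlonglongrightarrow> 0"
    by (simp add: seminorm_eq_hnorm Q_diff Q_functional)
  then show ?thesis by blast
qed

end

context hilbert_space
begin

lemma linearized: obtains Q where "linearized_hilbert_space H Q"
proof -
  obtain Q where "\<And>g. Q g \<in> carrier H" "\<And>g h. Q (g + h) = Q g \<oplus> Q h"
    "\<And>c g. Q (fscale c g) = c \<odot> Q g" "\<And>x. x \<in> carrier H \<Longrightarrow> Q (functional x) = x"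
    using linear_section by metis
  then have "linearized_hilbert_space H Q" by unfold_locales auto
  then show thesis by (rule that)
qed

lemma hnorm_Cauchy_Schwarz:
  assumes "x \<in> carrier H" "y \<in> carrier H"
  shows "cmod (cinner H x y) \<le> hnorm H x * hnorm H y"
proof -
  obtain Q where "linearized_hilbert_space H Q" using linearized .
  then interpret L: linearized_hilbert_space H Q .
  show ?thesis
    using L.form.seminorm_Cauchy_Schwarz[of "functional x" "functional y"] assms
    by (simp add: L.seminorm_eq_hnorm L.Q_functional L.cinner_eq_ip)
qed

lemma hnorm_nonneg [simp]: "x \<in> carrier H \<Longrightarrow> 0 \<le> hnorm H x"
  by (simp add: hnorm_def cinner_nonneg)

lemma hnorm_power2: "x \<in> carrier H \<Longrightarrow> (hnorm H x)\<^sup>2 = Re (cinner H x x)"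
  by (simp add: hnorm_def cinner_nonneg)

lemma cinner_self: "x \<in> carrier H \<Longrightarrow> cinner H x x = of_real ((hnorm H x)\<^sup>2)"
  unfolding hnorm_power2 using arg_cong[OF cinner_commute[of x x], of Im] by (simp add: complex_eq_iff)

lemma hnorm_zero [simp]: "hnorm H \<zero> = 0"
proof -
  have "cinner H (0 \<odot> \<zero>) \<zero> = 0 * cinner H \<zero> \<zero>" by (rule cinner_smult_left) simp_all
  then show ?thesis using smult_l_null[of \<zero>] by (simp add: hnorm_def)
qed

lemma hnorm_smult: "x \<in> carrier H \<Longrightarrow> hnorm H (c \<odot> x) = cmod c * hnorm H x"
proof -
  assume x: "x \<in> carrier H"
  have "cinner H (c \<odot> x) (c \<odot> x) = (c * cnj c) * cinner H x x"
    using x by (simp add: cinner_smult_left cinner_smult_right)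
  then have "Re (cinner H (c \<odot> x) (c \<odot> x)) = (cmod c)\<^sup>2 * Re (cinner H x x)"
    by (simp add: complex_norm_square[symmetric])
  then show ?thesis by (simp add: hnorm_def real_sqrt_mult)
qed

end

lemma bounded_operatorD:
  assumes "bounded_operator H K A"
  shows "x \<in> carrier H \<Longrightarrow> A x \<in> carrier K"
    "x \<in> carrier H \<Longrightarrow> y \<in> carrier H \<Longrightarrow> A (x \<oplus>\<^bsub>H\<^esub> y) = A x \<oplus>\<^bsub>K\<^esub> A y"
    "x \<in> carrier H \<Longrightarrow> A (c \<odot>\<^bsub>H\<^esub> x) = c \<odot>\<^bsub>K\<^esub> A x"
  using assms by (auto simp: bounded_operator_def)

text \<open>
  The Riesz theorem applies to the linearized space, which is complete because $H$ is.
\<close>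
theorem adjoint_exists:
  assumes "hilbert_space H" "hilbert_space K" and A: "bounded_operator H K A"
  obtains A' where "is_adjoint H K A A'"
proof -
  interpret H: hilbert_space H by fact
  interpret K: hilbert_space K by fact
  obtain Q where "linearized_hilbert_space H Q" using H.linearized .
  then interpret L: linearized_hilbert_space H Q .
  note AD = bounded_operatorD[OF A]
  obtain C where C: "\<forall>x\<in>carrier H. hnorm K (A x) \<le> C * hnorm H x"
    using A unfolding bounded_operator_def by blast
  (* In the zero space the constant C may be negative. *)
  define D where "D = max C 0"
  have D: "hnorm K (A x) \<le> D * hnorm H x" if "x \<in> carrier H" for x
  proof -
    have "hnorm K (A x) \<le> C * hnorm H x" using C that by blast
    also have "\<dots> \<le> D * hnorm H x" using that by (intro mult_right_mono) (simp_all add: D_def)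
    finally show ?thesis .
  qed
  have "\<exists>z\<in>carrier H. \<forall>x\<in>carrier H. cinner K (A x) y = cinner H x z" if y: "y \<in> carrier K" for y
  proof -
    have "\<exists>z. \<forall>g. cinner K (A (Q g)) y = L.ip g z"
    proof (rule L.form.Riesz_representation[OF L.ip_complete])
      fix g h c
      show "cinner K (A (Q (g + h))) y = cinner K (A (Q g)) y + cinner K (A (Q h)) y"
        using y by (simp add: L.Q_add AD K.cinner_add_left)
      show "cinner K (A (Q (fscale c g))) y = c * cinner K (A (Q g)) y"
        using y by (simp add: L.Q_scale AD K.cinner_smult_left)
      have "cmod (cinner K (A (Q g)) y) \<le> hnorm K (A (Q g)) * hnorm K y"
        using y by (intro K.hnorm_Cauchy_Schwarz AD) simp_all
      also have "\<dots> \<le> (D * hnorm H (Q g)) * hnorm K y"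
        using y by (intro mult_right_mono D) simp_all
      finally show "cmod (cinner K (A (Q g)) y) \<le> (D * hnorm K y) * L.form.seminorm g"
        by (simp add: L.seminorm_eq_hnorm mult_ac)
    qed
    then obtain z where z: "\<And>g. cinner K (A (Q g)) y = L.ip g z" by blast
    have "cinner K (A x) y = cinner H x (Q z)" if "x \<in> carrier H" for x
      using z[of "H.functional x"] that by (simp add: L.ip_def L.Q_functional)
    then show ?thesis by (intro bexI[of _ "Q z"]) auto
  qed
  then obtain B where B: "\<And>y. y \<in> carrier K \<Longrightarrow> B y \<in> carrier H"
    and adj: "\<And>x y. x \<in> carrier H \<Longrightarrow> y \<in> carrier K \<Longrightarrow> cinner K (A x) y = cinner H x (B y)"
    by metis
  have "bounded_operator K H B"
    unfolding bounded_operator_def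
  proof (intro conjI ballI allI exI[of _ D])
    fix y assume y: "y \<in> carrier K"
    show "B y \<in> carrier H" by (rule B[OF y])
    show "B (c \<odot>\<^bsub>K\<^esub> y) = c \<odot>\<^bsub>H\<^esub> B y" for c
      by (rule H.eq_by_cinner) (simp_all add: B y AD H.cinner_smult_right K.cinner_smult_right flip: adj)
    have "(hnorm H (B y))\<^sup>2 = Re (cinner K (A (B y)) y)"
      using B[OF y] y by (simp add: H.hnorm_power2 adj)
    also have "\<dots> \<le> hnorm K (A (B y)) * hnorm K y"
      using K.hnorm_Cauchy_Schwarz[OF AD(1)[OF B[OF y]] y] complex_Re_le_cmod order_trans by blast
    also have "\<dots> \<le> (D * hnorm H (B y)) * hnorm K y"
      using y by (intro mult_right_mono D B) simp_all
    finally have le: "hnorm H (B y) * hnorm H (B y) \<le> hnorm H (B y) * (D * hnorm K y)"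
      by (simp add: power2_eq_square mult_ac)
    show "hnorm H (B y) \<le> D * hnorm K y"
    proof (cases "hnorm H (B y) = 0")
      case True
      then show ?thesis using y by (simp add: D_def)
    next
      case False
      then have "0 < hnorm H (B y)" using H.hnorm_nonneg[OF B[OF y]] by linarith
      then show ?thesis using le by simp
    qed
    fix z assume z: "z \<in> carrier K"
    show "B (y \<oplus>\<^bsub>K\<^esub> z) = B y \<oplus>\<^bsub>H\<^esub> B z"
      by (rule H.eq_by_cinner) (simp_all add: B y z AD H.cinner_add_right K.cinner_add_right flip: adj)
  qed
  then have "is_adjoint H K A B" using adj by (simp add: is_adjoint_def)
  then show thesis by (rule that)
qed

lemma (in abelian_monoid) finsum_atMost_0:
  "g 0 \<in> carrier G \<Longrightarrow> finsum G g {..0 :: nat} = g 0"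
  using finsum_0[of g] by (simp add: Pi_def)

lemma (in abelian_monoid) finsum_atMost_1:
  assumes "g 0 \<in> carrier G" "g (Suc 0) \<in> carrier G"
  shows "finsum G g {..Suc 0} = g (Suc 0) \<oplus> g 0"
proof -
  have "g \<in> {..Suc 0} \<rightarrow> carrier G" using assms by (auto simp: le_Suc_eq)
  from finsum_Suc[OF this] show ?thesis using finsum_atMost_0[of g, OF assms(1)] by simp
qed

lemma poly_op_first:
  assumes "hilbert_space H" "bounded_operator H H A" "x \<in> carrier H"
  shows "poly_op H [:[:0, 1:]:] A B x = A x"
proof -
  interpret hilbert_space H by fact
  have A: "A x \<in> carrier H" using assms bounded_operatorD(1) by metis
  let ?g = "\<lambda>i. \<Oplus>\<^bsub>H\<^esub>j\<in>{..degree (coeff ([:[:0, 1:]:] :: complex poly poly) i)}. coeff (coeff [:[:0, 1:]:] i) j \<odot>\<^bsub>H\<^esub> (A ^^ j) ((B ^^ i) x)"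
  have g0: "?g 0 = A x"
  proof -
    have "?g 0 = (\<Oplus>\<^bsub>H\<^esub>j\<in>{..Suc 0}. coeff [:0, 1:] j \<odot>\<^bsub>H\<^esub> (A ^^ j) x)" by simp
    also have "\<dots> = A x"
      using assms(3) A smult_l_null[of x] by (subst finsum_atMost_1) simp_all
    finally show ?thesis .
  qed
  have "poly_op H [:[:0, 1:]:] A B x = finsum H ?g {..0}" by (simp add: poly_op_def)
  also have "\<dots> = ?g 0" by (rule finsum_atMost_0) (simp only: g0 A)
  finally show ?thesis by (simp only: g0)
qed

lemma poly_op_second:
  assumes "hilbert_space H" "bounded_operator H H B" "x \<in> carrier H"
  shows "poly_op H [:0, [:1:]:] A B x = B x"
proof -
  interpret hilbert_space H by fact
  have B: "B x \<in> carrier H" using assms bounded_operatorD(1) by metis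
  let ?g = "\<lambda>i. \<Oplus>\<^bsub>H\<^esub>j\<in>{..degree (coeff ([:0, [:1:]:] :: complex poly poly) i)}. coeff (coeff [:0, [:1:]:] i) j \<odot>\<^bsub>H\<^esub> (A ^^ j) ((B ^^ i) x)"
  have g0: "?g 0 = \<zero>\<^bsub>H\<^esub>"
  proof -
    have "?g 0 = (\<Oplus>\<^bsub>H\<^esub>j\<in>{..0}. 0 \<odot>\<^bsub>H\<^esub> (A ^^ j) x)" by simp
    also have "\<dots> = \<zero>\<^bsub>H\<^esub>"
      using assms(3) smult_l_null[of x] by (subst finsum_atMost_0) simp_all
    finally show ?thesis .
  qed
  have g1: "?g (Suc 0) = B x"
  proof -
    have "?g (Suc 0) = (\<Oplus>\<^bsub>H\<^esub>j\<in>{..0}. coeff [:1:] j \<odot>\<^bsub>H\<^esub> (A ^^ j) (B x))" by simp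
    also have "\<dots> = B x"
      using B by (subst finsum_atMost_0) simp_all
    finally show ?thesis .
  qed
  have "poly_op H [:0, [:1:]:] A B x = finsum H ?g {..Suc 0}" by (simp add: poly_op_def)
  also have "\<dots> = ?g (Suc 0) \<oplus>\<^bsub>H\<^esub> ?g 0"
    by (rule finsum_atMost_1) (simp_all only: g0 g1 B zero_closed)
  also have "\<dots> = B x" unfolding g0 g1 using B by simp
  finally show ?thesis .
qed

lemma unitary_cinner:
  assumes "unitary K U" "x \<in> carrier K" "y \<in> carrier K"
  shows "cinner K (U x) (U y) = cinner K x y"
proof -
  obtain U' where U': "is_adjoint K K U U'" "\<And>x. x \<in> carrier K \<Longrightarrow> U' (U x) = x"
    using assms(1) by (auto simp: unitary_def)
  have "U y \<in> carrier K" using assms bounded_operatorD(1) by (metis unitary_def)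
  then show ?thesis using U' assms(2,3) by (simp add: is_adjoint_def)
qed

text \<open>
  On the circle $|z|^2 + |1-z|^2 = 1$, and $z \overline{(1-z)}$ is imaginary. The inner product $\langle Uk, Vk\rangle$ is real
  because $\langle Uk, Vk\rangle = \langle U^2 k, UV k\rangle = \langle V^2 k, V U k\rangle = \langle Vk, Uk\rangle$.
\<close>
lemma unitary_pencil_isometric:
  assumes "hilbert_space K" and U: "unitary K U" and V: "unitary K V"
    and comm: "operators_commute K U V" and squares: "equal_squares K U V"
    and z: "cmod (z - 1/2) = 1/2" and k: "k \<in> carrier K"
  shows "hnorm K (z \<odot>\<^bsub>K\<^esub> U k \<oplus>\<^bsub>K\<^esub> (1 - z) \<odot>\<^bsub>K\<^esub> V k) = hnorm K k"
proof -
  interpret K: hilbert_space K by fact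
  have Uk: "U x \<in> carrier K" and Vk: "V x \<in> carrier K" if "x \<in> carrier K" for x
    using U V that bounded_operatorD(1) by (metis unitary_def)+
  have "cinner K (U k) (V k) = cinner K (U (U k)) (U (V k))"
    using unitary_cinner[OF U] Uk Vk k by simp
  also have "\<dots> = cinner K (V (V k)) (V (U k))"
    using comm squares k by (simp add: operators_commute_def equal_squares_def)
  also have "\<dots> = cinner K (V k) (U k)" using unitary_cinner[OF V] Uk Vk k by simp
  finally have sym: "cinner K (U k) (V k) = cinner K (V k) (U k)" .
  define a b where "a = Re z" and "b = Im z"
  have "(cmod (z - 1/2))\<^sup>2 = (1/2)\<^sup>2" using z by simp
  then have "(Re (z - 1/2))\<^sup>2 + (Im (z - 1/2))\<^sup>2 = (1/2)\<^sup>2" unfolding cmod_power2 .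
  then have circ: "a\<^sup>2 + b\<^sup>2 = a"
    by (simp add: a_def b_def power2_eq_square algebra_simps)
  have zz: "z * cnj z + (1 - z) * cnj (1 - z) = 1"
    using circ by (simp add: complex_eq_iff a_def b_def power2_eq_square algebra_simps)
  have zc: "z * cnj (1 - z) + (1 - z) * cnj z = 0"
    using circ by (simp add: complex_eq_iff a_def b_def power2_eq_square algebra_simps)
  have UU: "cinner K (U k) (U k) = cinner K k k" and VV: "cinner K (V k) (V k) = cinner K k k"
    using unitary_cinner[OF U k k] unitary_cinner[OF V k k] by auto
  have "cinner K (z \<odot>\<^bsub>K\<^esub> U k \<oplus>\<^bsub>K\<^esub> (1 - z) \<odot>\<^bsub>K\<^esub> V k) (z \<odot>\<^bsub>K\<^esub> U k \<oplus>\<^bsub>K\<^esub> (1 - z) \<odot>\<^bsub>K\<^esub> V k)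
      = (z * cnj z + (1 - z) * cnj (1 - z)) * cinner K k k
        + (z * cnj (1 - z) + (1 - z) * cnj z) * cinner K (V k) (U k)"
    using Uk[OF k] Vk[OF k]
    by (simp add: K.cinner_add_left K.cinner_add_right K.cinner_smult_left K.cinner_smult_right UU VV sym
        distrib_right distrib_left mult_ac del: complex_cnj_diff)
  also have "\<dots> = cinner K k k" unfolding zz zc by simp
  finally show ?thesis by (simp only: hnorm_def)
qed

text \<open>
  The polynomials $z$ and $w$ alone express $S$ and $T$ as compressions of $U$ and $V$.
\<close>
theorem dilation_imp_contractive:
  fixes H :: "'a hilbert"
  assumes H: "hilbert_space H" and S: "bounded_operator H H S" and T: "bounded_operator H H T"
    and dil: "dilates_to_unitaries TYPE('k) H S T" and z: "cmod (z - 1/2) = 1/2"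
  shows "operator_norm H H (\<lambda>x. z \<odot>\<^bsub>H\<^esub> S x \<oplus>\<^bsub>H\<^esub> (1 - z) \<odot>\<^bsub>H\<^esub> T x) \<le> 1"
proof -
  interpret H: hilbert_space H by fact
  obtain K :: "'k hilbert" and U V where K: "hilbert_space K" and U: "unitary K U" and V: "unitary K V"
    and comm: "operators_commute K U V" and squares: "equal_squares K U V" and D: "dilates_to H S T K U V"
    using dil by (auto simp: dilates_to_unitaries_def)
  interpret K: hilbert_space K by fact
  obtain \<iota> \<iota>' where iso: "isometry H K \<iota>" and adj: "is_adjoint H K \<iota> \<iota>'"
    and poly: "\<And>p x. x \<in> carrier H \<Longrightarrow> poly_op H p S T x = \<iota>' (poly_op K p U V (\<iota> x))"
    using D by (auto simp: dilates_to_def)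
  have io: "\<iota> x \<in> carrier K" "hnorm K (\<iota> x) = hnorm H x" if "x \<in> carrier H" for x
    using iso that by (auto simp: isometry_def bounded_operator_def)
  have bU: "bounded_operator K K U" and bV: "bounded_operator K K V"
    using U V by (auto simp: unitary_def)
  have bi: "bounded_operator K H \<iota>'" using adj by (simp add: is_adjoint_def)
  have contr: "hnorm H (\<iota>' y) \<le> hnorm K y" if y: "y \<in> carrier K" for y
  proof -
    have iy: "\<iota>' y \<in> carrier H" by (rule bounded_operatorD(1)[OF bi y])
    have "(hnorm H (\<iota>' y))\<^sup>2 = Re (cinner K (\<iota> (\<iota>' y)) y)"
      using adj iy y by (simp add: is_adjoint_def H.hnorm_power2)
    also have "\<dots> \<le> hnorm H (\<iota>' y) * hnorm K y"
      using K.hnorm_Cauchy_Schwarz[OF io(1)[OF iy] y] complex_Re_le_cmod[of "cinner K (\<iota> (\<iota>' y)) y"] io(2)[OF iy]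
      by simp
    finally have "hnorm H (\<iota>' y) * hnorm H (\<iota>' y) \<le> hnorm H (\<iota>' y) * hnorm K y"
      by (simp add: power2_eq_square)
    then show ?thesis
      using H.hnorm_nonneg[OF iy] K.hnorm_nonneg[OF y] by (cases "hnorm H (\<iota>' y) = 0") auto
  qed
  have le: "hnorm H (z \<odot>\<^bsub>H\<^esub> S x \<oplus>\<^bsub>H\<^esub> (1 - z) \<odot>\<^bsub>H\<^esub> T x) \<le> hnorm H x" if x: "x \<in> carrier H" for x
  proof -
    let ?k = "\<iota> x"
    have k: "?k \<in> carrier K" by (rule io(1)[OF x])
    have Uk: "U ?k \<in> carrier K" and Vk: "V ?k \<in> carrier K"
      using bounded_operatorD(1)[OF bU k] bounded_operatorD(1)[OF bV k] .
    have "S x = \<iota>' (U ?k)"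
      using poly[OF x, of "[:[:0, 1:]:]"] by (simp only: poly_op_first[OF H S x] poly_op_first[OF K bU k])
    moreover have "T x = \<iota>' (V ?k)"
      using poly[OF x, of "[:0, [:1:]:]"] by (simp only: poly_op_second[OF H T x] poly_op_second[OF K bV k])
    ultimately have "z \<odot>\<^bsub>H\<^esub> S x \<oplus>\<^bsub>H\<^esub> (1 - z) \<odot>\<^bsub>H\<^esub> T x
        = \<iota>' (z \<odot>\<^bsub>K\<^esub> U ?k \<oplus>\<^bsub>K\<^esub> (1 - z) \<odot>\<^bsub>K\<^esub> V ?k)"
      using Uk Vk by (simp add: bounded_operatorD[OF bi])
    also have "hnorm H \<dots> \<le> hnorm K (z \<odot>\<^bsub>K\<^esub> U ?k \<oplus>\<^bsub>K\<^esub> (1 - z) \<odot>\<^bsub>K\<^esub> V ?k)"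
      using Uk Vk by (intro contr) simp
    also have "\<dots> = hnorm H x"
      using unitary_pencil_isometric[OF K U V comm squares z k] io(2)[OF x] by simp
    finally show ?thesis .
  qed
  show ?thesis
    unfolding operator_norm_def
  proof (rule cSUP_least)
    show "{x \<in> carrier H. hnorm H x \<le> 1} \<noteq> {}" using H.hnorm_zero H.zero_closed by force
    show "hnorm H (z \<odot>\<^bsub>H\<^esub> S x \<oplus>\<^bsub>H\<^esub> (1 - z) \<odot>\<^bsub>H\<^esub> T x) \<le> 1" if "x \<in> {x \<in> carrier H. hnorm H x \<le> 1}" for x
      using le[of x] that by auto
  qed
qed

section \<open>The dilation kernel\<close>

context psd_form
begin

lemma toeplitz_properties:
  assumes E: "psd_form scale E" and E_le: "\<And>x. Re (E x x) \<le> sq x"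
    and C: "\<And>x y. C (x + y) = C x + C y" "\<And>c x. C (c *s x) = c *s C x" and C_le: "\<And>x. sq (C x) \<le> sq x"
  shows "toeplitz f E C m n (x + y) z = toeplitz f E C m n x z + toeplitz f E C m n y z"
    and "toeplitz f E C m n (c *s x) z = c * toeplitz f E C m n x z"
    and "toeplitz f E C m n x y = cnj (toeplitz f E C n m y x)"
    and "sq (y - y') = 0 \<Longrightarrow> toeplitz f E C m n x y = toeplitz f E C m n x y'"
proof -
  interpret E: psd_form scale E by (rule E)
  have pow_add: "(C ^^ k) (x + y) = (C ^^ k) x + (C ^^ k) y" and pow_scale: "(C ^^ k) (c *s x) = c *s (C ^^ k) x"
    and pow_le: "sq ((C ^^ k) x) \<le> sq x" for k x y c
    by (induction k) (auto simp: C intro: order_trans[OF C_le])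
  show "toeplitz f E C m n (x + y) z = toeplitz f E C m n x z + toeplitz f E C m n y z"
    by (simp add: toeplitz_def add_left E.add_left pow_add)
  show "toeplitz f E C m n (c *s x) z = c * toeplitz f E C m n x z"
    by (simp add: toeplitz_def scale_left E.scale_left pow_scale)
  show "toeplitz f E C m n x y = cnj (toeplitz f E C n m y x)"
    using E.hermitian[of x y] hermitian[of "(C ^^ nat (m - n)) x" y] hermitian[of x "(C ^^ nat (n - m)) y"]
    by (auto simp: toeplitz_def)
  assume null: "sq (y - y') = 0"
  have pow_diff: "(C ^^ k) (y - y') = (C ^^ k) y - (C ^^ k) y'" for k
    using pow_add[of k "y - y'" y'] by (simp add: eq_diff_eq)
  have "sq ((C ^^ k) y - (C ^^ k) y') = 0" for k
    using pow_le[of k "y - y'"] null by (simp add: pow_diff order_antisym)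
  moreover have "E.sq (y - y') = 0"
    using E_le[of "y - y'"] null E.sq_nonneg[of "y - y'"] by (simp add: E.sq_def)
  ultimately show "toeplitz f E C m n x y = toeplitz f E C m n x y'"
    by (simp add: toeplitz_def eq_of_null_diff(2) eq_of_null_diff(2)[OF null] E.eq_of_null_diff(2))
qed

end

lemma finite_int_set_window:
  assumes "finite (I :: int set)" obtains c N where "I \<subseteq> (\<lambda>n. c + int n) ` {..<N}"
proof -
  define b where "b = (\<Sum>x\<in>I. \<bar>x\<bar>)"
  have "x \<in> (\<lambda>n. - b + int n) ` {..<nat (2 * b + 1)}" if "x \<in> I" for x
  proof -
    have "\<bar>x\<bar> \<le> b" unfolding b_def using assms that by (intro member_le_sum) auto
    then have "x = - b + int (nat (x + b))" "nat (x + b) < nat (2 * b + 1)" by auto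
    then show ?thesis by blast
  qed
  then show thesis using that by blast
qed

context contractive_pencil
begin

text \<open>
  Average the pencil inequality over $\mu = 1$ and $\mu = -1$.
\<close>
lemma sq_A_le: "sq (A x) \<le> sq x"
proof -
  have "sq (A x + B x) \<le> sq x" "sq (A x - B x) \<le> sq x"
    using pencil[of 1 x] pencil[of "-1" x] by simp_all
  then show ?thesis using parallelogram[of "A x" "B x"] sq_nonneg[of "B x"] by linarith
qed

lemma sq_B_le: "sq (B x) \<le> sq x"
  by (rule contractive_pencil.sq_A_le[OF swapped])

text \<open>
  All mixed products vanish because $AB = BA = 0$.
\<close>
lemma pencil_powers:
  "((\<lambda>v. A v + B v) ^^ j) (((\<lambda>v. A v - B v) ^^ i) x)
    = (if i + j = 0 then x else (A ^^ (i + j)) x + ((-1) ^ i) *s (B ^^ (i + j)) x)"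
proof -
  have AB': "A ((B ^^ Suc n) x) = 0" and BA': "B ((A ^^ Suc n) x) = 0" for n by (simp_all add: AB BA)
  have 1: "((\<lambda>v. A v - B v) ^^ i) x = (if i = 0 then x else (A ^^ i) x + ((-1) ^ i) *s (B ^^ i) x)"
  proof (induction i)
    case (Suc i)
    show ?case
    proof (cases i)
      case 0 then show ?thesis by simp
    next
      case (Suc k)
      then show ?thesis using Suc.IH by (simp add: A_add B_add A_diff B_diff A_scale B_scale AB BA)
    qed
  qed simp
  show ?thesis
  proof (induction j)
    case 0
    then show ?case by (simp add: 1)
  next
    case (Suc j)
    show ?case
    proof (cases "i + j")
      case 0
      then show ?thesis by simp
    next
      case (Suc k)
      then show ?thesis using Suc.IH by (simp add: A_add B_add A_scale B_scale AB BA)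
    qed
  qed
qed

text \<open>
  Positions are pairs of a summand and a time. The summand \<open>True\<close> carries the Toeplitz kernel of $A$, the summand
  \<open>False\<close> that of $B$, and the two summands are orthogonal.
\<close>
theorem dilation_kernel:
  obtains \<kappa> :: "bool \<times> int \<Rightarrow> bool \<times> int \<Rightarrow> 'v \<Rightarrow> 'v \<Rightarrow> complex" where
    "operator_kernel scale \<kappa>"
    "\<And>s t m n k x y. \<kappa> (s, m + k) (t, n + k) x y = \<kappa> (s, m) (t, n) x y"
    "\<And>s t m n x y. s \<noteq> t \<Longrightarrow> \<kappa> (s, m) (t, n) x y = 0"
    "\<And>x y. \<kappa> (True, 0) (True, 0) x y + \<kappa> (False, 0) (False, 0) x y = ip x y"
    "\<And>n x y. n > 0 \<Longrightarrow> \<kappa> (True, int n) (True, 0) x y = ip ((A ^^ n) x) y"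
    "\<And>n x y. n > 0 \<Longrightarrow> \<kappa> (False, int n) (False, 0) x y = ip ((B ^^ n) x) y"
    "\<And>p q x y y'. sq (y - y') = 0 \<Longrightarrow> \<kappa> p q x y = \<kappa> p q x y'"
proof -
  obtain F where F: "psd_form scale F" and F_le: "\<And>x. Re (F x x) \<le> sq x"
    and FA: "\<And>M h a. shiftable scale A M h a \<Longrightarrow>
      0 \<le> (\<Sum>i<M. sq (h i) - Re (F (h i) (h i))) + 2 * (\<Sum>i<M. Re (ip (h i) (a i)))"
    and FB: "\<And>N k b. shiftable scale B N k b \<Longrightarrow>
      0 \<le> (\<Sum>j<N. Re (F (k j) (k j))) + 2 * (\<Sum>j<N. Re (ip (k j) (b j)))"
    using splitting_form by blast
  interpret F: psd_form scale F by (rule F)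
  define E where "E x y = ip x y - F x y" for x y
  have Eherm: "E x y = cnj (E y x)" for x y
    using hermitian[of x y] F.hermitian[of x y] by (simp add: E_def)
  have E: "psd_form scale E"
    by unfold_locales (use F_le Eherm in \<open>auto simp: E_def add_left F.add_left scale_left F.scale_left
      sq_def algebra_simps\<close>)
  have E_le: "Re (E x x) \<le> sq x" for x using F.nonneg[of x] by (simp add: E_def sq_def)
  have EA: "0 \<le> (\<Sum>i<M. Re (E (h i) (h i))) + 2 * (\<Sum>i<M. Re (ip (h i) (a i)))"
    if "shiftable scale A M h a" for M h a
    using FA[OF that] by (simp add: E_def sq_def)
  note tA = toeplitz_properties[OF E E_le A_add A_scale sq_A_le]
  note tB = toeplitz_properties[OF F F_le B_add B_scale sq_B_le]
  define \<kappa> where "\<kappa> p q x y = (if fst p \<noteq> fst q then 0 else if fst p then toeplitz ip E A (snd p) (snd q) x y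
    else toeplitz ip F B (snd p) (snd q) x y)" for p q :: "bool \<times> int" and x y
  show thesis
  proof (rule that)
    show "operator_kernel scale \<kappa>"
    proof
      fix p q :: "bool \<times> int" and x y z :: 'v and c :: complex
      show "\<kappa> p q (x + y) z = \<kappa> p q x z + \<kappa> p q y z" by (simp add: \<kappa>_def tA(1) tB(1))
      show "\<kappa> p q (c *s x) y = c * \<kappa> p q x y" by (simp add: \<kappa>_def tA(2) tB(2))
      show "\<kappa> p q x y = cnj (\<kappa> q p y x)"
        using tA(3)[of "snd p" "snd q" x y] tB(3)[of "snd p" "snd q" x y] by (simp add: \<kappa>_def)
      fix P0 :: "(bool \<times> int) set" assume "finite P0"
      then obtain c N where I: "snd ` P0 \<subseteq> (\<lambda>n. c + int n) ` {..<N}"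
        using finite_int_set_window[of "snd ` P0"] by auto
      let ?I = "(\<lambda>n. c + int n) ` {..<N}"
      let ?P = "(UNIV :: bool set) \<times> ?I"
      have inj: "inj_on (\<lambda>n. c + int n) {..<N}" by (auto simp: inj_on_def)
      have split: "(\<Sum>p\<in>?P. h p) = (\<Sum>s\<in>UNIV. \<Sum>m<N. h (s, c + int m))" for h :: "bool \<times> int \<Rightarrow> complex"
      proof -
        have "(\<Sum>p\<in>?P. h p) = (\<Sum>s\<in>UNIV. \<Sum>i\<in>?I. h (s, i))"
          unfolding sum.cartesian_product by (simp add: split_def)
        then show ?thesis by (simp add: sum.reindex[OF inj])
      qed
      have "P0 \<subseteq> ?P"
      proof
        fix p assume "p \<in> P0"
        then have "snd p \<in> ?I" using I by blast
        then show "p \<in> ?P" by (cases p) auto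
      qed
      moreover have "0 \<le> Re (\<Sum>p\<in>?P. \<Sum>q\<in>?P. \<kappa> p q (g p) (g q))" for g
      proof -
        have "(\<Sum>p\<in>?P. \<Sum>q\<in>?P. \<kappa> p q (g p) (g q))
            = (\<Sum>s\<in>UNIV. \<Sum>m<N. \<Sum>t\<in>UNIV. \<Sum>n<N. \<kappa> (s, c + int m) (t, c + int n) (g (s, c + int m)) (g (t, c + int n)))"
          unfolding split ..
        also have "\<dots> = (\<Sum>m<N. \<Sum>n<N. toeplitz ip E A (c + int m) (c + int n) (g (True, c + int m)) (g (True, c + int n)))
            + (\<Sum>m<N. \<Sum>n<N. toeplitz ip F B (c + int m) (c + int n) (g (False, c + int m)) (g (False, c + int n)))"
          by (simp add: UNIV_bool \<kappa>_def)
        finally show ?thesis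
          using toeplitz_nonneg[where C = A and E = E and N = N and c = c and h = "\<lambda>m. g (True, c + int m)", OF A_add A_zero EA]
            toeplitz_nonneg[where C = B and E = F and N = N and c = c and h = "\<lambda>m. g (False, c + int m)", OF B_add B_zero FB] by simp
      qed
      ultimately show "\<exists>P. P0 \<subseteq> P \<and> finite P \<and> (\<forall>g. 0 \<le> Re (\<Sum>p\<in>P. \<Sum>q\<in>P. \<kappa> p q (g p) (g q)))"
        by (intro exI[of _ ?P]) auto
    qed
    show "\<kappa> (s, m + k) (t, n + k) x y = \<kappa> (s, m) (t, n) x y" for s t m n k x y
      by (simp add: \<kappa>_def toeplitz_def)
    show "\<kappa> (s, m) (t, n) x y = 0" if "s \<noteq> t" for s t m n x y using that by (simp add: \<kappa>_def)
    show "\<kappa> (True, 0) (True, 0) x y + \<kappa> (False, 0) (False, 0) x y = ip x y" for x y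
      by (simp add: \<kappa>_def toeplitz_def E_def)
    show "\<kappa> (True, int n) (True, 0) x y = ip ((A ^^ n) x) y" if "n > 0" for n x y
      using that by (simp add: \<kappa>_def toeplitz_def)
    show "\<kappa> (False, int n) (False, 0) x y = ip ((B ^^ n) x) y" if "n > 0" for n x y
      using that by (simp add: \<kappa>_def toeplitz_def)
    show "\<kappa> p q x y = \<kappa> p q x y'" if "sq (y - y') = 0" for p q x y y'
      using tA(4)[OF that] tB(4)[OF that] by (simp add: \<kappa>_def)
  qed
qed

end

section \<open>The dilation\<close>

lemma (in hilbert_space) cinner_finsum_left:
  assumes "finite I" "\<And>i. i \<in> I \<Longrightarrow> g i \<in> carrier H" "y \<in> carrier H"
  shows "cinner H (finsum H g I) y = (\<Sum>i\<in>I. cinner H (g i) y)"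
  using assms(1,2)
proof (induction I)
  case empty
  have "cinner H (0 \<odot> \<zero>) y = 0 * cinner H \<zero> y" using assms(3) by (intro cinner_smult_left) simp_all
  then show ?case using smult_l_null[of \<zero>] by simp
next
  case (insert i I)
  then have "g \<in> I \<rightarrow> carrier H" "g i \<in> carrier H" by auto
  then show ?case
    using insert assms(3) by (simp add: finsum_insert cinner_add_left finsum_closed)
qed

lemma funpow_closed:
  assumes "\<And>x. x \<in> X \<Longrightarrow> A x \<in> X" "x \<in> X" shows "(A ^^ n) x \<in> X"
  by (induction n) (auto simp: assms)

lemma poly_op_closed:
  assumes "hilbert_space H" "\<And>x. x \<in> carrier H \<Longrightarrow> A x \<in> carrier H"
    "\<And>x. x \<in> carrier H \<Longrightarrow> B x \<in> carrier H" "x \<in> carrier H"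
  shows "poly_op H p A B x \<in> carrier H"
proof -
  interpret hilbert_space H by fact
  have "(A ^^ j) ((B ^^ i) x) \<in> carrier H" for i j
    using assms by (intro funpow_closed)
  then show ?thesis unfolding poly_op_def by (intro finsum_closed) (auto intro!: finsum_closed)
qed

lemma cinner_poly_op:
  assumes "hilbert_space H" "\<And>x. x \<in> carrier H \<Longrightarrow> A x \<in> carrier H"
    "\<And>x. x \<in> carrier H \<Longrightarrow> B x \<in> carrier H" "x \<in> carrier H" "y \<in> carrier H"
  shows "cinner H (poly_op H p A B x) y
    = (\<Sum>i\<le>degree p. \<Sum>j\<le>degree (coeff p i). coeff (coeff p i) j * cinner H ((A ^^ j) ((B ^^ i) x)) y)"
proof -
  interpret hilbert_space H by fact
  have c: "(A ^^ j) ((B ^^ i) x) \<in> carrier H" for i j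
    using assms by (intro funpow_closed)
  have s: "(\<Oplus>\<^bsub>H\<^esub>j\<in>{..degree (coeff p i)}. coeff (coeff p i) j \<odot>\<^bsub>H\<^esub> (A ^^ j) ((B ^^ i) x)) \<in> carrier H" for i
    using c by (auto intro!: finsum_closed)
  show ?thesis
    unfolding poly_op_def using c s assms(5)
    by (subst cinner_finsum_left, simp, simp, simp, intro sum.cong refl, subst cinner_finsum_left)
      (auto intro!: sum.cong simp: cinner_smult_left)
qed

definition move :: "int \<Rightarrow> bool \<times> int \<Rightarrow> bool \<times> int" where
  "move k p = (fst p, snd p + k)"

lemma bij_move: "bij (move k)"
  by (rule bij_betw_byWitness[where f' = "move (- k)"]) (auto simp: move_def)

text \<open>
  Positions are encoded by natural numbers because the functions in the completion are indexed by pairs of a number and an element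
  of $H$. Several numbers may decode to the same position, so a position is shifted after decoding and
  encoded again; functions in the completion do not distinguish such numbers.
\<close>
definition reindex_nat :: "int \<Rightarrow> nat \<times> 'a \<Rightarrow> nat \<times> 'a" where
  "reindex_nat k i = (to_nat (move k (from_nat (fst i))), snd i)"

locale bilateral_kernel = linearized_hilbert_space H Q + operator_kernel fscale \<kappa>
  for H :: "'a hilbert" (structure) and Q and \<kappa> :: "bool \<times> int \<Rightarrow> bool \<times> int \<Rightarrow> ('a \<Rightarrow> complex) \<Rightarrow> ('a \<Rightarrow> complex) \<Rightarrow> complex" +
  assumes shift_invariant: "\<kappa> (s, m + k) (t, n + k) x y = \<kappa> (s, m) (t, n) x y"
    and block_diagonal: "s \<noteq> t \<Longrightarrow> \<kappa> (s, m) (t, n) x y = 0"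
    and kernel_diagonal: "\<kappa> (True, 0) (True, 0) x y + \<kappa> (False, 0) (False, 0) x y = ip x y"
    and kernel_null: "form.sq (y - y') = 0 \<Longrightarrow> \<kappa> p q x y = \<kappa> p q x y'"
begin

abbreviation single :: "bool \<times> int \<Rightarrow> ('a \<Rightarrow> complex) \<Rightarrow> (bool \<times> int) \<Rightarrow>\<^sub>0 ('a \<Rightarrow> complex)" where
  "single \<equiv> Poly_Mapping.single"

definition \<phi> :: "nat \<times> 'a \<Rightarrow> (bool \<times> int) \<Rightarrow>\<^sub>0 ('a \<Rightarrow> complex)" where
  "\<phi> i = single (from_nat (fst i)) (functional (if snd i \<in> carrier H then snd i else \<zero>))"

sublocale W: psd_form pscale form
  by (rule psd_form_form)

sublocale W: spanning_family pscale form \<phi>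
proof
  fix w :: "(bool \<times> int) \<Rightarrow>\<^sub>0 ('a \<Rightarrow> complex)"
  let ?l = "Poly_Mapping.lookup w"
  let ?enc = "\<lambda>q. (to_nat q, Q (?l q))"
  have inj: "inj_on ?enc (Poly_Mapping.keys w)" by (auto simp: inj_on_def)
  have "form u w = (\<Sum>i\<in>?enc ` Poly_Mapping.keys w. 1 * form u (\<phi> i))" for u
  proof -
    have "form u (single q (?l q)) = form u (\<phi> (?enc q))" for q
    proof -
      have "form.sq (?l q - functional (Q (?l q))) = 0"
      proof -
        have "form.seminorm (?l q - functional (Q (?l q))) = 0"
          by (simp add: seminorm_eq_hnorm Q_diff Q_functional minus_eq r_neg)
        then show ?thesis using form.seminorm_power2[of "?l q - functional (Q (?l q))"] by simp
      qed
      from kernel_null[OF this] show ?thesis by (simp add: form_single_right \<phi>_def)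
    qed
    then show ?thesis by (subst form_expand_right) (simp add: sum.reindex[OF inj])
  qed
  then show "\<exists>F c. finite F \<and> (\<forall>u. form u w = (\<Sum>i\<in>F. c i * form u (\<phi> i)))"
    by (intro exI[of _ "?enc ` Poly_Mapping.keys w"] exI[of _ "\<lambda>_. 1"]) simp
qed

text \<open>
  The shift by one time step with the sign \<open>e True\<close> on one summand and \<open>e False\<close> on the
  other. The constant sign gives $U$, the signs $1$ and $-1$ give $V$.
\<close>
definition signed_shift :: "(bool \<Rightarrow> complex) \<Rightarrow> (nat \<times> 'a \<Rightarrow> complex) \<Rightarrow> nat \<times> 'a \<Rightarrow> complex" where
  "signed_shift e = W.weighted_subst (\<lambda>i. e (fst (from_nat (fst i) :: bool \<times> int))) (reindex_nat (-1))"

lemma kernel_move: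
  assumes "\<And>b. cnj (e b) * e b = 1"
  shows "e (fst p) * cnj (e (fst q)) * \<kappa> p q x y = \<kappa> (move k p) (move k q) x y"
proof (cases p, cases q)
  fix s m t n assume p: "p = (s, m)" and q: "q = (t, n)"
  show ?thesis
    using assms[of t] by (cases "s = t") (simp_all add: p q move_def block_diagonal shift_invariant mult.commute)
qed

lemma form_reindex_phi:
  assumes "\<And>b. cnj (e b) * e b = 1"
  shows "form (reindex (\<lambda>p. e (fst p)) (move k) w) (\<phi> i) = e (fst (from_nat (fst i) :: bool \<times> int)) * form w (\<phi> (reindex_nat k i))"
  unfolding \<phi>_def reindex_nat_def
  by (subst form_reindex_single[OF bij_move kernel_move[of e, OF assms] assms]) simp

lemma signed_shift_unitary:
  assumes e: "\<And>b. e b = 1 \<or> e b = -1"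
  shows "unitary W.completion (signed_shift e)"
proof -
  have e1: "cnj (e b) * e b = 1" "e b * e b = 1" for b using e[of b] by auto
  have fst_move: "fst (from_nat (fst (reindex_nat k i)) :: bool \<times> int) = fst (from_nat (fst i) :: bool \<times> int)" for k and i :: "nat \<times> 'a"
    by (simp add: reindex_nat_def move_def)
  have phi: "\<phi> (reindex_nat 1 (reindex_nat (- 1) i)) = \<phi> i" "\<phi> (reindex_nat (- 1) (reindex_nat 1 i)) = \<phi> i" for i
    by (simp_all add: \<phi>_def reindex_nat_def move_def)
  show ?thesis
    unfolding signed_shift_def
  proof (rule W.weighted_subst_unitary[where T = "reindex (\<lambda>p. e (fst p)) (move (-1))" and T' = "reindex (\<lambda>p. e (fst p)) (move 1)"
        and \<epsilon>' = "\<lambda>i. e (fst (from_nat (fst i) :: bool \<times> int))" and \<sigma>' = "reindex_nat 1"])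
  qed (auto simp: form_reindex[OF bij_move kernel_move[of e, OF e1(1)]] reindex_diff[OF bij_move]
      form_reindex_phi[of e, OF e1(1)] fst_move e1(2) phi)
qed

lemma signed_shift_commute: "signed_shift e (signed_shift e' f) = signed_shift e' (signed_shift e f)"
  by (auto simp: signed_shift_def W.weighted_subst_def fun_eq_iff reindex_nat_def move_def)

lemma signed_shift_squares:
  assumes "\<And>b. e b * e b = e' b * e' b"
  shows "signed_shift e (signed_shift e f) = signed_shift e' (signed_shift e' f)"
  using assms by (auto simp: signed_shift_def W.weighted_subst_def fun_eq_iff reindex_nat_def move_def mult.assoc[symmetric])

text \<open>
  The images of $x \in H$ under the powers of $U$ and $V$: at time $n$ they differ only by the factor $c$ on the second summand.
\<close>
definition lift :: "nat \<Rightarrow> complex \<Rightarrow> ('a \<Rightarrow> complex) \<Rightarrow> (bool \<times> int) \<Rightarrow>\<^sub>0 ('a \<Rightarrow> complex)" where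
  "lift n c x = single (True, int n) x + single (False, int n) (fscale c x)"

lemma signed_shift_lift:
  assumes e: "e True = 1" "e False = 1 \<or> e False = -1"
  shows "signed_shift e (W.hat (lift n c x)) = W.hat (lift (Suc n) (e False * c) x)"
proof -
  have e1: "cnj (e b) * e b = 1" for b using e by (cases b) auto
  have "reindex (\<lambda>p. e (fst p)) (move (-1)) (lift n c x) = lift (Suc n) (e False * c) x"
    by (rule poly_mapping_eqI)
      (auto simp: lookup_reindex[OF bij_move] lift_def lookup_add lookup_single when_def move_def e fun_eq_iff)
  moreover have "signed_shift e (W.hat w) = W.hat (reindex (\<lambda>p. e (fst p)) (move (-1)) w)" for w
    by (rule ext) (simp add: signed_shift_def W.weighted_subst_def W.hat_def form_reindex_phi[of e, OF e1])
  ultimately show ?thesis by simp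
qed

lemma signed_shift_powers:
  assumes "e True = 1" "e False = 1 \<or> e False = -1"
  shows "(signed_shift e ^^ k) (W.hat (lift n c x)) = W.hat (lift (n + k) (e False ^ k * c) x)"
  by (induction k) (simp_all add: signed_shift_lift[OF assms] mult.assoc)

lemma form_lift:
  "form (lift n c x) (lift 0 1 y)
    = \<kappa> (True, int n) (True, 0) x y + c * \<kappa> (False, int n) (False, 0) x y"
proof -
  have "fscale 1 y = y" by (simp add: fun_eq_iff)
  then show ?thesis
    by (simp add: lift_def W.add_left W.add_right form_single block_diagonal kernel_scale)
qed

lemma lift_add: "lift n c (x + y) = lift n c x + lift n c y"
  by (auto simp: lift_def single_add[symmetric] algebra_simps fun_eq_iff intro!: poly_mapping_eqI simp: lookup_add lookup_single when_def)

lemma lift_scale: "lift n c (fscale a x) = pscale a (lift n c x)"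
  by (auto simp: lift_def fun_eq_iff intro!: poly_mapping_eqI simp: lookup_add lookup_single when_def)

definition embed :: "'a \<Rightarrow> nat \<times> 'a \<Rightarrow> complex" where
  "embed x = W.hat (lift 0 1 (functional x))"

lemma embed_space: "embed x \<in> W.space" by (simp add: embed_def W.hat_space)

lemma embed_isometry: "isometry H W.completion embed"
proof -
  have n: "hnorm W.completion (embed x) = hnorm H x" if "x \<in> carrier H" for x
  proof -
    have "form (lift 0 1 (functional x)) (lift 0 1 (functional x)) = cinner H x x"
      using form_lift[of 0 1 "functional x" "functional x"] kernel_diagonal that by (simp add: cinner_eq_ip)
    then show ?thesis
      unfolding embed_def W.hnorm_hat by (simp add: W.seminorm_def W.sq_def hnorm_def)
  qed
  have a: "embed (x \<oplus> y) = (\<lambda>i. embed x i + embed y i)" if "x \<in> carrier H" "y \<in> carrier H" for x y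
    using that by (simp add: embed_def functional_add lift_add W.hat_def W.add_left fun_eq_iff)
  have s: "embed (c \<odot> x) = (\<lambda>i. c * embed x i)" if "x \<in> carrier H" for c x
    using that by (simp add: embed_def functional_smult lift_scale W.hat_def W.scale_left fun_eq_iff)
  show ?thesis
    unfolding isometry_def bounded_operator_def using n a s embed_space
    by (intro conjI exI[of _ 1]) auto
qed

end

text \<open>
  The linearized operators $A = (S+T)/2$ and $B = (S-T)/2$ form a contractive pencil. The moments $\langle U^j V^i \iota x, \iota y\rangle$
  are entries of the kernel at time difference $i + j$, where they agree with
  $\langle S^j T^i x, y\rangle$.
\<close>
theorem contractive_imp_dilation:
  fixes H :: "'a hilbert"
  assumes H: "hilbert_space H" and S: "bounded_operator H H S" and T: "bounded_operator H H T"
    and comm: "operators_commute H S T" and squares: "equal_squares H S T"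
    and contr: "\<And>z. cmod (z - 1/2) = 1/2 \<Longrightarrow>
      operator_norm H H (\<lambda>x. z \<odot>\<^bsub>H\<^esub> S x \<oplus>\<^bsub>H\<^esub> (1 - z) \<odot>\<^bsub>H\<^esub> T x) \<le> 1"
  shows "dilates_to_unitaries TYPE(nat \<times> 'a \<Rightarrow> complex) H S T"
proof -
  interpret H: hilbert_space H by fact
  obtain Q where "linearized_hilbert_space H Q" using H.linearized .
  then interpret L: linearized_hilbert_space H Q .
  note SD = bounded_operatorD[OF S] and TD = bounded_operatorD[OF T]
  have pointwise: "hnorm H (z \<odot>\<^bsub>H\<^esub> S x \<oplus>\<^bsub>H\<^esub> (1 - z) \<odot>\<^bsub>H\<^esub> T x) \<le> hnorm H x"
    if z: "cmod (z - 1/2) = 1/2" and x: "x \<in> carrier H" for z x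
  proof -
    let ?R = "\<lambda>x. z \<odot>\<^bsub>H\<^esub> S x \<oplus>\<^bsub>H\<^esub> (1 - z) \<odot>\<^bsub>H\<^esub> T x"
    have R: "?R x \<in> carrier H" if "x \<in> carrier H" for x using that SD TD by simp
    have tri: "hnorm H (u \<oplus>\<^bsub>H\<^esub> v) \<le> hnorm H u + hnorm H v" if "u \<in> carrier H" "v \<in> carrier H" for u v
      using L.form.seminorm_triangle[of "H.functional u" "H.functional v"] that
      by (simp add: L.seminorm_eq_hnorm L.Q_add L.Q_functional)
    obtain C D where C: "\<forall>x\<in>carrier H. hnorm H (S x) \<le> C * hnorm H x" and D: "\<forall>x\<in>carrier H. hnorm H (T x) \<le> D * hnorm H x"
      using S T unfolding bounded_operator_def by blast
    have bdd: "bdd_above ((\<lambda>x. hnorm H (?R x)) ` {x \<in> carrier H. hnorm H x \<le> 1})"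
    proof (rule bdd_aboveI2)
      fix x assume x: "x \<in> {x \<in> carrier H. hnorm H x \<le> 1}"
      then have xc: "x \<in> carrier H" and x1: "hnorm H x \<le> 1" by auto
      have x0: "0 \<le> hnorm H x" using xc by simp
      have le: "r * hnorm H x \<le> \<bar>r\<bar>" for r
        using mult_mono[of r "\<bar>r\<bar>" "hnorm H x" 1] x1 x0 by simp
      have "hnorm H (?R x) \<le> cmod z * hnorm H (S x) + cmod (1 - z) * hnorm H (T x)"
        using tri[of "z \<odot>\<^bsub>H\<^esub> S x" "(1 - z) \<odot>\<^bsub>H\<^esub> T x"] xc SD TD by (simp add: H.hnorm_smult)
      also have "\<dots> \<le> cmod z * \<bar>C\<bar> + cmod (1 - z) * \<bar>D\<bar>"
      proof (intro add_mono mult_left_mono)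
        show "hnorm H (S x) \<le> \<bar>C\<bar>" "hnorm H (T x) \<le> \<bar>D\<bar>"
          using C[rule_format, OF xc] D[rule_format, OF xc] le[of C] le[of D] by linarith+
      qed simp_all
      finally show "hnorm H (?R x) \<le> cmod z * \<bar>C\<bar> + cmod (1 - z) * \<bar>D\<bar>" .
    qed
    have unit: "hnorm H (?R y) \<le> 1" if "y \<in> carrier H" "hnorm H y \<le> 1" for y
      using cSUP_upper[OF _ bdd, of y] contr[OF z] that unfolding operator_norm_def by auto
    show ?thesis
    (* The operator norm only controls the unit ball, so nonzero vectors are normalized first. *)
    proof (cases "hnorm H x = 0")
      case True
      then have "cinner H x x = 0" using H.cinner_self[OF x] by simp
      then have x0: "x = \<zero>\<^bsub>H\<^esub>" using H.cinner_definite x by blast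
      have "S x = \<zero>\<^bsub>H\<^esub>" "T x = \<zero>\<^bsub>H\<^esub>"
        using SD(3)[OF x, of 0] TD(3)[OF x, of 0] H.smult_l_null[of x] H.smult_l_null[of "S x"] H.smult_l_null[of "T x"] SD(1)[OF x] TD(1)[OF x] x x0
        by simp_all
      then show ?thesis using True H.smult_r_null by simp
    next
      case False
      then have r: "0 < hnorm H x" using H.hnorm_nonneg[OF x] by linarith
      define c where "c = complex_of_real (inverse (hnorm H x))"
      have "?R (c \<odot>\<^bsub>H\<^esub> x) = c \<odot>\<^bsub>H\<^esub> ?R x"
        by (rule H.functional_inject)
          (simp_all add: x SD TD H.functional_add H.functional_smult fun_eq_iff algebra_simps)
      moreover have "hnorm H (?R (c \<odot>\<^bsub>H\<^esub> x)) \<le> 1"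
        by (rule unit) (use x r in \<open>simp_all add: H.hnorm_smult c_def norm_inverse\<close>)
      ultimately have "inverse (hnorm H x) * hnorm H (?R x) \<le> 1"
        using R[OF x] r by (simp add: H.hnorm_smult c_def norm_inverse)
      then show ?thesis using r by (simp add: field_simps)
    qed
  qed
  define A where "A g = H.functional ((1/2) \<odot>\<^bsub>H\<^esub> S (Q g) \<oplus>\<^bsub>H\<^esub> (1/2) \<odot>\<^bsub>H\<^esub> T (Q g))" for g
  define B where "B g = H.functional ((1/2) \<odot>\<^bsub>H\<^esub> S (Q g) \<oplus>\<^bsub>H\<^esub> (-1/2) \<odot>\<^bsub>H\<^esub> T (Q g))" for g
  note simps = L.Q_add L.Q_scale L.Q_functional SD TD H.functional_add H.functional_smult
  have SS: "S (S x) = T (T x)" and ST: "S (T x) = T (S x)" if "x \<in> carrier H" for x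
    using that comm squares by (auto simp: operators_commute_def equal_squares_def)
  have QA: "Q (A g) = (1/2) \<odot>\<^bsub>H\<^esub> S (Q g) \<oplus>\<^bsub>H\<^esub> (1/2) \<odot>\<^bsub>H\<^esub> T (Q g)"
    and QB: "Q (B g) = (1/2) \<odot>\<^bsub>H\<^esub> S (Q g) \<oplus>\<^bsub>H\<^esub> (-1/2) \<odot>\<^bsub>H\<^esub> T (Q g)" for g
    by (simp_all add: A_def B_def L.Q_functional SD TD)
  interpret P: contractive_pencil fscale L.ip A B
  proof
    fix x y :: "'a \<Rightarrow> complex" and c \<mu> :: complex
    show "A (x + y) = A x + A y" "A (fscale c x) = fscale c (A x)" "B (x + y) = B x + B y" "B (fscale c x) = fscale c (B x)"
      by (simp_all add: A_def B_def simps fun_eq_iff algebra_simps)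
    show "A (B x) = 0" "B (A x) = 0"
      unfolding A_def[of "B x"] B_def[of "A x"] QA QB by (simp_all add: simps SS ST fun_eq_iff algebra_simps)
    assume m: "cmod \<mu> = 1"
    define z where "z = (1 + \<mu>) / 2"
    have zm: "z - 1/2 = \<mu> / 2" by (simp add: z_def add_divide_distrib)
    have z: "cmod (z - 1/2) = 1/2" unfolding zm using m by (simp add: norm_divide)
    have "H.functional (Q (A x + fscale \<mu> (B x))) = H.functional (z \<odot>\<^bsub>H\<^esub> S (Q x) \<oplus>\<^bsub>H\<^esub> (1 - z) \<odot>\<^bsub>H\<^esub> T (Q x))"
      unfolding L.Q_add L.Q_scale QA QB by (simp add: simps fun_eq_iff z_def field_simps)
    then have "Q (A x + fscale \<mu> (B x)) = z \<odot>\<^bsub>H\<^esub> S (Q x) \<oplus>\<^bsub>H\<^esub> (1 - z) \<odot>\<^bsub>H\<^esub> T (Q x)"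
      by (rule H.functional_inject[rotated 2]) (simp_all add: SD TD)
    then have "L.form.seminorm (A x + fscale \<mu> (B x)) \<le> L.form.seminorm x"
      using pointwise[OF z, of "Q x"] by (simp add: L.seminorm_eq_hnorm)
    then show "L.form.sq (A x + fscale \<mu> (B x)) \<le> L.form.sq x"
      by (simp add: L.form.seminorm_def)
  qed
  obtain \<kappa> :: "bool \<times> int \<Rightarrow> bool \<times> int \<Rightarrow> ('a \<Rightarrow> complex) \<Rightarrow> ('a \<Rightarrow> complex) \<Rightarrow> complex"
    where k: "operator_kernel fscale \<kappa>"
    "\<And>s t m n k x y. \<kappa> (s, m + k) (t, n + k) x y = \<kappa> (s, m) (t, n) x y"
    "\<And>s t m n x y. s \<noteq> t \<Longrightarrow> \<kappa> (s, m) (t, n) x y = 0"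
    "\<And>x y. \<kappa> (True, 0) (True, 0) x y + \<kappa> (False, 0) (False, 0) x y = L.ip x y"
    "\<And>n x y. n > 0 \<Longrightarrow> \<kappa> (True, int n) (True, 0) x y = L.ip ((A ^^ n) x) y"
    "\<And>n x y. n > 0 \<Longrightarrow> \<kappa> (False, int n) (False, 0) x y = L.ip ((B ^^ n) x) y"
    "\<And>p q x y y'. L.form.sq (y - y') = 0 \<Longrightarrow> \<kappa> p q x y = \<kappa> p q x y'"
    by (rule P.dilation_kernel) blast
  interpret K: bilateral_kernel H Q \<kappa>
    by (rule bilateral_kernel.intro[OF L.linearized_hilbert_space_axioms k(1)], unfold_locales) (fact k)+
  let ?K = "K.W.completion"
  define e where "e b = (if b then 1 else -1 :: complex)" for b
  let ?U = "K.signed_shift (\<lambda>_. 1)" and ?V = "K.signed_shift e"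
  have HK: "hilbert_space ?K" by (rule K.W.completion_hilbert_space)
  have U: "unitary ?K ?U" by (rule K.signed_shift_unitary) simp
  have V: "unitary ?K ?V" by (rule K.signed_shift_unitary) (simp add: e_def)
  have iso: "isometry H ?K K.embed" by (rule K.embed_isometry)
  then have bi: "bounded_operator H ?K K.embed" by (simp add: isometry_def)
  obtain \<iota>' where adj: "is_adjoint H ?K K.embed \<iota>'" using adjoint_exists[OF H HK bi] .
  have Uc: "?U f \<in> carrier ?K" and Vc: "?V f \<in> carrier ?K" if "f \<in> carrier ?K" for f
  proof -
    have "bounded_operator ?K ?K ?U" "bounded_operator ?K ?K ?V" using U V by (simp_all only: unitary_def)
    from bounded_operatorD(1)[OF this(1) that] bounded_operatorD(1)[OF this(2) that]
    show "?U f \<in> carrier ?K" "?V f \<in> carrier ?K" .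
  qed
  have powers_H: "H.functional ((S ^^ j) ((T ^^ i) x)) = ((\<lambda>v. A v + B v) ^^ j) (((\<lambda>v. A v - B v) ^^ i) (H.functional x))"
    if x: "x \<in> carrier H" for i j x
  proof -
    have Tc: "(T ^^ i) x \<in> carrier H" for i using TD(1) x by (rule funpow_closed)
    have Sc: "(S ^^ j) ((T ^^ i) x) \<in> carrier H" for i j using SD(1) Tc by (rule funpow_closed)
    have step: "H.functional (S u) = A (H.functional u) + B (H.functional u)"
      "H.functional (T u) = A (H.functional u) - B (H.functional u)" if "u \<in> carrier H" for u
      using that by (simp_all add: A_def B_def simps fun_eq_iff)
    have "H.functional ((T ^^ i) x) = ((\<lambda>v. A v - B v) ^^ i) (H.functional x)"
      by (induction i) (simp_all add: step Tc)
    then show ?thesis by (induction j) (simp_all add: step Sc)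
  qed
  have moments: "cinner ?K ((?U ^^ j) ((?V ^^ i) (K.embed x))) (K.embed y) = cinner H ((S ^^ j) ((T ^^ i) x)) y"
    if x: "x \<in> carrier H" and y: "y \<in> carrier H" for i j x y
  proof -
    have "(?U ^^ j) ((?V ^^ i) (K.embed x)) = K.W.hat (K.lift (i + j) ((-1) ^ i) (H.functional x))"
      by (simp add: K.embed_def K.signed_shift_powers e_def)
    then have "cinner ?K ((?U ^^ j) ((?V ^^ i) (K.embed x))) (K.embed y)
        = \<kappa> (True, int (i + j)) (True, 0) (H.functional x) (H.functional y)
          + (-1) ^ i * \<kappa> (False, int (i + j)) (False, 0) (H.functional x) (H.functional y)"
      by (simp only: K.embed_def K.W.completion_simps K.W.inner_hat K.form_lift)
    also have "\<dots> = L.ip (((\<lambda>v. A v + B v) ^^ j) (((\<lambda>v. A v - B v) ^^ i) (H.functional x))) (H.functional y)"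
    proof (cases "i + j = 0")
      case True
      then show ?thesis by (simp add: k(4))
    next
      case False
      then have pos: "0 < i + j" by simp
      show ?thesis
        unfolding P.pencil_powers if_not_P[OF False]
        by (simp only: k(5)[OF pos] k(6)[OF pos] L.form.add_left L.form.scale_left)
    qed
    also have "\<dots> = cinner H ((S ^^ j) ((T ^^ i) x)) y"
    proof -
      have "(S ^^ j) ((T ^^ i) x) \<in> carrier H" by (intro funpow_closed SD(1) TD(1) x)
      then show ?thesis using y by (simp add: L.cinner_eq_ip powers_H[OF x])
    qed
    finally show ?thesis .
  qed
  have "poly_op H p S T x = \<iota>' (poly_op ?K p ?U ?V (K.embed x))" if x: "x \<in> carrier H" for p x
  proof -
    interpret HK: hilbert_space ?K by (rule HK)
    have emb: "K.embed y \<in> carrier ?K" for y by (simp add: K.embed_space)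
    have pH: "poly_op H p S T x \<in> carrier H" by (rule poly_op_closed[OF H SD(1) TD(1) x])
    have pK: "poly_op ?K p ?U ?V (K.embed x) \<in> carrier ?K" by (rule poly_op_closed[OF HK Uc Vc emb])
    have i: "\<iota>' (poly_op ?K p ?U ?V (K.embed x)) \<in> carrier H"
      using adj pK unfolding is_adjoint_def by (blast dest: bounded_operatorD(1))
    show ?thesis
    proof (rule H.eq_by_cinner[OF pH i])
      fix y assume y: "y \<in> carrier H"
      have "cinner H (poly_op H p S T x) y = cinner ?K (poly_op ?K p ?U ?V (K.embed x)) (K.embed y)"
        by (simp only: cinner_poly_op[OF H SD(1) TD(1) x y] cinner_poly_op[OF HK Uc Vc emb emb] moments[OF x y])
      then have "cinner H y (poly_op H p S T x) = cinner ?K (K.embed y) (poly_op ?K p ?U ?V (K.embed x))"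
        using H.cinner_commute[OF y pH] HK.cinner_commute[OF emb[of y] pK] by simp
      also have "\<dots> = cinner H y (\<iota>' (poly_op ?K p ?U ?V (K.embed x)))"
        using adj y pK by (simp add: is_adjoint_def)
      finally show "cinner H y (poly_op H p S T x) = cinner H y (\<iota>' (poly_op ?K p ?U ?V (K.embed x)))" .
    qed
  qed
  then have D: "dilates_to H S T ?K ?U ?V" unfolding dilates_to_def using iso adj by blast
  have "operators_commute ?K ?U ?V" by (simp add: operators_commute_def K.signed_shift_commute)
  moreover have "equal_squares ?K ?U ?V"
    unfolding equal_squares_def by (intro ballI K.signed_shift_squares) (simp add: e_def)
  ultimately show ?thesis unfolding dilates_to_unitaries_def using HK U V D by blast
qed

theorem corollary6p11:
  fixes H :: "'a hilbert" and S T :: "'a \<Rightarrow> 'a"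
  assumes "hilbert_space H"
    and "bounded_operator H H S" and "bounded_operator H H T"
    and "operators_commute H S T" and "equal_squares H S T"
  shows
    "(dilates_to_unitaries TYPE(nat \<times> 'a \<Rightarrow> complex) H S T \<longleftrightarrow>
       (\<forall>z::complex. cmod (z - 1/2) = 1/2 \<longrightarrow>
         operator_norm H H (\<lambda>x. z \<odot>\<^bsub>H\<^esub> S x \<oplus>\<^bsub>H\<^esub> (1 - z) \<odot>\<^bsub>H\<^esub> T x) \<le> 1))
     \<and> (dilates_to_unitaries TYPE('k) H S T \<longrightarrow>
       (\<forall>z::complex. cmod (z - 1/2) = 1/2 \<longrightarrow>
         operator_norm H H (\<lambda>x. z \<odot>\<^bsub>H\<^esub> S x \<oplus>\<^bsub>H\<^esub> (1 - z) \<odot>\<^bsub>H\<^esub> T x) \<le> 1))"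
  using dilation_imp_contractive[OF assms(1-3), where 'k = "nat \<times> 'a \<Rightarrow> complex"]
    dilation_imp_contractive[OF assms(1-3), where 'k = 'k] contractive_imp_dilation[OF assms] by blast

end
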